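(* A PBW basis for $\mathcal A_q$ is obtained by its alternating generators $\mathcal W_{-k},\ \mathcal W_{k+1},\ \mathcal G_{k+1},\ \mathcal{\tilde G}_{k+1}$ $(k\in\mathbb N)$ in any linear order $<$ such that $$\mathcal G_{i+1} < \mathcal W_{-j} < \mathcal W_{k+1} < \mathcal{\tilde G}_{\ell+1}\qquad (i,j,k,\ell\in\mathbb N).$$
   Context: Conventions: $\mathbb N=\{0,1,2,\ldots\}$; $\mathbb F$ is a field; $q\in\mathbb F$ is nonzero and not a root of unity; all algebras are associative, unital, over $\mathbb F$. Write $[X,Y]=XY-YX$ and $[X,Y]_q=qXY-q^{-1}YX$. A Poincaré-Birkhoff-Witt (PBW) basis for an algebra $\mathcal A$ consists of a subset $\Omega\subseteq\mathcal A$ and a linear order $<$ on $\Omega$ such that the products $a_1a_2\cdots a_n$ with $n\in\mathbb N$, $a_1,\ldots,a_n\in\Omega$, $a_1\le a_2\le\cdots\le a_n$ form a basis for the vector space $\mathcal A$ (the empty product is the identity $1$). The algebra $\mathcal A_q$ is defined by generators (called alternating) $\{\mathcal W_{-k}\}_{k\in\mathbb N}$, $\{\mathcal W_{k+1}\}_{k\in\mathbb N}$, $\{\mathcal G_{k+1}\}_{k\in\mathbb N}$, $\{\mathcal{\tilde G}_{k+1}\}_{k\in\mathbb N}$ and the following relations for $k,\ell\in\mathbb N$, where $\rho=-(q^2-q^{-2})^2$: $[\mathcal W_0,\mathcal W_{k+1}]=[\mathcal W_{-k},\mathcal W_1]=(\mathcal{\tilde G}_{k+1}-\mathcal G_{k+1})/(q+q^{-1})$;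 $[\mathcal W_0,\mathcal G_{k+1}]_q=[\mathcal{\tilde G}_{k+1},\mathcal W_0]_q=\rho\mathcal W_{-k-1}-\rho\mathcal W_{k+1}$; $[\mathcal G_{k+1},\mathcal W_1]_q=[\mathcal W_1,\mathcal{\tilde G}_{k+1}]_q=\rho\mathcal W_{k+2}-\rho\mathcal W_{-k}$; $[\mathcal W_{-k},\mathcal W_{-\ell}]=0$, $[\mathcal W_{k+1},\mathcal W_{\ell+1}]=0$; $[\mathcal W_{-k},\mathcal W_{\ell+1}]+[\mathcal W_{k+1},\mathcal W_{-\ell}]=0$; $[\mathcal W_{-k},\mathcal G_{\ell+1}]+[\mathcal G_{k+1},\mathcal W_{-\ell}]=0$; $[\mathcal W_{-k},\mathcal{\tilde G}_{\ell+1}]+[\mathcal{\tilde G}_{k+1},\mathcal W_{-\ell}]=0$; $[\mathcal W_{k+1},\mathcal G_{\ell+1}]+[\mathcal G_{k+1},\mathcal W_{\ell+1}]=0$; $[\mathcal W_{k+1},\mathcal{\tilde G}_{\ell+1}]+[\mathcal{\tilde G}_{k+1},\mathcal W_{\ell+1}]=0$; $[\mathcal G_{k+1},\mathcal G_{\ell+1}]=0$, $[\mathcal{\tilde G}_{k+1},\mathcal{\tilde G}_{\ell+1}]=0$; $[\mathcal{\tilde G}_{k+1},\mathcal G_{\ell+1}]+[\mathcal G_{k+1},\mathcal{\tilde G}_{\ell+1}]=0$. *)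

theory Defs
  imports
    "HOL-Library.Poly_Mapping"
    "HOL-Algebra.QuotRing"
    "Jordan_Normal_Form.VS_Connect"
begin

text \<open>
  Words are lists wrapped in a new type, so that concatenation can be the operation of a
  \<^class>\<open>monoid_add\<close>. Then finitely supported functions on words, with the convolution
  product of \<^theory>\<open>HOL-Library.Poly_Mapping\<close>, are the free associative unital algebra.
\<close>

datatype 'x word = Word "'x list"

instantiation word :: (type) monoid_add
begin

definition zero_word :: "'x word" where
  "zero_word = Word []"

fun plus_word :: "'x word \<Rightarrow> 'x word \<Rightarrow> 'x word" where
  "plus_word (Word u) (Word v) = Word (u @ v)"

instance
proof
  fix a b c :: "'x word"
  show "a + b + c = a + (b + c)" by (cases a; cases b; cases c) simp
  show "0 + a = a" by (cases a) (simp add: zero_word_def)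
  show "a + 0 = a" by (cases a) (simp add: zero_word_def)
qed

end

type_synonym ('f, 'x) free_algebra = "'x word \<Rightarrow>\<^sub>0 'f"

definition var :: "'x \<Rightarrow> ('f::field, 'x) free_algebra" where
  "var x = Poly_Mapping.single (Word [x]) 1"

text \<open>The scalar \<open>c\<close> as a multiple of the empty word; it acts on the free algebra by multiplication.\<close>

definition const :: "'f::field \<Rightarrow> ('f, 'x) free_algebra" where
  "const c = Poly_Mapping.single 0 c"

definition comm :: "('f::field, 'x) free_algebra \<Rightarrow> ('f, 'x) free_algebra \<Rightarrow> ('f, 'x) free_algebra" where
  "comm X Y = X * Y - Y * X"

definition qcomm :: "'f::field \<Rightarrow> ('f, 'x) free_algebra \<Rightarrow> ('f, 'x) free_algebra \<Rightarrow> ('f, 'x) free_algebra" where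
  "qcomm q X Y = const q * X * Y - const (inverse q) * Y * X"

text \<open>
  \<open>Wneg k\<close>, \<open>Wpos k\<close>, \<open>G k\<close>, \<open>Gt k\<close> stand for \<open>W\<close> with index \<open>-k\<close>, \<open>W\<close> with index \<open>k+1\<close>,
  \<open>G\<close> with index \<open>k+1\<close>, and \<open>G\<close>-tilde with index \<open>k+1\<close>, respectively. Note the shift in the last
  three: the generator written \<open>W\<close> with index \<open>1\<close> is \<open>Wpos 0\<close>.
\<close>

datatype alt_gen = Wneg nat | Wpos nat | G nat | Gt nat

definition rho :: "'f::field \<Rightarrow> 'f" where
  "rho q = - ((q\<^sup>2 - inverse (q\<^sup>2))\<^sup>2)"

text \<open>\<open>aq_rel q X Y\<close>: the equation \<open>X = Y\<close> is one of the defining relations.\<close>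

inductive aq_rel :: "'f::field \<Rightarrow> ('f, alt_gen) free_algebra \<Rightarrow> ('f, alt_gen) free_algebra \<Rightarrow> bool"
  for q :: 'f where
  "aq_rel q
    (comm (var (Wneg 0)) (var (Wpos k)))
    (const (inverse (q + inverse q)) * (var (Gt k) - var (G k)))"
| "aq_rel q
    (comm (var (Wneg k)) (var (Wpos 0)))
    (const (inverse (q + inverse q)) * (var (Gt k) - var (G k)))"
| "aq_rel q
    (qcomm q (var (Wneg 0)) (var (G k)))
    (const (rho q) * var (Wneg (Suc k)) - const (rho q) * var (Wpos k))"
| "aq_rel q
    (qcomm q (var (Gt k)) (var (Wneg 0)))
    (const (rho q) * var (Wneg (Suc k)) - const (rho q) * var (Wpos k))"
| "aq_rel q
    (qcomm q (var (G k)) (var (Wpos 0)))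
    (const (rho q) * var (Wpos (Suc k)) - const (rho q) * var (Wneg k))"
| "aq_rel q
    (qcomm q (var (Wpos 0)) (var (Gt k)))
    (const (rho q) * var (Wpos (Suc k)) - const (rho q) * var (Wneg k))"
| "aq_rel q (comm (var (Wneg k)) (var (Wneg l))) 0"
| "aq_rel q (comm (var (Wpos k)) (var (Wpos l))) 0"
| "aq_rel q (comm (var (Wneg k)) (var (Wpos l)) + comm (var (Wpos k)) (var (Wneg l))) 0"
| "aq_rel q (comm (var (Wneg k)) (var (G l)) + comm (var (G k)) (var (Wneg l))) 0"
| "aq_rel q (comm (var (Wneg k)) (var (Gt l)) + comm (var (Gt k)) (var (Wneg l))) 0"
| "aq_rel q (comm (var (Wpos k)) (var (G l)) + comm (var (G k)) (var (Wpos l))) 0"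
| "aq_rel q (comm (var (Wpos k)) (var (Gt l)) + comm (var (Gt k)) (var (Wpos l))) 0"
| "aq_rel q (comm (var (G k)) (var (G l))) 0"
| "aq_rel q (comm (var (Gt k)) (var (Gt l))) 0"
| "aq_rel q (comm (var (Gt k)) (var (G l)) + comm (var (G k)) (var (Gt l))) 0"

definition aq_ideal :: "'f::field \<Rightarrow> ('f, alt_gen) free_algebra set" where
  "aq_ideal q = genideal class_ring {X - Y | X Y. aq_rel q X Y}"

text \<open>
  The quotient ring of the free algebra by the two-sided ideal generated by the relations, made
  into an algebra by letting a scalar \<open>c\<close> act as multiplication by the class of \<open>c\<close>. The record type
  \<^typ>\<open>('f, 'a) module\<close> carries both the ring operations and the scalar multiplication.
\<close>

definition Aq :: "'f::field \<Rightarrow> ('f, ('f, alt_gen) free_algebra set) module" where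
  "Aq q = (let I = aq_ideal q; Q = class_ring Quot I in
     \<lparr>carrier = carrier Q, mult = mult Q, one = one Q, zero = zero Q, add = add Q,
      smult = (\<lambda>c X. (I +>\<^bsub>class_ring\<^esub> const c) \<otimes>\<^bsub>Q\<^esub> X)\<rparr>)"

definition alt :: "'f::field \<Rightarrow> alt_gen \<Rightarrow> ('f, alt_gen) free_algebra set" where
  "alt q x = aq_ideal q +>\<^bsub>class_ring\<^esub> var x"

definition list_prod :: "('a, 'm) monoid_scheme \<Rightarrow> 'a list \<Rightarrow> 'a" where
  "list_prod A as = foldr (mult A) as \<one>\<^bsub>A\<^esub>"

text \<open>
  A linear order is given by its reflexive version \<open>r\<close>. That the products form a basis is meant for
  the family indexed by the weakly increasing lists, hence the injectivity condition.
\<close>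

definition pbw_basis :: "('f::field, 'a) module \<Rightarrow> 'a set \<Rightarrow> 'a rel \<Rightarrow> bool" where
  "pbw_basis A \<Omega> r \<longleftrightarrow>
     \<Omega> \<subseteq> carrier A \<and> linear_order_on \<Omega> r \<and>
     (let S = {as. set as \<subseteq> \<Omega> \<and> sorted_wrt (\<lambda>a b. (a, b) \<in> r) as} in
        inj_on (list_prod A) S \<and> vectorspace.basis class_ring A (list_prod A ` S))"

lemma const_add: "const (a + b) = const a + const b"
  by (simp add: const_def single_add)

lemma const_mult: "const (a * b) = const a * const b"
  by (simp add: const_def mult_single)

lemma const_one: "const 1 = 1"
  by (simp add: const_def)

lemma const_central:
  fixes X :: "('f::field, 'x) free_algebra"
  shows "const c * X = X * const c"
proof (induction X rule: update_induct)
  case const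
  show ?case by simp
next
  case (update X w a)
  have "Poly_Mapping.update w a X = X + Poly_Mapping.single w a"
    using update(1) by (intro poly_mapping_eqI)
      (auto simp: lookup_add lookup_single lookup_update when_def in_keys_iff)
  with update(3) show ?case
    by (simp add: distrib_left distrib_right const_def mult_single mult.commute)
qed

lemma ideal_aq_ideal: "ideal (aq_ideal q) class_ring"
  unfolding aq_ideal_def by (rule ring.genideal_ideal[OF class_ring.ring_axioms]) simp

lemma Aq_simps:
  "carrier (Aq q) = carrier (class_ring Quot aq_ideal q)"
  "mult (Aq q) = mult (class_ring Quot aq_ideal q)"
  "one (Aq q) = one (class_ring Quot aq_ideal q)"
  "zero (Aq q) = zero (class_ring Quot aq_ideal q)"
  "add (Aq q) = add (class_ring Quot aq_ideal q)"
  "smult (Aq q) c X = (aq_ideal q +>\<^bsub>class_ring\<^esub> const c) \<otimes>\<^bsub>class_ring Quot aq_ideal q\<^esub> X"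
  by (simp_all add: Aq_def Let_def)

lemma ring_Aq: "ring (Aq q)"
proof -
  interpret Q: ring "class_ring Quot aq_ideal q"
    by (rule ideal.quotient_is_ring[OF ideal_aq_ideal])
  have inv: "\<exists>y\<in>carrier (class_ring Quot aq_ideal q).
      y \<oplus>\<^bsub>class_ring Quot aq_ideal q\<^esub> x = \<zero>\<^bsub>class_ring Quot aq_ideal q\<^esub>"
    if "x \<in> carrier (class_ring Quot aq_ideal q)" for x
    using Q.l_neg[OF that] Q.a_inv_closed[OF that] by blast
  show ?thesis
    by (intro ringI abelian_groupI Group.monoidI)
      (auto simp: Aq_simps Q.m_assoc Q.l_distr Q.r_distr Q.a_ac intro: inv)
qed

lemma vectorspace_Aq: "vectorspace class_ring (Aq q)"
  and Aq_smult_mult: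
    "\<lbrakk>X \<in> carrier (Aq q); Y \<in> carrier (Aq q)\<rbrakk> \<Longrightarrow>
      smult (Aq q) c (mult (Aq q) X Y) = mult (Aq q) (smult (Aq q) c X) Y"
    "\<lbrakk>X \<in> carrier (Aq q); Y \<in> carrier (Aq q)\<rbrakk> \<Longrightarrow>
      smult (Aq q) c (mult (Aq q) X Y) = mult (Aq q) X (smult (Aq q) c Y)"
proof -
  interpret R: ring "class_ring :: ('a, alt_gen) free_algebra ring" by (rule class_ring.ring_axioms)
  let ?Q = "class_ring Quot aq_ideal q"
  interpret Q: ring ?Q by (rule ideal.quotient_is_ring[OF ideal_aq_ideal])
  interpret A: ring "Aq q" by (rule ring_Aq)
  define \<pi> where "\<pi> = a_r_coset class_ring (aq_ideal q)"
  interpret h: ring_hom_ring class_ring ?Q \<pi>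
    unfolding \<pi>_def by (rule ideal.rcos_ring_hom_ring[OF ideal_aq_ideal])
  have cl: "\<pi> x \<in> carrier ?Q" for x using h.hom_closed[of x] by simp
  have m: "\<pi> (x * y) = \<pi> x \<otimes>\<^bsub>?Q\<^esub> \<pi> y" for x y using h.hom_mult[of x y] by simp
  have a: "\<pi> (x + y) = \<pi> x \<oplus>\<^bsub>?Q\<^esub> \<pi> y" for x y using h.hom_add[of x y] by simp
  have o: "\<pi> 1 = \<one>\<^bsub>?Q\<^esub>" using h.hom_one by simp
  have surj: "\<exists>x. X = \<pi> x" if "X \<in> carrier ?Q" for X
    using that by (auto simp: FactRing_def A_RCOSETS_def' \<pi>_def)
  have central: "\<pi> (const c) \<otimes>\<^bsub>?Q\<^esub> X = X \<otimes>\<^bsub>?Q\<^esub> \<pi> (const c)" if "X \<in> carrier ?Q" for c X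
    using surj[OF that] by (metis m const_central)
  have s: "smult (Aq q) c X = \<pi> (const c) \<otimes>\<^bsub>?Q\<^esub> X" for c X
    by (simp add: Aq_simps \<pi>_def)
  have "module class_ring (Aq q)"
    by (intro moduleI class_cring.cring_axioms A.abelian_group_axioms)
      (simp_all add: s Aq_simps(1-5) cl const_add const_mult const_one a m o
        Q.l_distr Q.r_distr Q.m_assoc)
  then show "vectorspace class_ring (Aq q)"
    by (simp add: vectorspace_def class_field)
  show "smult (Aq q) c (mult (Aq q) X Y) = mult (Aq q) (smult (Aq q) c X) Y"
    if "X \<in> carrier (Aq q)" "Y \<in> carrier (Aq q)"
    using that by (simp add: s Aq_simps(1-5) cl Q.m_assoc)
  show "smult (Aq q) c (mult (Aq q) X Y) = mult (Aq q) X (smult (Aq q) c Y)"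
    if "X \<in> carrier (Aq q)" "Y \<in> carrier (Aq q)"
    using that by (simp add: s Aq_simps(1-5) cl central[of X] Q.m_assoc[symmetric])
qed

end

theory Submission
  imports Defs "HOL-Computational_Algebra.Formal_Power_Series"
begin

text \<open>
  Two things have to be shown: sorted words span the quotient, and they are independent.

  \<^emph>\<open>Spanning.\<close> A commutator of a letter \<open>W\<close> with a letter \<open>G\<close> is symmetric up to a shift of the two
  indices, by the defining relations, and antisymmetric modulo products that are already in the
  wanted order; the two together reduce the indices until the commutator disappears
  (\<open>exchange_span\<close>). Hence letters \<open>G\<close> move to the left of letters \<open>W\<close>, and letters \<open>Gt\<close> to the
  right. The commutator of \<open>Wneg\<close> and \<open>Wpos\<close> is a combination of words in \<open>G\<close> and \<open>Gt\<close> alone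
  (\<open>comm_AB\<close>), so sorting the letters \<open>W\<close> costs only words with fewer of them. A letter \<open>Gt\<close> to the
  left of a letter \<open>G\<close> never has to be exchanged with it, because the first relation writes \<open>Gt\<close>
  through \<open>G\<close> and a commutator of letters \<open>W\<close>. Inside the four blocks the letters commute, so any
  order that respects the blocks will do (\<open>sorted_span\<close>).

  \<^emph>\<open>Independence.\<close> The relations are, up to normalisation, quadratic exchange relations between four
  generating functions \<open>A\<close>, \<open>B\<close>, \<open>C\<close>, \<open>D\<close> with coefficients \<open>Wneg\<close>, \<open>Wpos\<close>, \<open>G\<close>, \<open>Gt\<close>, at two
  values \<open>s\<close>, \<open>t\<close> of the formal variable. Such relations have a coideal structure: from one solution
  and one additional site, carrying a few Laurent variables and a \<open>q\<close>-shift, a new solution arises by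
  a linear formula (\<open>dress\<close>, \<open>exchange_dress\<close>). Starting with \<open>A = B = 0\<close> and \<open>C\<close>, \<open>D\<close> constant, \<open>k\<close>
  sites give a representation of the algebra on Laurent polynomials (\<open>gen_op_rel\<close>). If the variables
  of later sites are given much larger weights, then every generator of index less than \<open>k\<close> acts with
  a single leading term, a monomial times an invertible diagonal operator (\<open>lead_raw_op\<close>). Leading
  terms multiply, so a word has as leading exponent the sum of those of its letters. This sum
  determines the letters with their multiplicities (\<open>mexp_inj\<close>), hence words with different multisets
  of letters are linearly independent modulo the relations (\<open>words_independent\<close>). A sorted word is
  determined by its multiset.
\<close>

section \<open>The coefficient identities behind dressing\<close>

text \<open>
  The four generating functions: \<open>FA\<close> and \<open>FB\<close> collect \<open>Wneg n\<close> and \<open>Wpos n\<close>; \<open>FC\<close> and \<open>FD\<close> collect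
  multiples of \<open>G\<close> and \<open>Gt\<close>, shifted by one so that their coefficients of index \<open>0\<close> are scalars.
\<close>

datatype fam = FA | FB | FC | FD

text \<open>
  The parameters of one site. Intended are \<open>q' = 1/q\<close>, \<open>p = 1/(q + q')\<close> and \<open>V' = 1/V\<close>, all in a
  commutative ring; in addition a site has an invertible \<open>h\<close> with inverse \<open>h'\<close>, and an operator \<open>F\<close>
  with inverse \<open>G\<close> such that \<open>F h = q\<^sup>2 h F\<close>. The dressed function number \<open>j\<close> is
  \<open>N\<^sub>j (\<Sum>\<^sub>a phi j a h h' u X\<^sub>a)\<close>, where \<open>u\<close> is the formal variable, \<open>C\<close> and \<open>D\<close> are multiplied by
  \<open>G\<close> and \<open>F\<close>, and \<open>N\<close> undoes this. All powers of \<open>F\<close> thus stand outside of \<open>phi\<close>, whose entries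
  commute with each other. With \<open>E = e h h' G\<close> one has \<open>E F = e h h'\<close> and \<open>F E = f h h'\<close>, so that, up
  to the factor \<open>V\<close>, the elements \<open>E\<close>, \<open>F\<close>, \<open>h\<close> generate the quantum enveloping algebra of \<open>sl\<^sub>2\<close> with
  Casimir element \<open>c\<close>.
\<close>

locale site_coeffs =
  fixes q q' p V V' c :: "'p::comm_ring_1"
begin
definition e where "e h h' = V * (c - p * (q' * h + q * h'))"
definition f where "f h h' = V * (c - p * (q * h + q' * h'))"

fun phi :: "fam \<Rightarrow> fam \<Rightarrow> 'p \<Rightarrow> 'p \<Rightarrow> 'p \<Rightarrow> 'p" where
  "phi FA FA h h' u = h - u * p * (V + V')"
| "phi FA FB h h' u = u * (c - h)"
| "phi FA FC h h' u = e h h'"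
| "phi FA FD h h' u = q * V' * h"
| "phi FB FA h h' u = u * (c - h')"
| "phi FB FB h h' u = h' - u * p * (V + V')"
| "phi FB FC h h' u = q * V' * h' * e h h'"
| "phi FB FD h h' u = 1"
| "phi FC FA h h' u = u * q' * h - u * u * V'"
| "phi FC FB h h' u = u * V' - u * u * q' * h"
| "phi FC FC h h' u = 1 - u * p * (V * q'^2 * h + V' * q^2 * h')"
| "phi FC FD h h' u = u * V' * h"
| "phi FD FA h h' u = (u * V' - u * u * q' * h') * f h h'"
| "phi FD FB h h' u = (u * q' * h' - u * u * V') * f h h'"
| "phi FD FC h h' u = u * V' * h' * f h h' * e h h'"
| "phi FD FD h h' u = 1 - u * p * (V * q'^2 * h' + V' * q^2 * h)"

text \<open>
  How the pair \<open>(h, h')\<close> changes when it is moved past the factor \<open>G\<close> or \<open>F\<close> that belongs to a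
  function. In a product of two dressed functions, \<open>pair_coeff\<close> is the resulting coefficient of
  \<open>X\<^sub>a X\<^sub>b\<close> after everything has been moved into standard position.
\<close>

fun h_shift where "h_shift FC (h, h') = (q'^2*h, q^2*h')" | "h_shift FD (h, h') = (q^2*h, q'^2*h')" | "h_shift _ z = z"

definition pair_coeff where "pair_coeff i j a b h h' u v = case_prod (phi i a) (h_shift j (h,h')) u * case_prod (phi j b) (h_shift a (h,h')) v"

end

text \<open>
  Tables \<open>T\<close>, \<open>U\<close> of coefficients for which \<open>\<Sum> T\<^sub>a\<^sub>b X\<^sub>a Y\<^sub>b + \<Sum> U\<^sub>a\<^sub>b Y\<^sub>a X\<^sub>b\<close> vanishes as a consequence of
  the exchange relations. The relations turn each product of two functions into a standard order, so
  that the condition says that the coefficients of the remaining products are zero, after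
  multiplication by \<open>s - t\<close>. Being conditions in a commutative ring, they can be decided by
  computation with polynomials.
\<close>

definition exchange_zero :: "'p::comm_ring_1 \<Rightarrow> 'p \<Rightarrow> 'p \<Rightarrow> 'p \<Rightarrow> (fam \<Rightarrow> fam \<Rightarrow> 'p) \<Rightarrow> (fam \<Rightarrow> fam \<Rightarrow> 'p) \<Rightarrow> bool"
  where "exchange_zero q q' s t T U \<longleftrightarrow> (let
   u = q' * (s * U FA FC + t * T FA FC); v = q * (s * U FB FC + t * T FB FC) in
    (s-t) * (T FC FA + U FA FC) = (q-q') * (u + t * v) \<and>
   (s-t) * (U FC FA + T FA FC) = - (q-q') * (u + s * v) \<and>
   (s-t) * (T FC FB + U FB FC) = - (q-q') * (t * u + v) \<and>
   (s-t) * (U FC FB + T FB FC) = (q-q') * (s * u + v)) \<and>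
  (let u = q' * (s * T FD FA + t * U FD FA); v = q * (s * T FD FB + t * U FD FB) in
    (s-t) * (U FA FD + T FD FA) = (q-q') * (u + t * v) \<and>
   (s-t) * (T FA FD + U FD FA) = - (q-q') * (u + s * v) \<and>
   (s-t) * (U FB FD + T FD FB) = - (q-q') * (t * u + v) \<and>
   (s-t) * (T FB FD + U FD FB) = (q-q') * (s * u + v)) \<and>
  (let g = (q-q') * (T FB FA + U FB FA); k = (q-q') * s * t * (T FD FC + U FD FC) in
   (s-t) * (T FA FB + U FB FA) = - (1 - s*t) * k \<and>
   (s-t) * (U FA FB + T FB FA) = (1 - s*t) * k \<and>
   T FA FA + U FA FA = - k \<and>
   T FB FB + U FB FB = k \<and>
   (s-t) * (T FC FD + U FD FC) = - g \<and>
   (s-t) * (U FC FD + T FD FC) = g) \<and>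
   T FC FC + U FC FC = 0 \<and> T FD FD + U FD FD = 0"

locale coefs = site_coeffs q q' p V V' c for q q' p V V' c :: "'p::idom" +
  fixes s t :: 'p
  assumes qq: "q * q' = 1" and p: "p * (q + q') = 1" and VV: "V * V' = 1"
begin

abbreviation "vanishes \<equiv> exchange_zero q q' s t"

text \<open>
  One lemma for each exchange relation that a dressed family has to satisfy: expanded in the
  undressed functions, the relation is a bilinear expression whose coefficients are of the form
  \<open>exchange_zero\<close>. Every claim is a polynomial identity modulo the relations for the inverses.
\<close>

lemma zero_AA: assumes hh: "h * h' = 1"
  shows "vanishes (\<lambda>a b. (1) * pair_coeff FA FA a b h h' s t) (\<lambda>a b. (-1) * pair_coeff FA FA a b h h' t s)"
  unfolding exchange_zero_def pair_coeff_def Let_def e_def f_def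
  apply (intro conjI)
  apply (simp_all only: h_shift.simps phi.simps split e_def f_def)
  using hh qq p VV
  apply Groebner_Basis.algebra+
  done

lemma zero_BB: assumes hh: "h * h' = 1"
  shows "vanishes (\<lambda>a b. (1) * pair_coeff FB FB a b h h' s t) (\<lambda>a b. (-1) * pair_coeff FB FB a b h h' t s)"
  unfolding exchange_zero_def pair_coeff_def Let_def e_def f_def
  apply (intro conjI)
  apply (simp_all only: h_shift.simps phi.simps split e_def f_def)
  using hh qq p VV
  apply Groebner_Basis.algebra+
  done

lemma zero_CC: assumes hh: "h * h' = 1"
  shows "vanishes (\<lambda>a b. (1) * pair_coeff FC FC a b h h' s t) (\<lambda>a b. (-1) * pair_coeff FC FC a b h h' t s)"
  unfolding exchange_zero_def pair_coeff_def Let_def e_def f_def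
  apply (intro conjI)
  apply (simp_all only: h_shift.simps phi.simps split e_def f_def)
  using hh qq p VV
  apply Groebner_Basis.algebra+
  done

lemma zero_DD: assumes hh: "h * h' = 1"
  shows "vanishes (\<lambda>a b. (1) * pair_coeff FD FD a b h h' s t) (\<lambda>a b. (-1) * pair_coeff FD FD a b h h' t s)"
  unfolding exchange_zero_def pair_coeff_def Let_def e_def f_def
  apply (intro conjI)
  apply (simp_all only: h_shift.simps phi.simps split e_def f_def)
  using hh qq p VV
  apply Groebner_Basis.algebra+
  done

lemma zero_AB: assumes hh: "h * h' = 1"
  shows "vanishes (\<lambda>a b. (s-t) * pair_coeff FA FB a b h h' s t + (q-q') * pair_coeff FC FD a b h h' s t) (\<lambda>a b. (-(s-t)) * pair_coeff FB FA a b h h' t s + (-(q-q')) * pair_coeff FC FD a b h h' t s)"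
  unfolding exchange_zero_def pair_coeff_def Let_def e_def f_def
  apply (intro conjI)
  apply (simp_all only: h_shift.simps phi.simps split e_def f_def)
  using hh qq p VV
  apply Groebner_Basis.algebra+
  done

lemma zero_CA: assumes hh: "h * h' = 1"
  shows "vanishes (\<lambda>a b. (s-t) * pair_coeff FC FA a b h h' s t + (-((q-q')*q'*s)) * pair_coeff FC FA a b h h' s t + ((q-q')*q'*s*t) * pair_coeff FC FB a b h h' s t) (\<lambda>a b. (-(s-t)) * pair_coeff FA FC a b h h' t s + ((q-q')*q'*s) * pair_coeff FC FA a b h h' t s + (-((q-q')*q'*s*s)) * pair_coeff FC FB a b h h' t s)"
  unfolding exchange_zero_def pair_coeff_def Let_def e_def f_def
  apply (intro conjI)
  apply (simp_all only: h_shift.simps phi.simps split e_def f_def)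
  using hh qq p VV
  apply Groebner_Basis.algebra+
  done

lemma zero_CB: assumes hh: "h * h' = 1"
  shows "vanishes (\<lambda>a b. (s-t) * pair_coeff FC FB a b h h' s t + (((q-q')*q*s)) * pair_coeff FC FB a b h h' s t + (-((q-q')*q*s*t)) * pair_coeff FC FA a b h h' s t) (\<lambda>a b. (-(s-t)) * pair_coeff FB FC a b h h' t s + (-((q-q')*q*s)) * pair_coeff FC FB a b h h' t s + (((q-q')*q*s*s)) * pair_coeff FC FA a b h h' t s)"
  unfolding exchange_zero_def pair_coeff_def Let_def e_def f_def
  apply (intro conjI)
  apply (simp_all only: h_shift.simps phi.simps split e_def f_def)
  using hh qq p VV
  apply Groebner_Basis.algebra+
  done

lemma zero_AD: assumes hh: "h * h' = 1"
  shows "vanishes (\<lambda>a b. (-(s-t)) * pair_coeff FD FA a b h h' s t + ((q-q')*q'*s) * pair_coeff FA FD a b h h' s t + (-((q-q')*q'*s*s)) * pair_coeff FB FD a b h h' s t) (\<lambda>a b. (s-t) * pair_coeff FA FD a b h h' t s + (-((q-q')*q'*s)) * pair_coeff FA FD a b h h' t s + ((q-q')*q'*s*t) * pair_coeff FB FD a b h h' t s)"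
  unfolding exchange_zero_def pair_coeff_def Let_def e_def f_def
  apply (intro conjI)
  apply (simp_all only: h_shift.simps phi.simps split e_def f_def)
  using hh qq p VV
  apply Groebner_Basis.algebra+
  done

lemma zero_BD: assumes hh: "h * h' = 1"
  shows "vanishes (\<lambda>a b. (-(s-t)) * pair_coeff FD FB a b h h' s t + (-((q-q')*q*s)) * pair_coeff FB FD a b h h' s t + (((q-q')*q*s*s)) * pair_coeff FA FD a b h h' s t) (\<lambda>a b. (s-t) * pair_coeff FB FD a b h h' t s + (((q-q')*q*s)) * pair_coeff FB FD a b h h' t s + (-((q-q')*q*s*t)) * pair_coeff FA FD a b h h' t s)"
  unfolding exchange_zero_def pair_coeff_def Let_def e_def f_def
  apply (intro conjI)
  apply (simp_all only: h_shift.simps phi.simps split e_def f_def)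
  using hh qq p VV
  apply Groebner_Basis.algebra+
  done

lemma zero_CD: assumes hh: "h * h' = 1"
  shows "vanishes (\<lambda>a b. (s-t) * pair_coeff FC FD a b h h' s t + ((q-q')*s*t*(1-s*t)) * pair_coeff FA FB a b h h' s t + ((q-q')*s*t*(s-t)) * pair_coeff FA FA a b h h' s t + (-((q-q')*s*t*(s-t))) * pair_coeff FB FB a b h h' s t) (\<lambda>a b. (-(s-t)) * pair_coeff FD FC a b h h' t s + (-((q-q')*s*t*(1-s*t))) * pair_coeff FA FB a b h h' t s)"
  unfolding exchange_zero_def pair_coeff_def Let_def e_def f_def
  apply (intro conjI)
  apply (simp_all only: h_shift.simps phi.simps split e_def f_def)
  using hh qq p VV
  apply Groebner_Basis.algebra+
  done
end

section \<open>Exchange relations between generating functions\<close>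

lemma sum_fam: "(\<Sum>i\<in>UNIV. f i) = f FA + (f FB + (f FC + (f FD :: 'a::comm_monoid_add)))"
proof -
  have "UNIV = {FA, FB, FC, FD}" using fam.exhaust by auto
  then have "sum f UNIV = sum f {FA, FB, FC, FD}" by (simp only:)
  then show ?thesis by simp
qed

text \<open>
  Ring homomorphisms between structures on types. The source supplies the commuting coefficients, the
  target the operators; \<open>tw T x y\<close> records that moving the coefficient \<open>x\<close> past the operator \<open>T\<close>
  changes it into \<open>y\<close>.
\<close>

locale unital_hom =
  fixes i :: "'p::ring_1 \<Rightarrow> 'b::ring_1"
  assumes i_add: "i (x + y) = i x + i y" and i_mult: "i (x * y) = i x * i y" and i_1: "i 1 = 1"
begin
lemma i_0: "i 0 = 0" using i_add[of 0 0] by simp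
lemma i_minus: "i (- x) = - i x" using i_add[of x "-x"] by (simp add: i_0 eq_neg_iff_add_eq_0 add.commute)
lemma i_diff: "i (x - y) = i x - i y" using i_add[of x "-y"] by (simp add: i_minus)
lemma i_fold: "i x * (i y * w) = i (x * y) * w" by (simp add: i_mult mult.assoc)
lemma i_sum: "i (sum f A) = (\<Sum>a\<in>A. i (f a))"
  by (induction A rule: infinite_finite_induct) (simp_all add: i_add i_0)

definition tw :: "'b \<Rightarrow> 'p \<Rightarrow> 'p \<Rightarrow> bool" where
  "tw T x y \<longleftrightarrow> T * i x = i y * T"

lemma tw_add: "tw T x y \<Longrightarrow> tw T x' y' \<Longrightarrow> tw T (x + x') (y + y')"
  by (simp add: tw_def i_add algebra_simps)
lemma tw_diff: "tw T x y \<Longrightarrow> tw T x' y' \<Longrightarrow> tw T (x - x') (y - y')"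
  by (simp add: tw_def i_diff algebra_simps)
lemma tw_mult: "tw T x y \<Longrightarrow> tw T x' y' \<Longrightarrow> tw T (x * x') (y * y')"
  by (simp add: tw_def i_mult) (metis mult.assoc)
lemma tw_1: "tw T 1 1" by (simp add: tw_def i_1)
lemma tw_power: "tw T x y \<Longrightarrow> tw T (x ^ n) (y ^ n)"
  by (induction n) (auto intro: tw_1 tw_mult)
lemma tw_comp: "tw T y z \<Longrightarrow> tw S x y \<Longrightarrow> tw (T * S) x z"
  unfolding tw_def by (metis mult.assoc)
lemma tw_inverse: "S * T = 1 \<Longrightarrow> T * S = 1 \<Longrightarrow> tw S x y \<Longrightarrow> tw T y x"
  unfolding tw_def by (metis mult.assoc mult_1_left mult_1_right)

lemmas tw_intros = tw_add tw_diff tw_mult tw_1 tw_power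

lemma tw_pass: "tw T z z \<Longrightarrow> i z * T = T * i z" "tw T z z \<Longrightarrow> i z * (T * x) = T * (i z * x)"
  unfolding tw_def by (metis mult.assoc)+

end

text \<open>
  The exchange relations, with \<open>X\<close> the family at \<open>s\<close> and \<open>Y\<close> the family at \<open>t\<close>, multiplied by
  \<open>s - t\<close> to have no denominators. For generating functions with scalar constant terms \<open>C\<^sub>0\<close> and \<open>D\<^sub>0\<close>,
  comparison of coefficients gives the defining relations of the algebra, up to normalisation.
\<close>

definition exchange :: "('p::comm_ring_1 \<Rightarrow> 'b::ring_1) \<Rightarrow> 'p \<Rightarrow> 'p \<Rightarrow> 'p \<Rightarrow> 'p \<Rightarrow> (fam \<Rightarrow> 'b) \<Rightarrow> (fam \<Rightarrow> 'b) \<Rightarrow> bool" where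
  "exchange i q q' s t X Y \<longleftrightarrow>
     (\<forall>a. X a * Y a = Y a * X a) \<and>
     i (s - t) * (X FA * Y FB - Y FB * X FA) = i (q - q') * (Y FC * X FD - X FC * Y FD) \<and>
     i (s - t) * (X FC * Y FA - Y FA * X FC) =
       i ((q - q') * q' * s) * (X FC * Y FA - Y FC * X FA - i t * (X FC * Y FB) + i s * (Y FC * X FB)) \<and>
     i (s - t) * (X FC * Y FB - Y FB * X FC) =
       - i ((q - q') * q * s) * (X FC * Y FB - Y FC * X FB - i t * (X FC * Y FA) + i s * (Y FC * X FA)) \<and>
     i (s - t) * (Y FA * X FD - X FD * Y FA) =
       i ((q - q') * q' * s) * (Y FA * X FD - X FA * Y FD - i t * (Y FB * X FD) + i s * (X FB * Y FD)) \<and>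
     i (s - t) * (Y FB * X FD - X FD * Y FB) =
       - i ((q - q') * q * s) * (Y FB * X FD - X FB * Y FD - i t * (Y FA * X FD) + i s * (X FA * Y FD)) \<and>
     i (s - t) * (X FC * Y FD - Y FD * X FC) =
       - i ((q - q') * s * t) * (i (1 - s * t) * (X FA * Y FB - Y FA * X FB) + i (s - t) * (X FA * Y FA - X FB * Y FB))"

lemma exchangeD:
  assumes "exchange i q q' s t X Y"
  shows "X a * Y a = Y a * X a"
    and "i (s - t) * (X FA * Y FB - Y FB * X FA) = i (q - q') * (Y FC * X FD - X FC * Y FD)"
    and "i (s - t) * (X FC * Y FA - Y FA * X FC) =
       i ((q - q') * q' * s) * (X FC * Y FA - Y FC * X FA - i t * (X FC * Y FB) + i s * (Y FC * X FB))"
    and "i (s - t) * (X FC * Y FB - Y FB * X FC) =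
       - i ((q - q') * q * s) * (X FC * Y FB - Y FC * X FB - i t * (X FC * Y FA) + i s * (Y FC * X FA))"
    and "i (s - t) * (Y FA * X FD - X FD * Y FA) =
       i ((q - q') * q' * s) * (Y FA * X FD - X FA * Y FD - i t * (Y FB * X FD) + i s * (X FB * Y FD))"
    and "i (s - t) * (Y FB * X FD - X FD * Y FB) =
       - i ((q - q') * q * s) * (Y FB * X FD - X FB * Y FD - i t * (Y FA * X FD) + i s * (X FA * Y FD))"
    and "i (s - t) * (X FC * Y FD - Y FD * X FC) =
       - i ((q - q') * s * t) * (i (1 - s * t) * (X FA * Y FB - Y FA * X FB) + i (s - t) * (X FA * Y FA - X FB * Y FB))"
  using assms unfolding exchange_def by blast+

text \<open>
  The expression is multiplied by \<open>s - t\<close>, all products are brought into standard order by the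
  relations for \<open>(s, t)\<close> and for \<open>(t, s)\<close>, and the coefficients are compared. The products fall into
  five groups that the relations do not mix.
\<close>

lemma bilinear_zero:
  fixes i :: "'p::idom \<Rightarrow> 'b::ring_1"
  assumes "unital_hom i"
    and st: "exchange i q q' s t X Y" and ts: "exchange i q q' t s Y X"
    and canc: "\<And>z. i (s - t) * z = 0 \<Longrightarrow> z = 0"
    and exchange_zero: "exchange_zero q q' s t T U"
  shows "(\<Sum>a\<in>UNIV. \<Sum>b\<in>UNIV. i (T a b) * (X a * Y b)) + (\<Sum>a\<in>UNIV. \<Sum>b\<in>UNIV. i (U a b) * (Y a * X b)) = 0"
    (is "?L = 0")
proof -
  interpret unital_hom i by fact
  define d where "d = s - t"
  define h where "h = q - q'"
  have ts_d: "t - s = - d" by (simp add: d_def)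
  note st_e = exchangeD[OF st, folded d_def h_def]
    and ts_e = exchangeD[OF ts, unfolded ts_d mult.commute[of t s], folded h_def]
  define W where "W x y z = i x * (y * z)" for x y z
  have W_add: "W (x + x') y z = W x y z + W x' y z" and W_diff: "W (x - x') y z = W x y z - W x' y z"
   and W_minus: "W (- x) y z = - W x y z" and W_0: "W 0 y z = 0" for x x' y z
    by (simp_all add: W_def i_add i_minus i_diff i_0 algebra_simps)
  have scale: "i c * W x y z = W (c * x) y z" for c x y z by (simp add: W_def i_fold)
  note norm = W_def i_fold right_diff_distrib distrib_left algebra_simps i_add i_diff i_minus
  have u0: "W (d * x) (Y FB) (X FA) = W (d * x) (X FA) (Y FB) + W (h * x) (X FC) (Y FD) - W (h * x) (Y FC) (X FD)" for x
    using st_e(2) [THEN arg_cong[where f = "\<lambda>z. i x * z"]] by (simp add: norm ts_e(1))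
  have u1: "W (d * x) (X FB) (Y FA) = W (d * x) (Y FA) (X FB) + W (h * x) (X FC) (Y FD) - W (h * x) (Y FC) (X FD)" for x
    using ts_e(2) [THEN arg_cong[where f = "\<lambda>z. i x * z"]] by (simp add: norm ts_e(1))
  have u2: "W (d * x) (Y FA) (X FC) = W (d * x) (X FC) (Y FA) - W (h * q' * s * x) (X FC) (Y FA) + W (h * q' * s * x) (Y FC) (X FA) + W (h * q' * s * t * x) (X FC) (Y FB) - W (h * q' * s * s * x) (Y FC) (X FB)" for x
    using st_e(3) [THEN arg_cong[where f = "\<lambda>z. i x * z"]] by (simp add: norm ts_e(1))
  have u3: "W (d * x) (X FA) (Y FC) = W (d * x) (Y FC) (X FA) - W (h * q' * t * x) (X FC) (Y FA) + W (h * q' * t * x) (Y FC) (X FA) + W (h * q' * t * t * x) (X FC) (Y FB) - W (h * q' * t * s * x) (Y FC) (X FB)" for x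
    using ts_e(3) [THEN arg_cong[where f = "\<lambda>z. i x * z"]] by (simp add: norm ts_e(1))
  have u4: "W (d * x) (Y FB) (X FC) = W (d * x) (X FC) (Y FB) + W (h * q * s * x) (X FC) (Y FB) - W (h * q * s * x) (Y FC) (X FB) - W (h * q * s * t * x) (X FC) (Y FA) + W (h * q * s * s * x) (Y FC) (X FA)" for x
    using st_e(4) [THEN arg_cong[where f = "\<lambda>z. i x * z"]] by (simp add: norm ts_e(1))
  have u5: "W (d * x) (X FB) (Y FC) = W (d * x) (Y FC) (X FB) + W (h * q * t * x) (X FC) (Y FB) - W (h * q * t * x) (Y FC) (X FB) - W (h * q * t * t * x) (X FC) (Y FA) + W (h * q * t * s * x) (Y FC) (X FA)" for x
    using ts_e(4) [THEN arg_cong[where f = "\<lambda>z. i x * z"]] by (simp add: norm ts_e(1))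
  have u6: "W (d * x) (X FD) (Y FA) = W (d * x) (Y FA) (X FD) - W (h * q' * s * x) (Y FA) (X FD) + W (h * q' * s * x) (X FA) (Y FD) + W (h * q' * s * t * x) (Y FB) (X FD) - W (h * q' * s * s * x) (X FB) (Y FD)" for x
    using st_e(5) [THEN arg_cong[where f = "\<lambda>z. i x * z"]] by (simp add: norm ts_e(1))
  have u7: "W (d * x) (Y FD) (X FA) = W (d * x) (X FA) (Y FD) - W (h * q' * t * x) (Y FA) (X FD) + W (h * q' * t * x) (X FA) (Y FD) + W (h * q' * t * t * x) (Y FB) (X FD) - W (h * q' * t * s * x) (X FB) (Y FD)" for x
    using ts_e(5) [THEN arg_cong[where f = "\<lambda>z. i x * z"]] by (simp add: norm ts_e(1))
  have u8: "W (d * x) (X FD) (Y FB) = W (d * x) (Y FB) (X FD) + W (h * q * s * x) (Y FB) (X FD) - W (h * q * s * x) (X FB) (Y FD) - W (h * q * s * t * x) (Y FA) (X FD) + W (h * q * s * s * x) (X FA) (Y FD)" for x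
    using st_e(6) [THEN arg_cong[where f = "\<lambda>z. i x * z"]] by (simp add: norm ts_e(1))
  have u9: "W (d * x) (Y FD) (X FB) = W (d * x) (X FB) (Y FD) + W (h * q * t * x) (Y FB) (X FD) - W (h * q * t * x) (X FB) (Y FD) - W (h * q * t * t * x) (Y FA) (X FD) + W (h * q * t * s * x) (X FA) (Y FD)" for x
    using ts_e(6) [THEN arg_cong[where f = "\<lambda>z. i x * z"]] by (simp add: norm ts_e(1))
  have u10: "W (d * x) (Y FD) (X FC) = W (d * x) (X FC) (Y FD) + W (h * s * t * (1 - s * t) * x) (X FA) (Y FB) - W (h * s * t * (1 - s * t) * x) (Y FA) (X FB) + W (h * s * t * d * x) (X FA) (Y FA) - W (h * s * t * d * x) (X FB) (Y FB)" for x
    using st_e(7) [THEN arg_cong[where f = "\<lambda>z. i x * z"]] by (simp add: norm ts_e(1))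
  have u11: "W (d * x) (X FD) (Y FC) = W (d * x) (Y FC) (X FD) + W (h * s * t * (1 - s * t) * x) (X FA) (Y FB) - W (h * s * t * (1 - s * t) * x) (Y FA) (X FB) + W (h * s * t * d * x) (X FA) (Y FA) - W (h * s * t * d * x) (X FB) (Y FB)" for x
    using ts_e(7) [THEN arg_cong[where f = "\<lambda>z. i x * z"]] by (simp add: norm ts_e(1))
  have swap: "W x (Y a) (X a) = W x (X a) (Y a)" for x a
    using st_e(1) by (simp add: W_def)
  note g = exchange_zero[unfolded exchange_zero_def Let_def, folded d_def h_def]
  have "i d * (W (T FC FA) (X FC) (Y FA) + W (T FA FC) (X FA) (Y FC) + W (T FC FB) (X FC) (Y FB) + W (T FB FC) (X FB) (Y FC) + W (U FC FA) (Y FC) (X FA) + W (U FA FC) (Y FA) (X FC) + W (U FC FB) (Y FC) (X FB) + W (U FB FC) (Y FB) (X FC))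
    = W (d * (T FC FA + U FA FC) - h * ((q' * (s * U FA FC + t * T FA FC)) + t * (q * (s * U FB FC + t * T FB FC)))) (X FC) (Y FA) + W (d * (U FC FA + T FA FC) + h * ((q' * (s * U FA FC + t * T FA FC)) + s * (q * (s * U FB FC + t * T FB FC)))) (Y FC) (X FA) + W (d * (T FC FB + U FB FC) + h * (t * (q' * (s * U FA FC + t * T FA FC)) + (q * (s * U FB FC + t * T FB FC)))) (X FC) (Y FB) + W (d * (U FC FB + T FB FC) - h * (s * (q' * (s * U FA FC + t * T FA FC)) + (q * (s * U FB FC + t * T FB FC)))) (Y FC) (X FB)"
    unfolding distrib_left scale u0 u1 u2 u3 u4 u5 u6 u7 u8 u9 u10 u11 swap by (simp add: W_add W_diff W_minus algebra_simps)
  also have "\<dots> = 0" using g by (simp add: W_0)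
  finally have CA: "i d * (W (T FC FA) (X FC) (Y FA) + W (T FA FC) (X FA) (Y FC) + W (T FC FB) (X FC) (Y FB) + W (T FB FC) (X FB) (Y FC) + W (U FC FA) (Y FC) (X FA) + W (U FA FC) (Y FA) (X FC) + W (U FC FB) (Y FC) (X FB) + W (U FB FC) (Y FB) (X FC)) = 0" .
  have "i d * (W (T FD FA) (X FD) (Y FA) + W (T FA FD) (X FA) (Y FD) + W (T FD FB) (X FD) (Y FB) + W (T FB FD) (X FB) (Y FD) + W (U FD FA) (Y FD) (X FA) + W (U FA FD) (Y FA) (X FD) + W (U FD FB) (Y FD) (X FB) + W (U FB FD) (Y FB) (X FD))
    = W (d * (U FA FD + T FD FA) - h * ((q' * (s * T FD FA + t * U FD FA)) + t * (q * (s * T FD FB + t * U FD FB)))) (Y FA) (X FD) + W (d * (T FA FD + U FD FA) + h * ((q' * (s * T FD FA + t * U FD FA)) + s * (q * (s * T FD FB + t * U FD FB)))) (X FA) (Y FD) + W (d * (U FB FD + T FD FB) + h * (t * (q' * (s * T FD FA + t * U FD FA)) + (q * (s * T FD FB + t * U FD FB)))) (Y FB) (X FD) + W (d * (T FB FD + U FD FB) - h * (s * (q' * (s * T FD FA + t * U FD FA)) + (q * (s * T FD FB + t * U FD FB)))) (X FB) (Y FD)"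
    unfolding distrib_left scale u0 u1 u2 u3 u4 u5 u6 u7 u8 u9 u10 u11 swap by (simp add: W_add W_diff W_minus algebra_simps)
  also have "\<dots> = 0" using g by (simp add: W_0)
  finally have AD: "i d * (W (T FD FA) (X FD) (Y FA) + W (T FA FD) (X FA) (Y FD) + W (T FD FB) (X FD) (Y FB) + W (T FB FD) (X FB) (Y FD) + W (U FD FA) (Y FD) (X FA) + W (U FA FD) (Y FA) (X FD) + W (U FD FB) (Y FD) (X FB) + W (U FB FD) (Y FB) (X FD)) = 0" .
  have "i d * (W (T FA FB) (X FA) (Y FB) + W (T FB FA) (X FB) (Y FA) + W (T FC FD) (X FC) (Y FD) + W (T FD FC) (X FD) (Y FC) + W (U FA FB) (Y FA) (X FB) + W (U FB FA) (Y FB) (X FA) + W (U FC FD) (Y FC) (X FD) + W (U FD FC) (Y FD) (X FC) + W (T FA FA) (X FA) (Y FA) + W (U FA FA) (Y FA) (X FA) + W (T FB FB) (X FB) (Y FB) + W (U FB FB) (Y FB) (X FB))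
    = W (d * (T FA FB + U FB FA) - (s * t - 1) * (h * s * t * (T FD FC + U FD FC))) (X FA) (Y FB) + W (d * (U FA FB + T FB FA) - (1 - s * t) * (h * s * t * (T FD FC + U FD FC))) (Y FA) (X FB) + W (d * (T FA FA + U FA FA + (h * s * t * (T FD FC + U FD FC)))) (X FA) (Y FA) + W (d * (T FB FB + U FB FB - (h * s * t * (T FD FC + U FD FC)))) (X FB) (Y FB) + W (d * (T FC FD + U FD FC) + (h * (T FB FA + U FB FA))) (X FC) (Y FD) + W (d * (U FC FD + T FD FC) - (h * (T FB FA + U FB FA))) (Y FC) (X FD)"
    unfolding distrib_left scale u0 u1 u2 u3 u4 u5 u6 u7 u8 u9 u10 u11 swap by (simp add: W_add W_diff W_minus algebra_simps)
  also have "\<dots> = 0" using g by (simp add: W_0)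
  finally have AB: "i d * (W (T FA FB) (X FA) (Y FB) + W (T FB FA) (X FB) (Y FA) + W (T FC FD) (X FC) (Y FD) + W (T FD FC) (X FD) (Y FC) + W (U FA FB) (Y FA) (X FB) + W (U FB FA) (Y FB) (X FA) + W (U FC FD) (Y FC) (X FD) + W (U FD FC) (Y FD) (X FC) + W (T FA FA) (X FA) (Y FA) + W (U FA FA) (Y FA) (X FA) + W (T FB FB) (X FB) (Y FB) + W (U FB FB) (Y FB) (X FB)) = 0" .
  have "i d * (W (T FC FC) (X FC) (Y FC) + W (U FC FC) (Y FC) (X FC))
    = W (d * (T FC FC + U FC FC)) (X FC) (Y FC)"
    unfolding distrib_left scale u0 u1 u2 u3 u4 u5 u6 u7 u8 u9 u10 u11 swap by (simp add: W_add W_diff W_minus algebra_simps)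
  also have "\<dots> = 0" using g by (simp add: W_0)
  finally have CC: "i d * (W (T FC FC) (X FC) (Y FC) + W (U FC FC) (Y FC) (X FC)) = 0" .
  have "i d * (W (T FD FD) (X FD) (Y FD) + W (U FD FD) (Y FD) (X FD))
    = W (d * (T FD FD + U FD FD)) (X FD) (Y FD)"
    unfolding distrib_left scale u0 u1 u2 u3 u4 u5 u6 u7 u8 u9 u10 u11 swap by (simp add: W_add W_diff W_minus algebra_simps)
  also have "\<dots> = 0" using g by (simp add: W_0)
  finally have DD: "i d * (W (T FD FD) (X FD) (Y FD) + W (U FD FD) (Y FD) (X FD)) = 0" .
  have "i d * ?L =
     i d * (W (T FC FA) (X FC) (Y FA) + W (T FA FC) (X FA) (Y FC) + W (T FC FB) (X FC) (Y FB) + W (T FB FC) (X FB) (Y FC) + W (U FC FA) (Y FC) (X FA) + W (U FA FC) (Y FA) (X FC) + W (U FC FB) (Y FC) (X FB) + W (U FB FC) (Y FB) (X FC))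
     + i d * (W (T FD FA) (X FD) (Y FA) + W (T FA FD) (X FA) (Y FD) + W (T FD FB) (X FD) (Y FB) + W (T FB FD) (X FB) (Y FD) + W (U FD FA) (Y FD) (X FA) + W (U FA FD) (Y FA) (X FD) + W (U FD FB) (Y FD) (X FB) + W (U FB FD) (Y FB) (X FD))
     + i d * (W (T FA FB) (X FA) (Y FB) + W (T FB FA) (X FB) (Y FA) + W (T FC FD) (X FC) (Y FD) + W (T FD FC) (X FD) (Y FC) + W (U FA FB) (Y FA) (X FB) + W (U FB FA) (Y FB) (X FA) + W (U FC FD) (Y FC) (X FD) + W (U FD FC) (Y FD) (X FC) + W (T FA FA) (X FA) (Y FA) + W (U FA FA) (Y FA) (X FA) + W (T FB FB) (X FB) (Y FB) + W (U FB FB) (Y FB) (X FB))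
     + i d * (W (T FC FC) (X FC) (Y FC) + W (U FC FC) (Y FC) (X FC))
     + i d * (W (T FD FD) (X FD) (Y FD) + W (U FD FD) (Y FD) (X FD))"
    unfolding sum_fam W_def[symmetric] distrib_left by (simp add: algebra_simps)
  also have "\<dots> = 0" by (simp only: CA AD AB CC DD add_0)
  finally show ?thesis by (rule canc[folded d_def])
qed

section \<open>Dressing preserves the exchange relations\<close>

text \<open>
  \<open>hat\<close> multiplies \<open>C\<close> and \<open>D\<close> by powers of \<open>F\<close>; these commute with everything in the family, and the
  exchange relations are homogeneous, with weights \<open>-1\<close> and \<open>1\<close> for \<open>C\<close> and \<open>D\<close>, so that the
  modified family satisfies them again (\<open>exchange_hat\<close>). The factor \<open>N\<close> restores the weights.
\<close>

locale dress_syntax = site_coeffs q q' p V V' c for q q' p V V' c :: "'p::comm_ring_1" +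
  fixes i :: "'p \<Rightarrow> 'b::ring_1" and h h' :: 'p and F G :: 'b
begin

definition hat :: "(fam \<Rightarrow> 'b) \<Rightarrow> fam \<Rightarrow> 'b" where
  "hat Z a = (case a of FC \<Rightarrow> G * Z FC | FD \<Rightarrow> F * Z FD | _ \<Rightarrow> Z a)"

definition N :: "fam \<Rightarrow> 'b" where
  "N j = (case j of FC \<Rightarrow> F | FD \<Rightarrow> G | _ \<Rightarrow> 1)"

definition dress :: "(fam \<Rightarrow> 'b) \<Rightarrow> 'p \<Rightarrow> fam \<Rightarrow> 'b" where
  "dress Z u j = N j * (\<Sum>a\<in>UNIV. i (phi j a h h' u) * hat Z a)"

end

locale dress_hom = unital_hom i + dress_syntax q q' p V V' c i h h' F G
  for i :: "'p::comm_ring_1 \<Rightarrow> 'b::ring_1" and q q' p V V' c h h' :: 'p and F G :: 'b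
begin

lemma tw_phi:
  assumes "\<And>z. z \<in> {q, q', p, V, V', c, u} \<Longrightarrow> tw T z z" and "tw T k l" and "tw T k' l'"
  shows "tw T (phi j b k k' u) (phi j b l l' u)"
proof -
  have [intro]: "tw T q q" "tw T q' q'" "tw T p p" "tw T V V" "tw T V' V'" "tw T c c" "tw T u u" using assms(1) by auto
  show ?thesis
    by (cases j; cases b; simp add: e_def f_def; intro tw_intros assms(2,3); blast)
qed

lemma dress_commute:
  assumes z: "\<And>z. z \<in> {q, q', p, V, V', c, h, h', u} \<Longrightarrow> tw T z z"
    and F: "T * F = F * T" and G: "T * G = G * T" and Z: "\<And>a. T * Z a = Z a * T"
  shows "T * dress Z u j = dress Z u j * T"
proof -
  have mult: "T * (x * y) = x * y * T" if "T * x = x * T" "T * y = y * T" for x y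
    using that by (metis mult.assoc)
  have N: "T * N j = N j * T" using F G by (cases j) (simp_all add: N_def)
  have hat: "T * hat Z a = hat Z a * T" for a
    by (cases a) (simp_all add: hat_def mult F G Z)
  have "tw T (phi j a h h' u) (phi j a h h' u)" for a
    by (rule tw_phi; rule z; blast)
  then have phi: "T * i (phi j a h h' u) = i (phi j a h h' u) * T" for a
    by (simp add: tw_def)
  have "T * (\<Sum>a\<in>UNIV. i (phi j a h h' u) * hat Z a) = (\<Sum>a\<in>UNIV. i (phi j a h h' u) * hat Z a) * T"
    unfolding sum_distrib_left sum_distrib_right by (intro sum.cong refl mult phi hat)
  with N show ?thesis unfolding dress_def by (rule mult)
qed

end

text \<open>
  Dressing commutes with homomorphisms. It is needed to dress the family in one formal variable and
  use the result at both \<open>s\<close> and \<open>t\<close>.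
\<close>

lemma dress_transport:
  fixes g :: "'b::ring_1 \<Rightarrow> 'c::ring_1" and F G :: 'b
  assumes f: "unital_hom f" and g: "unital_hom g" and ig: "\<And>z. g (i z) = j (f z)"
  shows "g (dress_syntax.dress q q' p V V' c i h h' F G Z u a) =
    dress_syntax.dress (f q) (f q') (f p) (f V) (f V') (f c) j (f h) (f h') (g F) (g G) (\<lambda>a. g (Z a)) (f u) a"
proof -
  interpret f: unital_hom f by fact
  interpret g: unital_hom g by fact
  have power: "f (x ^ n) = f x ^ n" for x n by (induction n) (simp_all add: f.i_1 f.i_mult)
  have phi: "f (site_coeffs.phi q q' p V V' c b d h h' u) =
     site_coeffs.phi (f q) (f q') (f p) (f V) (f V') (f c) b d (f h) (f h') (f u)" for b d
    by (cases b; cases d)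
      (simp_all add: site_coeffs.phi.simps site_coeffs.e_def site_coeffs.f_def f.i_add f.i_diff f.i_mult f.i_1 power)
  have hat: "g (dress_syntax.hat F G Z b) = dress_syntax.hat (g F) (g G) (\<lambda>a. g (Z a)) b" for b
    by (cases b) (simp_all add: dress_syntax.hat_def g.i_mult)
  have N: "g (dress_syntax.N F G b) = dress_syntax.N (g F) (g G) b" for b
    by (cases b) (simp_all add: dress_syntax.N_def g.i_1)
  show ?thesis
    by (simp add: dress_syntax.dress_def g.i_mult g.i_sum hat N ig phi)
qed

locale dressing = dress_hom i q q' p V V' c h h' F G
  for i :: "'p::idom \<Rightarrow> 'b::ring_1" and q q' p V V' c h h' :: 'p and F G :: 'b +
  fixes s t :: 'p and X Y :: "fam \<Rightarrow> 'b"
  assumes coefs: "coefs q q' p V V'" and hh: "h * h' = 1"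
    and FG: "F * G = 1" and GF: "G * F = 1"
    and F_central: "\<And>z. z \<in> {q, q', p, V, V', c, s, t} \<Longrightarrow> F * i z = i z * F"
    and F_h: "F * i h = i (q^2 * h) * F" and F_h': "F * i h' = i (q'^2 * h') * F"
    and XY_i: "\<And>a z. z \<in> {q, q', p, V, V', c, s, t, h, h'} \<Longrightarrow> X a * i z = i z * X a \<and> Y a * i z = i z * Y a"
    and XY_F: "\<And>a. X a * F = F * X a \<and> Y a * F = F * Y a"
begin

sublocale coefs q q' p V V' c s t by (rule coefs)

lemmas tw_inverse = tw_inverse[OF FG GF]

lemma qq_sq: "q'^2 * (q^2 * x) = x" "q^2 * (q'^2 * x) = x"
proof -
  have "q^2 * q'^2 = 1" using qq by (metis power_mult_distrib power_one)
  then show "q'^2 * (q^2 * x) = x" "q^2 * (q'^2 * x) = x" by (metis mult.assoc mult.commute mult_1_left)+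
qed

lemma tw_F: "z \<in> {q, q', p, V, V', c, s, t} \<Longrightarrow> tw F z z" "tw F h (q^2 * h)" "tw F h' (q'^2 * h')"
    "tw F (q'^2 * h) h" "tw F (q^2 * h') h'"
proof -
  show F: "z \<in> {q, q', p, V, V', c, s, t} \<Longrightarrow> tw F z z" "tw F h (q^2 * h)" "tw F h' (q'^2 * h')" for z
    using F_central F_h F_h' by (simp_all add: tw_def)
  have "tw F (q'^2 * h) (q'^2 * (q^2 * h))" "tw F (q^2 * h') (q^2 * (q'^2 * h'))"
    by (intro tw_mult tw_power F; simp)+
  then show "tw F (q'^2 * h) h" "tw F (q^2 * h') h'" by (simp_all only: qq_sq)
qed

lemma tw_XY: "z \<in> {q, q', p, V, V', c, s, t, h, h'} \<Longrightarrow> Z \<in> {X, Y} \<Longrightarrow> tw (Z a) z z"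
  using XY_i by (auto simp: tw_def)

lemma tw_hat:
  assumes Z: "Z \<in> {X, Y}"
  shows "z \<in> {q, q', p, V, V', c, s, t} \<Longrightarrow> tw (hat Z a) z z"
    and "tw (hat Z a) h (fst (h_shift a (h, h')))" and "tw (hat Z a) h' (snd (h_shift a (h, h')))"
proof -
  have hz: "tw (Z b) h h" "tw (Z b) h' h'" for b by (rule tw_XY[OF _ Z], simp)+
  show "tw (hat Z a) z z" if z: "z \<in> {q, q', p, V, V', c, s, t}"
  proof -
    have "tw (Z b) z z" for b by (rule tw_XY[OF _ Z]) (use z in blast)
    with tw_F(1)[OF z] tw_inverse[OF tw_F(1)[OF z]] show ?thesis
      by (cases a) (simp_all add: hat_def tw_comp)
  qed
  show "tw (hat Z a) h (fst (h_shift a (h, h')))"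
    using hz tw_comp[OF tw_F(2) hz(1)] tw_comp[OF tw_inverse[OF tw_F(4)] hz(1)] by (cases a) (simp_all add: hat_def)
  show "tw (hat Z a) h' (snd (h_shift a (h, h')))"
    using hz tw_comp[OF tw_F(3) hz(2)] tw_comp[OF tw_inverse[OF tw_F(5)] hz(2)] by (cases a) (simp_all add: hat_def)
qed

lemma tw_N:
  shows "z \<in> {q, q', p, V, V', c, s, t} \<Longrightarrow> tw (N j) z z"
    and "tw (N j) (fst (h_shift j (h, h'))) h" and "tw (N j) (snd (h_shift j (h, h'))) h'"
proof -
  have one: "tw 1 x x" for x by (simp add: tw_def)
  show "z \<in> {q, q', p, V, V', c, s, t} \<Longrightarrow> tw (N j) z z"
    using tw_F(1)[of z] tw_inverse[of z z] one[of z] by (cases j) (simp_all only: N_def fam.case)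
  show "tw (N j) (fst (h_shift j (h, h'))) h" "tw (N j) (snd (h_shift j (h, h'))) h'"
    using tw_F(4,5) tw_inverse[OF tw_F(2)] tw_inverse[OF tw_F(3)] one by (cases j; simp add: N_def)+
qed

lemma hat_phi: "Z \<in> {X, Y} \<Longrightarrow> u \<in> {s, t} \<Longrightarrow>
  hat Z a * i (phi j b h h' u) = i (case_prod (phi j b) (h_shift a (h, h')) u) * hat Z a"
  using tw_phi[of u "hat Z a", OF _ tw_hat(2,3)] tw_hat(1)[of Z]
  by (auto simp: tw_def case_prod_unfold)

lemma N_phi:
  assumes "u \<in> {s, t}"
  shows "i (phi j b h h' u) * N k = N k * i (case_prod (phi j b) (h_shift k (h, h')) u)"
proof -
  have "tw (N k) (phi j b (fst (h_shift k (h, h'))) (snd (h_shift k (h, h'))) u) (phi j b h h' u)"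
    by (rule tw_phi[OF _ tw_N(2,3)], rule tw_N(1)) (use assms in auto)
  then show ?thesis by (simp add: tw_def case_prod_unfold)
qed

lemma G_comm: "Z \<in> {X, Y} \<Longrightarrow> Z a * G = G * Z a"
  using XY_F FG GF by (auto; metis mult.assoc mult_1_left mult_1_right)

lemma hat_N: "Z \<in> {X, Y} \<Longrightarrow> hat Z a * N k = N k * hat Z a"
proof -
  assume Z: "Z \<in> {X, Y}"
  have F: "Z a * F = F * Z a" for a using Z XY_F by auto
  have G: "Z a * G = G * Z a" for a using G_comm[OF Z] .
  have cancel: "F * (G * x) = x" "G * (F * x) = x" for x using FG GF by (simp_all add: mult.assoc[symmetric])
  show ?thesis
    by (cases a; cases k) (simp_all add: hat_def N_def mult.assoc F G cancel)
qed

definition prods :: "(fam \<Rightarrow> 'b) \<Rightarrow> 'p \<Rightarrow> (fam \<Rightarrow> 'b) \<Rightarrow> 'p \<Rightarrow> fam \<Rightarrow> fam \<Rightarrow> 'b" where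
  "prods Z u W v j k = (\<Sum>a\<in>UNIV. \<Sum>b\<in>UNIV. i (pair_coeff j k a b h h' u v) * (hat Z a * hat W b))"

text \<open>
  All coefficients are moved to the left of the functions, and the outer factors \<open>N\<close> to the front.
\<close>

lemma dress_mult:
  assumes "Z \<in> {X, Y}" "W \<in> {X, Y}" "u \<in> {s, t}" "v \<in> {s, t}"
  shows "dress Z u j * dress W v k = N j * N k * prods Z u W v j k"
proof -
  have "dress Z u j * dress W v k =
      N j * ((\<Sum>a\<in>UNIV. i (phi j a h h' u) * hat Z a * N k) * (\<Sum>b\<in>UNIV. i (phi k b h h' v) * hat W b))"
    by (simp add: dress_def sum_distrib_right mult.assoc)
  also have "(\<Sum>a\<in>UNIV. i (phi j a h h' u) * hat Z a * N k) =
      N k * (\<Sum>a\<in>UNIV. i (case_prod (phi j a) (h_shift k (h, h')) u) * hat Z a)"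
    unfolding sum_distrib_left
  proof (intro sum.cong refl)
    fix a
    have "i (phi j a h h' u) * hat Z a * N k = (i (phi j a h h' u) * N k) * hat Z a"
      by (simp only: mult.assoc hat_N[OF assms(1)])
    then show "i (phi j a h h' u) * hat Z a * N k = N k * (i (case_prod (phi j a) (h_shift k (h, h')) u) * hat Z a)"
      by (simp only: N_phi[OF assms(3)] mult.assoc)
  qed
  also have "N j * (N k * (\<Sum>a\<in>UNIV. i (case_prod (phi j a) (h_shift k (h, h')) u) * hat Z a) * (\<Sum>b\<in>UNIV. i (phi k b h h' v) * hat W b))
     = N j * N k * (\<Sum>a\<in>UNIV. \<Sum>b\<in>UNIV. i (case_prod (phi j a) (h_shift k (h, h')) u) * (hat Z a * i (phi k b h h' v)) * hat W b)"
    by (simp add: mult.assoc sum_product)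
  also have "\<dots> = N j * N k * prods Z u W v j k"
    unfolding prods_def pair_coeff_def hat_phi[OF assms(1,4)] by (simp add: i_mult mult.assoc)
  finally show ?thesis .
qed

lemma sums_linear:
  fixes f :: "fam \<Rightarrow> fam \<Rightarrow> 'b"
  shows "(\<Sum>a\<in>UNIV. \<Sum>b\<in>UNIV. i (T a b + T' a b) * f a b) =
    (\<Sum>a\<in>UNIV. \<Sum>b\<in>UNIV. i (T a b) * f a b) + (\<Sum>a\<in>UNIV. \<Sum>b\<in>UNIV. i (T' a b) * f a b)"
  and "(\<Sum>a\<in>UNIV. \<Sum>b\<in>UNIV. i (r * pair_coeff j k a b h h' u v) * (hat Z a * hat W b)) = i r * prods Z u W v j k"
  by (simp_all add: prods_def i_add distrib_right sum.distrib sum_distrib_left i_fold)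

lemma exchange_hat:
  assumes ex: "exchange i q q' u v Z W" and Z: "Z \<in> {X, Y}" and W: "W \<in> {X, Y}" and u: "u \<in> {s, t}" and v: "v \<in> {s, t}"
  shows "exchange i q q' u v (hat Z) (hat W)"
proof -
  define c1 where "c1 = i (u - v)"
  define c2 where "c2 = i (q - q')"
  define c3 where "c3 = i (1 - u * v)"
  note fold = c1_def[symmetric] c2_def[symmetric] c3_def[symmetric]
  note E = exchangeD[OF ex, unfolded i_mult fold]
  have tw: "tw F q q" "tw F q' q'" "tw F u u" "tw F v v" using u v by (auto intro!: tw_F(1))
  then have tw': "tw F (u - v) (u - v)" "tw F (q - q') (q - q')" "tw F (1 - u * v) (1 - u * v)"
    by (auto intro!: tw_intros)
  note comm = tw_pass[OF tw(1)] tw_pass[OF tw(2)] tw_pass[OF tw(3)] tw_pass[OF tw(4)]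
    tw_pass[OF tw'(1), folded c1_def] tw_pass[OF tw'(2), folded c2_def] tw_pass[OF tw'(3), folded c3_def]
    tw_pass[OF tw(1)[THEN tw_inverse]] tw_pass[OF tw(2)[THEN tw_inverse]] tw_pass[OF tw(3)[THEN tw_inverse]] tw_pass[OF tw(4)[THEN tw_inverse]]
    tw_pass[OF tw'(1)[THEN tw_inverse], folded c1_def] tw_pass[OF tw'(2)[THEN tw_inverse], folded c2_def] tw_pass[OF tw'(3)[THEN tw_inverse], folded c3_def]
  have FX: "Z a * F = F * Z a" "W a * F = F * W a" "Z a * G = G * Z a" "W a * G = G * W a" for a
    using XY_F Z W G_comm by auto
  have left: "x * y = y * x \<Longrightarrow> x * (y * z) = y * (x * z)" for x y z :: 'b by (metis mult.assoc)
  note comm = comm FX FX[THEN left] FG GF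
  have cancel: "F * (G * x) = x" "G * (F * x) = x" for x using FG GF by (simp_all add: mult.assoc[symmetric])
  show ?thesis
    unfolding exchange_def i_mult fold
  proof (intro conjI allI)
    show "hat Z a * hat W a = hat W a * hat Z a" for a
      using E(1) by (cases a) (simp_all add: hat_def mult.assoc comm)
    show "c1 * (hat Z FA * hat W FB - hat W FB * hat Z FA) = c2 * (hat W FC * hat Z FD - hat Z FC * hat W FD)"
      using E(2) by (simp add: hat_def mult.assoc comm cancel)
    show "c1 * (hat Z FC * hat W FA - hat W FA * hat Z FC) = c2 * i q' * i u *
       (hat Z FC * hat W FA - hat W FC * hat Z FA - i v * (hat Z FC * hat W FB) + i u * (hat W FC * hat Z FB))"
      using arg_cong[OF E(3), of "\<lambda>x. G * x"] by (simp add: hat_def algebra_simps comm)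
    show "c1 * (hat Z FC * hat W FB - hat W FB * hat Z FC) = - (c2 * i q * i u) *
       (hat Z FC * hat W FB - hat W FC * hat Z FB - i v * (hat Z FC * hat W FA) + i u * (hat W FC * hat Z FA))"
      using arg_cong[OF E(4), of "\<lambda>x. G * x"] by (simp add: hat_def algebra_simps comm)
    show "c1 * (hat W FA * hat Z FD - hat Z FD * hat W FA) = c2 * i q' * i u *
       (hat W FA * hat Z FD - hat Z FA * hat W FD - i v * (hat W FB * hat Z FD) + i u * (hat Z FB * hat W FD))"
      using arg_cong[OF E(5), of "\<lambda>x. F * x"] by (simp add: hat_def algebra_simps comm)
    show "c1 * (hat W FB * hat Z FD - hat Z FD * hat W FB) = - (c2 * i q * i u) *
       (hat W FB * hat Z FD - hat Z FB * hat W FD - i v * (hat W FA * hat Z FD) + i u * (hat Z FA * hat W FD))"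
      using arg_cong[OF E(6), of "\<lambda>x. F * x"] by (simp add: hat_def algebra_simps comm)
    show "c1 * (hat Z FC * hat W FD - hat W FD * hat Z FC) = - (c2 * i u * i v) *
       (c3 * (hat Z FA * hat W FB - hat W FA * hat Z FB) + c1 * (hat Z FA * hat W FA - hat Z FB * hat W FB))"
      using E(7) by (simp add: hat_def mult.assoc comm cancel)
  qed
qed

text \<open>
  By \<open>dress_mult\<close> each relation becomes a bilinear expression in the modified family, which vanishes
  by the coefficient identities; the outer factors are cancelled against \<open>F\<close> or \<open>G\<close>.
\<close>

lemma exchange_dress:
  assumes st: "exchange i q q' s t X Y" and ts: "exchange i q q' t s Y X"
    and canc: "\<And>z. i (s - t) * z = 0 \<Longrightarrow> z = 0"
  shows "exchange i q q' s t (dress X s) (dress Y t)"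
proof -
  define c1 where "c1 = i (s - t)"
  define c2 where "c2 = i (q - q')"
  define c3 where "c3 = i (1 - s * t)"
  note fold = c1_def[symmetric] c2_def[symmetric] c3_def[symmetric]
  have "exchange i q q' s t (hat X) (hat Y)" "exchange i q q' t s (hat Y) (hat X)"
    using st ts by (auto intro: exchange_hat)
  then have "exchange_zero q q' s t T U \<Longrightarrow> (\<Sum>a\<in>UNIV. \<Sum>b\<in>UNIV. i (T a b) * (hat X a * hat Y b)) +
      (\<Sum>a\<in>UNIV. \<Sum>b\<in>UNIV. i (U a b) * (hat Y a * hat X b)) = 0" for T U
    by (intro bilinear_zero[OF unital_hom_axioms]) (auto intro: canc)
  note zero = this
  have tw: "tw F q q" "tw F q' q'" "tw F s s" "tw F t t" by (auto intro!: tw_F(1))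
  then have tw': "tw F (s - t) (s - t)" "tw F (q - q') (q - q')" "tw F (1 - s * t) (1 - s * t)"
    by (auto intro!: tw_intros)
  note comm = tw_pass[OF tw(1)] tw_pass[OF tw(2)] tw_pass[OF tw(3)] tw_pass[OF tw(4)]
    tw_pass[OF tw'(1), folded c1_def] tw_pass[OF tw'(2), folded c2_def] tw_pass[OF tw'(3), folded c3_def]
    tw_pass[OF tw(1)[THEN tw_inverse]] tw_pass[OF tw(2)[THEN tw_inverse]] tw_pass[OF tw(3)[THEN tw_inverse]] tw_pass[OF tw(4)[THEN tw_inverse]]
    tw_pass[OF tw'(1)[THEN tw_inverse], folded c1_def] tw_pass[OF tw'(2)[THEN tw_inverse], folded c2_def] tw_pass[OF tw'(3)[THEN tw_inverse], folded c3_def]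
  have mult: "dress X s j * dress Y t k = N j * N k * prods X s Y t j k"
    "dress Y t j * dress X s k = N j * N k * prods Y t X s j k" for j k
    by (rule dress_mult; simp)+
  note norm = mult N_def mult.assoc comm FG GF
  have cs: "i s * i t = i t * i s" "c2 * i t = i t * c2" "c2 * i s = i s * c2" "i q' * i s = i s * i q'" for a b
    unfolding c2_def i_mult[symmetric] by (simp_all add: mult.commute)
  show ?thesis
    unfolding exchange_def i_mult fold
  proof (intro conjI allI)
    show "dress X s a * dress Y t a = dress Y t a * dress X s a" for a
      using zero[OF zero_AA[OF hh], unfolded sums_linear] zero[OF zero_BB[OF hh], unfolded sums_linear] zero[OF zero_CC[OF hh], unfolded sums_linear] zero[OF zero_DD[OF hh], unfolded sums_linear]
      unfolding mult by (cases a) (simp_all add: i_1 i_minus)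
    show "c1 * (dress X s FA * dress Y t FB - dress Y t FB * dress X s FA) =
      c2 * (dress Y t FC * dress X s FD - dress X s FC * dress Y t FD)"
      using zero[OF zero_AB[OF hh], unfolded sums_linear, unfolded i_mult i_minus fold] by (simp add: norm algebra_simps)
    show "c1 * (dress X s FC * dress Y t FA - dress Y t FA * dress X s FC) = c2 * i q' * i s *
       (dress X s FC * dress Y t FA - dress Y t FC * dress X s FA - i t * (dress X s FC * dress Y t FB) + i s * (dress Y t FC * dress X s FB))"
      using arg_cong[OF zero[OF zero_CA[OF hh], unfolded sums_linear, unfolded i_mult i_minus fold], of "\<lambda>x. F * x"] by (simp add: norm algebra_simps)
    show "c1 * (dress X s FC * dress Y t FB - dress Y t FB * dress X s FC) = - (c2 * i q * i s) *
       (dress X s FC * dress Y t FB - dress Y t FC * dress X s FB - i t * (dress X s FC * dress Y t FA) + i s * (dress Y t FC * dress X s FA))"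
      using arg_cong[OF zero[OF zero_CB[OF hh], unfolded sums_linear, unfolded i_mult i_minus fold], of "\<lambda>x. F * x"] by (simp add: norm algebra_simps)
    show "c1 * (dress Y t FA * dress X s FD - dress X s FD * dress Y t FA) = c2 * i q' * i s *
       (dress Y t FA * dress X s FD - dress X s FA * dress Y t FD - i t * (dress Y t FB * dress X s FD) + i s * (dress X s FB * dress Y t FD))"
      using arg_cong[OF zero[OF zero_AD[OF hh], unfolded sums_linear, unfolded i_mult i_minus fold], of "\<lambda>x. G * x"] by (simp add: norm algebra_simps)
    show "c1 * (dress Y t FB * dress X s FD - dress X s FD * dress Y t FB) = - (c2 * i q * i s) *
       (dress Y t FB * dress X s FD - dress X s FB * dress Y t FD - i t * (dress Y t FA * dress X s FD) + i s * (dress X s FA * dress Y t FD))"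
      using arg_cong[OF zero[OF zero_BD[OF hh], unfolded sums_linear, unfolded i_mult i_minus fold], of "\<lambda>x. G * x"] by (simp add: norm algebra_simps)
    show "c1 * (dress X s FC * dress Y t FD - dress Y t FD * dress X s FC) = - (c2 * i s * i t) *
       (c3 * (dress X s FA * dress Y t FB - dress Y t FA * dress X s FB) + c1 * (dress X s FA * dress Y t FA - dress X s FB * dress Y t FB))"
      using zero[OF zero_CD[OF hh], unfolded sums_linear, unfolded i_mult i_minus fold] by (simp add: norm algebra_simps)
  qed
qed

end

section \<open>Operators on Laurent polynomials\<close>

type_synonym 'f laurent = "(nat \<Rightarrow>\<^sub>0 int) \<Rightarrow>\<^sub>0 'f"

definition cst :: "'f::field \<Rightarrow> 'f laurent" where "cst c = Poly_Mapping.single 0 c"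

definition mon :: "(nat \<Rightarrow>\<^sub>0 int) \<Rightarrow> 'f::field laurent" where "mon l = Poly_Mapping.single l 1"

lemma cst_hom [simp]: "cst 0 = 0" "cst 1 = 1" "cst (a + b) = cst a + cst b" "cst (a * b) = cst a * cst b"
    "cst (a - b) = cst a - cst b" "cst (- a) = - cst a"
  by (simp_all add: cst_def single_add mult_single single_diff single_uminus)

lemma mon_mult: "mon a * mon b = mon (a + b)" and mon_0: "mon 0 = 1"
  by (simp_all add: mon_def mult_single)

lemma cst_mon: "cst c * mon l = Poly_Mapping.single l c"
  by (simp add: cst_def mon_def mult_single)

lemma laurent_induct [case_names monom add]:
  assumes "\<And>l c. P (Poly_Mapping.single l c)" "\<And>p r. P p \<Longrightarrow> P r \<Longrightarrow> P (p + r)"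
  shows "P (p :: 'a \<Rightarrow>\<^sub>0 'b::comm_monoid_add)"
proof (induction p rule: update_induct)
  case const
  show ?case using assms(1)[of _ 0] by simp
next
  case (update f a b)
  have "Poly_Mapping.update a b f = f + Poly_Mapping.single a b"
    using update(1) by (intro poly_mapping_eqI)
      (auto simp: lookup_add lookup_single lookup_update when_def in_keys_iff)
  with update(3) show ?case by (simp add: assms)
qed

text \<open>
  Linear endomorphisms of the Laurent polynomials in countably many variables, as a type, because the
  generating functions are power series over this ring and power series want a type class.
\<close>

typedef (overloaded) 'f op =
  "{T :: 'f::field laurent \<Rightarrow> 'f laurent. (\<forall>p r. T (p + r) = T p + T r) \<and> (\<forall>c p. T (cst c * p) = cst c * T p)}"
  by (rule exI[of _ "\<lambda>p. p"]) simp

setup_lifting type_definition_op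
lifting_forget poly_mapping.lifting

instantiation op :: (field) ring_1
begin
lift_definition zero_op :: "'a op" is "\<lambda>_. 0" by simp
lift_definition one_op :: "'a op" is "\<lambda>p. p" by simp
lift_definition plus_op :: "'a op \<Rightarrow> 'a op \<Rightarrow> 'a op" is "\<lambda>S T p. S p + T p" by (simp add: algebra_simps)
lift_definition minus_op :: "'a op \<Rightarrow> 'a op \<Rightarrow> 'a op" is "\<lambda>S T p. S p - T p" by (simp add: algebra_simps)
lift_definition uminus_op :: "'a op \<Rightarrow> 'a op" is "\<lambda>T p. - T p" by (simp add: algebra_simps)
lift_definition times_op :: "'a op \<Rightarrow> 'a op \<Rightarrow> 'a op" is "\<lambda>S T p. S (T p)" by simp
instance
proof
  show "(0::'a op) \<noteq> 1" by transfer (metis zero_neq_one)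
  fix a b c :: "'a op"
  show "(a + b) * c = a * c + b * c" by transfer simp
  show "a * (b + c) = a * b + a * c" by transfer simp
qed (transfer; simp add: algebra_simps fun_eq_iff)+
end

lift_definition iota :: "'f::field laurent \<Rightarrow> 'f op" is "\<lambda>r p. r * p" by (simp add: algebra_simps)

lemma unital_hom_iota: "unital_hom iota"
proof
  show "iota (x + y) = iota x + iota y" for x y :: "'a laurent"
    by (simp add: fun_eq_iff distrib_right iota.rep_eq plus_op.rep_eq flip: Rep_op_inject)
  show "iota (x * y) = iota x * iota y" for x y :: "'a laurent"
    by (simp add: fun_eq_iff mult.assoc iota.rep_eq times_op.rep_eq flip: Rep_op_inject)
  show "iota (1 :: 'a laurent) = 1"
    by (simp add: fun_eq_iff iota.rep_eq one_op.rep_eq flip: Rep_op_inject)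
qed

lemma iota_cst: "T * iota (cst c) = iota (cst c) * T"
  by transfer auto

lemma op_eqI: "(\<And>l. Rep_op S (mon l) = Rep_op T (mon l)) \<Longrightarrow> S = T"
proof (transfer, rule ext)
  fix S T :: "'a laurent \<Rightarrow> 'a laurent" and p
  assume S: "(\<forall>p r. S (p + r) = S p + S r) \<and> (\<forall>c p. S (cst c * p) = cst c * S p)"
    and T: "(\<forall>p r. T (p + r) = T p + T r) \<and> (\<forall>c p. T (cst c * p) = cst c * T p)"
    and eq: "\<And>l. S (mon l) = T (mon l)"
  show "S p = T p"
  proof (induction p rule: laurent_induct)
    case (monom l c)
    have "S (cst c * mon l) = T (cst c * mon l)" using S T eq by metis
    then show ?case by (simp only: cst_mon)
  next
    case (add p r)
    then show ?case using S T by metis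
  qed
qed

text \<open>
  Diagonal operators: the monomial with exponent \<open>l\<close> is multiplied by \<open>\<chi> l\<close>. For a multiplicative \<open>\<chi>\<close>
  this is an algebra automorphism, and \<open>chi q k\<close> multiplies the \<open>k\<close>-th variable by \<open>q\<^sup>2\<close>.
\<close>

definition scale :: "((nat \<Rightarrow>\<^sub>0 int) \<Rightarrow> 'f) \<Rightarrow> 'f::field laurent \<Rightarrow> 'f laurent" where
  "scale \<chi> p = Poly_Mapping.mapp (\<lambda>l v. \<chi> l * v) p"

lemma lookup_scale: "Poly_Mapping.lookup (scale \<chi> p) l = \<chi> l * Poly_Mapping.lookup p l"
  by (simp add: scale_def lookup_mapp when_def in_keys_iff)

lemma scale_add: "scale \<chi> (p + r) = scale \<chi> p + scale \<chi> r"
  by (rule poly_mapping_eqI) (simp add: lookup_scale lookup_add algebra_simps)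

lemma scale_single: "scale \<chi> (Poly_Mapping.single l c) = Poly_Mapping.single l (\<chi> l * c)"
  by (rule poly_mapping_eqI) (simp add: lookup_scale lookup_single when_def)

lemma scale_mult:
  assumes "\<And>k l. \<chi> (k + l) = \<chi> k * \<chi> l"
  shows "scale \<chi> (p * r) = scale \<chi> p * scale \<chi> r"
proof (induction p rule: laurent_induct)
  case (monom l c)
  show ?case by (induction r rule: laurent_induct)
    (simp_all add: scale_add scale_single mult_single distrib_left distrib_right assms mult_ac)
qed (simp add: scale_add distrib_right)

definition chi :: "'f::field \<Rightarrow> nat \<Rightarrow> (nat \<Rightarrow>\<^sub>0 int) \<Rightarrow> 'f" where
  "chi q k l = q powi (2 * Poly_Mapping.lookup l k)"

lemma chi_add: "q \<noteq> 0 \<Longrightarrow> chi q k (l + m) = chi q k l * chi q k m"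
  by (simp add: chi_def lookup_add power_int_add distrib_left)

lemma lookup_cst_mult: "Poly_Mapping.lookup (cst c * p) l = c * Poly_Mapping.lookup p l"
  by (induction p rule: laurent_induct)
    (simp_all add: cst_def mult_single lookup_single when_def distrib_left lookup_add)

lift_definition scaling :: "((nat \<Rightarrow>\<^sub>0 int) \<Rightarrow> 'f) \<Rightarrow> 'f::field op" is scale
proof (intro conjI allI)
  fix \<chi> :: "(nat \<Rightarrow>\<^sub>0 int) \<Rightarrow> 'f" and p r c
  show "scale \<chi> (p + r) = scale \<chi> p + scale \<chi> r" by (rule scale_add)
  show "scale \<chi> (cst c * p) = cst c * scale \<chi> p"
    by (rule poly_mapping_eqI) (simp only: lookup_scale lookup_cst_mult mult.left_commute)
qed

lemma scaling_iota:
  assumes "\<And>k l. \<chi> (k + l) = \<chi> k * \<chi> l"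
  shows "scaling \<chi> * iota r = iota (scale \<chi> r) * scaling \<chi>"
  by (simp add: scale_mult[OF assms] fun_eq_iff scaling.rep_eq times_op.rep_eq iota.rep_eq flip: Rep_op_inject)

lemma scaling_mult: "scaling \<chi> * scaling \<psi> = scaling (\<lambda>l. \<chi> l * \<psi> l)"
  by (auto intro!: poly_mapping_eqI simp: fun_eq_iff lookup_scale mult_ac scaling.rep_eq times_op.rep_eq simp flip: Rep_op_inject)

lemma scaling_1: "scaling (\<lambda>l. 1) = 1"
  by (auto intro!: poly_mapping_eqI simp: fun_eq_iff lookup_scale scaling.rep_eq one_op.rep_eq simp flip: Rep_op_inject)

text \<open>
  Site \<open>k\<close> uses the four variables \<open>V\<close>, \<open>c\<close>, \<open>h\<close>, \<open>y\<close> with numbers \<open>4 k\<close> to \<open>4 k + 3\<close>. The operator \<open>F\<close>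
  of the site multiplies by \<open>y\<close> and shifts \<open>h\<close> to \<open>q\<^sup>2 h\<close>; the factor \<open>y\<close> gives \<open>F\<close> a weight of its
  own.
\<close>

abbreviation unit_vec :: "nat \<Rightarrow> int \<Rightarrow> nat \<Rightarrow>\<^sub>0 int" where "unit_vec \<equiv> Poly_Mapping.single"

definition gV where "gV k n = mon (unit_vec (4 * k) n)"
definition gc where "gc k n = mon (unit_vec (4 * k + 1) n)"
definition gh where "gh k n = mon (unit_vec (4 * k + 2) n)"
definition gy where "gy k n = mon (unit_vec (4 * k + 3) n)"

definition Fop :: "'f::field \<Rightarrow> nat \<Rightarrow> 'f op" where
  "Fop q k = iota (gy k 1) * scaling (chi q (4 * k + 2))"

definition Gop :: "'f::field \<Rightarrow> nat \<Rightarrow> 'f op" where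
  "Gop q k = iota (gy k (-1)) * scaling (chi (inverse q) (4 * k + 2))"

lemma scale_mon: "scale \<chi> (mon l) = cst (\<chi> l) * mon l"
  by (simp add: mon_def scale_single cst_def mult_single)

context fixes q :: "'f::field" assumes q: "q \<noteq> 0" begin

lemma scaling_mon: "scaling (chi q k) * iota (mon l) = iota (cst (chi q k l)) * (iota (mon l) * scaling (chi q k))"
proof -
  interpret unital_hom iota by (rule unital_hom_iota)
  show ?thesis by (subst scaling_iota) (simp_all add: chi_add q scale_mon i_mult mult.assoc)
qed

lemma chi_inverse: "chi q k l * chi (inverse q) k l = 1" "chi (inverse q) k l * chi q k l = 1"
  using q by (simp_all add: chi_def power_int_inverse)

lemma F_mon: "Fop q k * iota (mon l) = iota (cst (chi q (4 * k + 2) l) * mon l) * Fop q k"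
proof -
  interpret unital_hom iota by (rule unital_hom_iota)
  have "Fop q k * iota (mon l) = iota (cst (chi q (4 * k + 2) l) * mon l * gy k 1) * scaling (chi q (4 * k + 2))"
    by (simp add: Fop_def mult.assoc scaling_mon) (simp add: i_fold flip: i_mult mult.assoc, simp add: mult_ac)
  then show ?thesis by (simp add: Fop_def i_mult mult.assoc)
qed

end

lemma chi_unit [simp]: "chi q k (unit_vec j n) = (if j = k then q powi (2 * n) else 1)"
  by (simp add: chi_def lookup_single when_def)

lemma FG_op: "q \<noteq> 0 \<Longrightarrow> Fop q k * Gop q k = 1" and GF_op: "q \<noteq> 0 \<Longrightarrow> Gop q k * Fop q k = 1"
proof -
  interpret unital_hom iota by (rule unital_hom_iota)
  have inv: "gy k 1 * gy k (-1) = (1 :: 'a laurent)"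
    by (simp add: gy_def mon_mult flip: single_add) (simp add: mon_0)
  assume q: "q \<noteq> 0"
  have *: "Fop r k * Gop r k = 1" if "r \<noteq> 0" for r :: 'a
  proof -
    have "Fop r k * Gop r k = iota (gy k 1) * (iota (gy k (-1)) * (scaling (chi r (4 * k + 2)) * scaling (chi (inverse r) (4 * k + 2))))"
      using scaling_mon[OF that, of "4 * k + 2" "unit_vec (4 * k + 3) (-1)"]
      by (simp add: Fop_def Gop_def mult.assoc gy_def) (simp add: i_1 flip: mult.assoc)
    then show ?thesis using that by (simp add: scaling_mult chi_inverse scaling_1 flip: i_mult mult.assoc add: inv i_1)
  qed
  show "Fop q k * Gop q k = 1" using *[OF q] .
  have "Gop q k * Fop q k = iota (gy k (-1)) * (iota (gy k 1) * (scaling (chi (inverse q) (4 * k + 2)) * scaling (chi q (4 * k + 2))))"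
      using scaling_mon[of "inverse q" "4 * k + 2" "unit_vec (4 * k + 3) 1"] q
      by (simp add: Fop_def Gop_def mult.assoc gy_def) (simp add: i_1 flip: mult.assoc)
  then show "Gop q k * Fop q k = 1" using q inv by (simp add: scaling_mult chi_inverse scaling_1 i_1 mult.commute flip: i_mult mult.assoc)
qed

section \<open>Solutions with several sites\<close>

unbundle fps_syntax

text \<open>
  Power series in two variables are power series over power series: \<open>s\<close> is the outer variable and \<open>t\<close>
  the inner one. The embeddings \<open>at_s\<close> and \<open>at_t\<close> substitute \<open>s\<close> or \<open>t\<close> for the variable of a single
  series.
\<close>

definition fmap :: "('a \<Rightarrow> 'b) \<Rightarrow> 'a fps \<Rightarrow> 'b fps" where
  "fmap f F = Abs_fps (\<lambda>n. f (F $ n))"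

lemma fmap_nth [simp]: "fmap f F $ n = f (F $ n)"
  by (simp add: fmap_def)

lemma unital_hom_fmap: "unital_hom f \<Longrightarrow> unital_hom (fmap f)"
proof -
  assume "unital_hom f"
  then interpret unital_hom f .
  show ?thesis
    by standard (auto intro!: fps_ext simp: i_add i_0 i_1 i_sum i_mult fps_mult_nth)
qed

lemma unital_hom_fps_const: "unital_hom (fps_const :: 'a::ring_1 \<Rightarrow> 'a fps)"
  by standard simp_all

lemma fmap_X: "unital_hom f \<Longrightarrow> fmap f fps_X = fps_X"
  by (rule fps_ext) (auto simp: unital_hom.i_0 unital_hom.i_1 fps_X_def)

lemma fmap_const: "unital_hom f \<Longrightarrow> fmap f (fps_const c) = fps_const (f c)"
  by (rule fps_ext) (auto simp: unital_hom.i_0)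

abbreviation at_s :: "'a::ring_1 fps \<Rightarrow> 'a fps fps" where "at_s \<equiv> fmap fps_const"
abbreviation at_t :: "'a::ring_1 fps \<Rightarrow> 'a fps fps" where "at_t \<equiv> fps_const"

abbreviation iota1 :: "'f::field laurent fps \<Rightarrow> 'f op fps" where "iota1 \<equiv> fmap iota"
abbreviation iota2 :: "'f::field laurent fps fps \<Rightarrow> 'f op fps fps" where "iota2 \<equiv> fmap iota1"

lemmas hom1 = unital_hom_fmap[OF unital_hom_iota] and hom2 = unital_hom_fmap[OF unital_hom_fmap[OF unital_hom_iota]]
lemmas hom_s = unital_hom_fmap[OF unital_hom_fps_const]
lemmas hom_t = unital_hom_fps_const

lemma iota2_s: "iota2 (at_s z) = at_s (iota1 z)"
  by (rule fps_ext) (simp add: fmap_const unital_hom_iota)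
lemma iota2_t: "iota2 (at_t z) = at_t (iota1 z)"
  by (rule fmap_const[OF hom1])
lemma at_s_const: "at_s (fps_const x) = fps_const (fps_const x)"
  by (rule fmap_const[OF hom_t])

text \<open>
  The solution with \<open>k\<close> sites. The constant one at the start satisfies the exchange relations
  trivially; its values fix the scalars of index \<open>0\<close> for every \<open>k\<close>.
\<close>

primrec fam_rep :: "'f::field \<Rightarrow> nat \<Rightarrow> fam \<Rightarrow> 'f op fps" where
  "fam_rep q 0 = (\<lambda>a. case a of FC \<Rightarrow> fps_const (iota (cst (- (q + inverse q)))) | FD \<Rightarrow> 1 | _ \<Rightarrow> 0)"
| "fam_rep q (Suc k) = dress_syntax.dress (fps_const (cst q)) (fps_const (cst (inverse q)))
     (fps_const (cst (inverse (q + inverse q)))) (fps_const (gV k 1)) (fps_const (gV k (-1))) (fps_const (gc k 1))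
     iota1 (fps_const (gh k 1)) (fps_const (gh k (-1))) (fps_const (Fop q k)) (fps_const (Gop q k)) (fam_rep q k) fps_X"

lemma iota_comm: "iota x * iota y = iota y * iota x"
proof -
  interpret unital_hom iota by (rule unital_hom_iota)
  show ?thesis by (metis i_mult mult.commute)
qed

text \<open>
  Operators that belong to sites not yet used.
\<close>

definition outer :: "'f::field \<Rightarrow> nat \<Rightarrow> 'f op \<Rightarrow> bool" where
  "outer q k T \<longleftrightarrow> (\<exists>j\<ge>4 * k. \<exists>n. T = iota (mon (unit_vec j n))) \<or> (\<exists>j\<ge>k. T = Fop q j)"

lemma F_var: "q \<noteq> 0 \<Longrightarrow> j \<noteq> 4 * k + 2 \<Longrightarrow> Fop q k * iota (mon (unit_vec j n)) = iota (mon (unit_vec j n)) * Fop q k"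
  by (subst F_mon) auto

lemma F_F:
  assumes "q \<noteq> 0"
  shows "Fop q j * Fop q k = Fop q k * Fop q j"
proof -
  have [simp]: "scaling (chi q a) * scaling (chi q b) = scaling (chi q b) * scaling (chi q a)" for a b
    by (simp add: scaling_mult mult.commute)
  have *: "scaling (chi q (4 * a + 2)) * iota (gy b 1) = iota (gy b 1) * scaling (chi q (4 * a + 2))" for a b
  proof -
    have "4 * b + 3 \<noteq> 4 * a + 2" by presburger
    then show ?thesis using scaling_mon[OF assms, of "4 * a + 2" "unit_vec (4 * b + 3) 1"]
      by (simp add: gy_def) (simp add: unital_hom.i_1[OF unital_hom_iota])
  qed
  have "Fop q j * Fop q k = iota (gy j 1) * (scaling (chi q (4 * j + 2)) * iota (gy k 1)) * scaling (chi q (4 * k + 2))"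
    by (simp add: Fop_def mult.assoc)
  also have "\<dots> = (iota (gy j 1) * iota (gy k 1)) * (scaling (chi q (4 * j + 2)) * scaling (chi q (4 * k + 2)))"
    unfolding * by (simp add: mult.assoc)
  also have "\<dots> = (iota (gy k 1) * iota (gy j 1)) * (scaling (chi q (4 * k + 2)) * scaling (chi q (4 * j + 2)))"
    by (simp add: iota_comm)
  also have "\<dots> = iota (gy k 1) * (iota (gy j 1) * scaling (chi q (4 * k + 2))) * scaling (chi q (4 * j + 2))"
    by (simp add: mult.assoc)
  also have "\<dots> = Fop q k * Fop q j"
    unfolding *[symmetric] by (simp add: Fop_def mult.assoc)
  finally show ?thesis .
qed

lemma commute_inverse:
  fixes T S R :: "'a::ring_1"
  assumes "S * R = 1" "R * S = 1" "T * S = S * T"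
  shows "T * R = R * T"
  by (metis assms mult.assoc mult_1_left mult_1_right)

lemma fps_const_comm: "(\<And>n. T * f $ n = f $ n * T) \<Longrightarrow> fps_const T * f = f * fps_const (T :: 'a::ring_1)"
  by (rule fps_ext) (simp add: fps_mult_left_const_nth fps_mult_right_const_nth)

text \<open>
  The assumptions of \<open>dressing\<close> are symmetric in the two variables, so that only one direction of the
  exchange relations has to be treated for them.
\<close>

lemma dressing_swap:
  assumes "dressing i q q' p V V' c h h' F K s t X Y"
  shows "dressing i q q' p V V' c h h' F K t s Y X"
proof -
  interpret dressing i q q' p V V' c h h' F K s t X Y by fact
  show ?thesis
    by unfold_locales (use qq p VV hh FG GF F_central F_h F_h' XY_i XY_F in auto)
qed

context
  fixes q :: "'f::field"
  assumes q: "q \<noteq> 0" and q4: "q + inverse q \<noteq> 0"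
begin

lemma fam_rep_commute: "outer q k T \<Longrightarrow> fps_const T * fam_rep q k a = fam_rep q k a * fps_const T"
proof (induction k arbitrary: a)
  case 0
  show ?case by (cases a) (auto intro!: fps_const_comm simp: iota_cst simp del: cst_hom)
next
  case (Suc k)
  interpret dress_hom iota1 "fps_const (cst q)" "fps_const (cst (inverse q))"
     "fps_const (cst (inverse (q + inverse q)))" "fps_const (gV k 1)" "fps_const (gV k (-1))" "fps_const (gc k 1)"
     "fps_const (gh k 1)" "fps_const (gh k (-1))" "fps_const (Fop q k)" "fps_const (Gop q k)"
    by (intro dress_hom.intro hom1)
  have "4 * k \<le> 4 * Suc k" by simp
  then have out: "outer q k T"
    using Suc.prems order.trans[of "4 * k" "4 * Suc k"] Suc_leD[of k] unfolding outer_def by blast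
  have const: "tw (fps_const T) (fps_const z) (fps_const z)" if "T * iota z = iota z * T" for z
    using that by (simp add: tw_def fmap_const[OF unital_hom_iota])
  have T_mon: "T * iota (mon (unit_vec j n)) = iota (mon (unit_vec j n)) * T" if "j < 4 * Suc k" for j n
    using Suc.prems unfolding outer_def
  proof (elim disjE exE conjE)
    fix j' assume "Suc k \<le> j'" "T = Fop q j'"
    then show ?thesis using F_var[OF q, of j j' n] that by auto
  qed (auto simp: iota_comm)
  have T_F: "T * Fop q k = Fop q k * T"
    using Suc.prems unfolding outer_def
  proof (elim disjE exE conjE)
    fix j n assume "4 * Suc k \<le> j" "T = iota (mon (unit_vec j n))"
    then show ?thesis using F_var[OF q, of j k n] by auto
  qed (auto simp: F_F q)
  note T_G = commute_inverse[OF FG_op[OF q, of k] GF_op[OF q, of k] T_F]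
  show ?case
    unfolding fam_rep.simps
  proof (rule dress_commute)
    have "tw (fps_const T) fps_X fps_X"
      by (simp add: tw_def fmap_X[OF unital_hom_iota] fps_mult_fps_X_commute)
    then show "tw (fps_const T) z z" if "z \<in> {fps_const (cst q), fps_const (cst (inverse q)),
        fps_const (cst (inverse (q + inverse q))), fps_const (gV k 1), fps_const (gV k (- 1)), fps_const (gc k 1),
        fps_const (gh k 1), fps_const (gh k (- 1)), fps_X}" for z
      using that by (auto intro!: const simp: iota_cst T_mon gV_def gc_def gh_def)
    show "fps_const T * fps_const (Fop q k) = fps_const (Fop q k) * fps_const T" using T_F by simp
    show "fps_const T * fps_const (Gop q k) = fps_const (Gop q k) * fps_const T" using T_G by simp
    show "fps_const T * fam_rep q k a = fam_rep q k a * fps_const T" for a by (rule Suc.IH[OF out])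
  qed
qed

abbreviation "qs \<equiv> (fps_const (fps_const (cst q)) :: 'f laurent fps fps)"
abbreviation "qs' \<equiv> (fps_const (fps_const (cst (inverse q))) :: 'f laurent fps fps)"
abbreviation "ss \<equiv> (fps_X :: 'f laurent fps fps)"
abbreviation "tt \<equiv> (fps_const fps_X :: 'f laurent fps fps)"

text \<open>
  \<open>iota2\<close> fixes the variables, and \<open>s z = t z\<close> forces the coefficient of \<open>s\<^sup>n\<close> in \<open>z\<close> to vanish once the
  one of \<open>s\<^sup>n\<^sup>-\<^sup>1\<close> does.
\<close>

lemma cancel_diff:
  assumes "iota2 (ss - tt) * z = 0"
  shows "z = 0"
proof -
  interpret h2: unital_hom "iota2 :: 'f laurent fps fps \<Rightarrow> 'f op fps fps" by (rule hom2)
  have "fps_X * z = fps_const fps_X * z"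
    using assms by (simp add: h2.i_diff fmap_X[OF hom1] fmap_const[OF hom1] fmap_X[OF unital_hom_iota] left_diff_distrib)
  then have eq: "(fps_X * z) $ n = fps_X * z $ n" for n by simp
  have "z $ n = 0" for n
  proof (induction n)
    case 0
    show ?case using eq[of 0] fps_mult_fps_X_nonzero(1)[of "z $ 0"] by auto
  next
    case (Suc n)
    then show ?case using eq[of "Suc n"] fps_mult_fps_X_nonzero(1)[of "z $ Suc n"] by auto
  qed
  then show ?thesis by (simp add: fps_eq_iff)
qed

lemma exchange_base:
  fixes u v :: "'f laurent fps fps"
  assumes "\<And>a. Z a = fps_const (fps_const (fam_rep q 0 a $ 0))" "\<And>a. W a = fps_const (fps_const (fam_rep q 0 a $ 0))"
  shows "exchange iota2 qs qs' u v Z W"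
  unfolding exchange_def
proof (intro conjI allI)
  show "Z a * W a = W a * Z a" for a using assms by simp
qed (simp_all add: assms iota_cst)

lemma dressing_site:
  "dressing iota2 qs qs' (fps_const (fps_const (cst (inverse (q + inverse q))))) (fps_const (fps_const (gV k 1)))
     (fps_const (fps_const (gV k (-1)))) (fps_const (fps_const (gc k 1))) (fps_const (fps_const (gh k 1)))
     (fps_const (fps_const (gh k (-1)))) (fps_const (fps_const (Fop q k))) (fps_const (fps_const (Gop q k)))
     ss tt (\<lambda>a. at_s (fam_rep q k a)) (\<lambda>a. at_t (fam_rep q k a))"
proof -
  interpret h0: unital_hom "iota :: 'f laurent \<Rightarrow> 'f op" by (rule unital_hom_iota)
  interpret h2: unital_hom "iota2 :: 'f laurent fps fps \<Rightarrow> 'f op fps fps" by (rule hom2)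
  have i2: "iota2 (fps_const (fps_const z)) = fps_const (fps_const (iota z))" for z
    by (simp add: fmap_const[OF hom1] fmap_const[OF unital_hom_iota])
  have s: "iota2 ss = fps_X" and t: "iota2 tt = fps_const fps_X"
    by (simp_all add: fmap_X[OF hom1] fmap_const[OF hom1] fmap_X[OF unital_hom_iota])
  have s_comm: "fps_X * z = z * fps_X" and t_comm: "fps_const fps_X * z = z * fps_const fps_X" for z :: "'f op fps fps"
    by (simp_all add: fps_mult_fps_X_commute fps_const_comm)
  have inv: "cst q * cst (inverse q) = 1" using q by (metis cst_hom(2,4) right_inverse)
  have inv': "cst (inverse (q + inverse q)) * (cst q + cst (inverse q)) = 1"
    using q4 by (metis cst_hom(2-4) left_inverse)
  have mon1: "mon (unit_vec j 1) * mon (unit_vec j (-1)) = (1 :: 'f laurent)" for j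
    by (simp add: mon_mult flip: single_add) (simp add: mon_0)
  have F_const: "fps_const (fps_const (Fop q k)) * iota2 (fps_const (fps_const z)) = iota2 (fps_const (fps_const z')) * fps_const (fps_const (Fop q k))"
    if "Fop q k * iota z = iota z' * Fop q k" for z z'
    using that by (simp add: i2)
  have F_h: "Fop q k * iota (gh k 1) = iota (cst (q ^ 2) * gh k 1) * Fop q k"
    and F_h': "Fop q k * iota (gh k (-1)) = iota (cst (inverse q ^ 2) * gh k (-1)) * Fop q k"
    unfolding gh_def by (subst F_mon[OF q]; simp add: power_int_minus power_inverse)+
  have outer: "outer q k T \<Longrightarrow> fam_rep q k a * fps_const T = fps_const T * fam_rep q k a" for T a
    using fam_rep_commute by metis
  have outer_s: "at_s (fam_rep q k a) * fps_const (fps_const T) = fps_const (fps_const T) * at_s (fam_rep q k a)"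
    if "fam_rep q k a * fps_const T = fps_const T * fam_rep q k a" for T a
    using unital_hom.i_mult[OF hom_s, of "fam_rep q k a" "fps_const T"] unital_hom.i_mult[OF hom_s, of "fps_const T" "fam_rep q k a"] that
    by (simp add: at_s_const)
  have XY: "at_s (fam_rep q k a) * fps_const (fps_const T) = fps_const (fps_const T) * at_s (fam_rep q k a) \<and>
     at_t (fam_rep q k a) * fps_const (fps_const T) = fps_const (fps_const T) * at_t (fam_rep q k a)"
    if "outer q k T \<or> (\<exists>c. T = iota (cst c))" for T a
  proof -
    have "fam_rep q k a * fps_const T = fps_const T * fam_rep q k a"
      using that
    proof
      assume "\<exists>c. T = iota (cst c)"
      then show ?thesis by (auto intro!: fps_const_comm[symmetric] simp: iota_cst)
    qed (rule outer)
    then show ?thesis using outer_s[of a T] by simp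
  qed
  have out_mon: "outer q k (iota (mon (unit_vec j n)))" if "j \<ge> 4 * k" for j n
    using that by (auto simp: outer_def)
  show ?thesis
  proof (intro dressing.intro dress_hom.intro dressing_axioms.intro coefs.intro)
    show "unital_hom iota2" by (rule hom2)
    show "qs * qs' = 1" using inv by simp
    show "fps_const (fps_const (cst (inverse (q + inverse q)))) * (qs + qs') = 1" using inv' by simp
    show "fps_const (fps_const (gV k 1)) * fps_const (fps_const (gV k (-1))) = (1 :: 'f laurent fps fps)" by (simp add: gV_def mon1)
    show "fps_const (fps_const (gh k 1)) * fps_const (fps_const (gh k (-1))) = (1 :: 'f laurent fps fps)" by (simp add: gh_def mon1)
    show "fps_const (fps_const (Fop q k)) * fps_const (fps_const (Gop q k)) = 1"
      "fps_const (fps_const (Gop q k)) * fps_const (fps_const (Fop q k)) = 1"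
      using FG_op[OF q] GF_op[OF q] by simp_all
    show "fps_const (fps_const (Fop q k)) * iota2 (fps_const (fps_const (gh k 1))) =
        iota2 (qs\<^sup>2 * fps_const (fps_const (gh k 1))) * fps_const (fps_const (Fop q k))"
      using F_const[OF F_h] by (simp add: power2_eq_square)
    show "fps_const (fps_const (Fop q k)) * iota2 (fps_const (fps_const (gh k (-1)))) =
        iota2 (qs'\<^sup>2 * fps_const (fps_const (gh k (-1)))) * fps_const (fps_const (Fop q k))"
      using F_const[OF F_h'] by (simp add: power2_eq_square)
    have F_var': "Fop q k * iota (mon (unit_vec (4 * k) n)) = iota (mon (unit_vec (4 * k) n)) * Fop q k"
      "Fop q k * iota (mon (unit_vec (4 * k + 1) n)) = iota (mon (unit_vec (4 * k + 1) n)) * Fop q k" for n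
      by (rule F_var[OF q], simp)+
    show "fps_const (fps_const (Fop q k)) * iota2 z = iota2 z * fps_const (fps_const (Fop q k))"
      if "z \<in> {qs, qs', fps_const (fps_const (cst (inverse (q + inverse q)))), fps_const (fps_const (gV k 1)),
         fps_const (fps_const (gV k (- 1))), fps_const (fps_const (gc k 1)), ss, tt}" for z
      using that F_var' by (auto simp: s t s_comm t_comm gV_def gc_def fps_mult_fps_X_commute intro!: F_const iota_cst)
    show "at_s (fam_rep q k a) * iota2 z = iota2 z * at_s (fam_rep q k a) \<and>
       at_t (fam_rep q k a) * iota2 z = iota2 z * at_t (fam_rep q k a)"
      if "z \<in> {qs, qs', fps_const (fps_const (cst (inverse (q + inverse q)))), fps_const (fps_const (gV k 1)),
         fps_const (fps_const (gV k (- 1))), fps_const (fps_const (gc k 1)), ss, tt, fps_const (fps_const (gh k 1)), fps_const (fps_const (gh k (-1)))}" for z a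
    proof -
      from that consider "z = ss" | "z = tt" |
        w where "z = fps_const (fps_const w)" "outer q k (iota w) \<or> (\<exists>c. iota w = iota (cst c))"
        unfolding gV_def gc_def gh_def using out_mon[OF le_refl] out_mon[OF le_add1] by blast
      then show ?thesis
      proof cases
        case (3 w)
        show ?thesis using XY[OF 3(2), of a] by (simp only: 3(1) i2)
      qed (simp_all only: s t s_comm t_comm)
    qed
    show "at_s (fam_rep q k a) * fps_const (fps_const (Fop q k)) = fps_const (fps_const (Fop q k)) * at_s (fam_rep q k a) \<and>
       at_t (fam_rep q k a) * fps_const (fps_const (Fop q k)) = fps_const (fps_const (Fop q k)) * at_t (fam_rep q k a)" for a
      by (rule XY) (auto simp: outer_def)
  qed
qed

theorem fam_rep_exchange:
  "exchange iota2 qs qs' ss tt (\<lambda>a. at_s (fam_rep q k a)) (\<lambda>a. at_t (fam_rep q k a)) \<and>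
   exchange iota2 qs qs' tt ss (\<lambda>a. at_t (fam_rep q k a)) (\<lambda>a. at_s (fam_rep q k a))"
proof (induction k)
  case 0
  have [simp]: "n \<noteq> 0 \<Longrightarrow> fam_rep q 0 a $ n = 0" for a n
    by (cases a) auto
  have "at_t (fam_rep q 0 a) = fps_const (fps_const (fam_rep q 0 a $ 0))"
     "at_s (fam_rep q 0 a) = fps_const (fps_const (fam_rep q 0 a $ 0))" for a
    by (auto intro!: fps_ext simp del: fam_rep.simps)
  then show ?case by (intro conjI exchange_base) simp_all
next
  case (Suc k)
  note D = dressing_site[of k]
  note D' = dressing_swap[OF D]
  have canc': "iota2 (tt - ss) * z = 0 \<Longrightarrow> z = 0" for z
  proof -
    assume z: "iota2 (tt - ss) * z = 0"
    have e: "iota2 (ss - tt) = - iota2 (tt - ss)"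
      using unital_hom.i_minus[OF hom2, of "tt - ss :: 'f laurent fps fps"] by (simp only: minus_diff_eq)
    show "z = 0" by (rule cancel_diff) (simp only: e z minus_zero flip: minus_mult_left)
  qed
  have s: "at_s (fam_rep q (Suc k) a) = dress_syntax.dress qs qs' (fps_const (fps_const (cst (inverse (q + inverse q))))) (fps_const (fps_const (gV k 1)))
     (fps_const (fps_const (gV k (-1)))) (fps_const (fps_const (gc k 1))) iota2 (fps_const (fps_const (gh k 1)))
     (fps_const (fps_const (gh k (-1)))) (fps_const (fps_const (Fop q k))) (fps_const (fps_const (Gop q k)))
      (\<lambda>a. at_s (fam_rep q k a)) ss a" for a
    unfolding fam_rep.simps dress_transport[where f = at_s and g = at_s and i = iota1 and j = iota2, OF hom_s hom_s iota2_s[symmetric]]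
    by (simp only: at_s_const fmap_X[OF hom_t])
  have t: "at_t (fam_rep q (Suc k) a) = dress_syntax.dress qs qs' (fps_const (fps_const (cst (inverse (q + inverse q))))) (fps_const (fps_const (gV k 1)))
     (fps_const (fps_const (gV k (-1)))) (fps_const (fps_const (gc k 1))) iota2 (fps_const (fps_const (gh k 1)))
     (fps_const (fps_const (gh k (-1)))) (fps_const (fps_const (Fop q k))) (fps_const (fps_const (Gop q k)))
      (\<lambda>a. at_t (fam_rep q k a)) tt a" for a
    unfolding fam_rep.simps dress_transport[where f = at_t and g = at_t and i = iota1 and j = iota2, OF hom_t hom_t iota2_t[symmetric]] ..
  show ?case
    unfolding s t
  proof
    show "exchange iota2 qs qs' ss tt
        (dress_syntax.dress qs qs' (fps_const (fps_const (cst (inverse (q + inverse q))))) (fps_const (fps_const (gV k 1)))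
          (fps_const (fps_const (gV k (-1)))) (fps_const (fps_const (gc k 1))) iota2 (fps_const (fps_const (gh k 1)))
          (fps_const (fps_const (gh k (-1)))) (fps_const (fps_const (Fop q k))) (fps_const (fps_const (Gop q k)))
          (\<lambda>a. at_s (fam_rep q k a)) ss)
        (dress_syntax.dress qs qs' (fps_const (fps_const (cst (inverse (q + inverse q))))) (fps_const (fps_const (gV k 1)))
          (fps_const (fps_const (gV k (-1)))) (fps_const (fps_const (gc k 1))) iota2 (fps_const (fps_const (gh k 1)))
          (fps_const (fps_const (gh k (-1)))) (fps_const (fps_const (Fop q k))) (fps_const (fps_const (Gop q k)))
          (\<lambda>a. at_t (fam_rep q k a)) tt)"
      by (rule dressing.exchange_dress[OF D Suc.IH[THEN conjunct1] Suc.IH[THEN conjunct2]]) (rule cancel_diff)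
    show "exchange iota2 qs qs' tt ss
        (dress_syntax.dress qs qs' (fps_const (fps_const (cst (inverse (q + inverse q))))) (fps_const (fps_const (gV k 1)))
          (fps_const (fps_const (gV k (-1)))) (fps_const (fps_const (gc k 1))) iota2 (fps_const (fps_const (gh k 1)))
          (fps_const (fps_const (gh k (-1)))) (fps_const (fps_const (Fop q k))) (fps_const (fps_const (Gop q k)))
          (\<lambda>a. at_t (fam_rep q k a)) tt)
        (dress_syntax.dress qs qs' (fps_const (fps_const (cst (inverse (q + inverse q))))) (fps_const (fps_const (gV k 1)))
          (fps_const (fps_const (gV k (-1)))) (fps_const (fps_const (gc k 1))) iota2 (fps_const (fps_const (gh k 1)))
          (fps_const (fps_const (gh k (-1)))) (fps_const (fps_const (Fop q k))) (fps_const (fps_const (Gop q k)))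
          (\<lambda>a. at_s (fam_rep q k a)) ss)"
      by (rule dressing.exchange_dress[OF D' Suc.IH[THEN conjunct2] Suc.IH[THEN conjunct1]]) (rule canc')
  qed
qed

end

section \<open>Relations between the coefficients\<close>

declare cst_hom [simp del]

definition nth2 :: "'a::ring_1 fps fps \<Rightarrow> nat \<Rightarrow> nat \<Rightarrow> 'a" where
  "nth2 f i j = fps_nth (fps_nth f i) j"

lemma nth2_simps:
  fixes f :: "'a::ring_1 fps fps"
  shows "nth2 (f + g) i j = nth2 f i j + nth2 g i j" "nth2 (f - g) i j = nth2 f i j - nth2 g i j" "nth2 (- f) i j = - nth2 f i j"
    "nth2 (fps_X * f) i j = (if i = 0 then 0 else nth2 f (i - 1) j)"
    "nth2 (fps_const fps_X * f) i j = (if j = 0 then 0 else nth2 f i (j - 1))"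
    "nth2 (fps_const (fps_const z) * f) i j = z * nth2 f i j"
    "nth2 (at_s x * at_t y) i j = fps_nth x i * fps_nth y j"
    "nth2 (at_t y * at_s x) i j = fps_nth y j * fps_nth x i"
  by (simp_all add: nth2_def fps_X_mult_nth fps_mult_left_const_nth fps_mult_right_const_nth)

definition comm_op :: "'f::field op \<Rightarrow> 'f op \<Rightarrow> 'f op" where "comm_op x y = x * y - y * x"

context
  fixes q :: "'f::field"
  assumes q: "q \<noteq> 0" and q4: "q + inverse q \<noteq> 0"
begin

abbreviation (input) "sc \<equiv> \<lambda>z::'f. iota (cst z)"

lemma sc_hom: "sc (x + y) = sc x + sc y" "sc (x * y) = sc x * sc y" "sc (x - y) = sc x - sc y" "sc (- x) = - sc x" "sc 1 = 1" "sc 0 = 0"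
proof -
  interpret unital_hom iota by (rule unital_hom_iota)
  show "sc (x + y) = sc x + sc y" "sc (x * y) = sc x * sc y" "sc (x - y) = sc x - sc y" "sc (- x) = - sc x" "sc 1 = 1" "sc 0 = 0"
    by (simp_all add: cst_hom i_add i_mult i_diff i_minus i_1 i_0)
qed

lemma sc_comm: "T * sc z = sc z * T" "T * (sc z * U) = sc z * (T * U)"
  by (metis iota_cst mult.assoc)+

lemma iota2_simps:
  "iota2 (fps_const (fps_const (cst z))) = fps_const (fps_const (sc z))"
  "iota2 fps_X = (fps_X :: 'f op fps fps)" "iota2 (fps_const fps_X) = (fps_const fps_X :: 'f op fps fps)"
  "iota2 (x * y) = iota2 x * (iota2 y :: 'f op fps fps)" "iota2 (x - y) = iota2 x - (iota2 y :: 'f op fps fps)" "iota2 1 = (1 :: 'f op fps fps)"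
proof -
  interpret h2: unital_hom "iota2 :: 'f laurent fps fps \<Rightarrow> 'f op fps fps" by (rule hom2)
  show "iota2 (fps_const (fps_const (cst z))) = fps_const (fps_const (sc z))"
  "iota2 fps_X = (fps_X :: 'f op fps fps)" "iota2 (fps_const fps_X) = (fps_const fps_X :: 'f op fps fps)"
  "iota2 (x * y) = iota2 x * (iota2 y :: 'f op fps fps)" "iota2 (x - y) = iota2 x - (iota2 y :: 'f op fps fps)" "iota2 1 = (1 :: 'f op fps fps)"
    by (simp_all add: fmap_X[OF hom1] fmap_const[OF hom1] fmap_X[OF unital_hom_iota] fmap_const[OF unital_hom_iota]
        h2.i_mult h2.i_diff h2.i_1)
qed

abbreviation (input) "hq \<equiv> q - inverse q"

lemma qs_diff: "qs q - qs' q = fps_const (fps_const (cst hq))"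
  by (simp add: cst_hom)

context
  fixes k :: nat
begin

abbreviation "cX a \<equiv> fam_rep q k a"
abbreviation "cA n \<equiv> fam_rep q k FA $ n"
abbreviation "cB n \<equiv> fam_rep q k FB $ n"
abbreviation "cC n \<equiv> fam_rep q k FC $ n"
abbreviation "cD n \<equiv> fam_rep q k FD $ n"

lemmas ex_st = fam_rep_exchange[OF q q4, of k, THEN conjunct1]
lemmas ex_ts = fam_rep_exchange[OF q q4, of k, THEN conjunct2]

lemma comm_same: "fps_nth (cX a) i * fps_nth (cX a) j = fps_nth (cX a) j * fps_nth (cX a) i"
  using arg_cong[OF exchangeD(1)[OF ex_st, of a], of "\<lambda>x. nth2 x i j"] by (simp add: nth2_simps)

lemmas norm = nth2_simps left_diff_distrib right_diff_distrib distrib_left mult.assoc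

text \<open>
  The coefficient of \<open>s\<^sup>i t\<^sup>j\<close> in an exchange relation. For the relations with \<open>C\<close> or \<open>D\<close> it is taken at
  \<open>s\<^sup>n\<^sup>+\<^sup>2 t\<^sup>0\<close>, where all terms with a factor \<open>t\<close> drop out; the results are the defining relations
  with a \<open>q\<close>-commutator.
\<close>

lemma raw_AB: "(if i = 0 then 0 else comm_op (cA (i - 1)) (cB j)) - (if j = 0 then 0 else comm_op (cA i) (cB (j - 1)))
     = sc hq * (cC j * cD i - cC i * cD j)"
  using arg_cong[OF exchangeD(2)[OF ex_st, unfolded qs_diff iota2_simps], of "\<lambda>x. nth2 x i j"]
  by (cases i; cases j) (simp_all add: norm comm_op_def algebra_simps)

lemma raw_CA: "comm_op (cC (Suc n)) (cA 0) =
    sc hq * (sc (inverse q) * (cC (Suc n) * cA 0 - cC 0 * (cA (Suc n) - cB n)))"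
  using arg_cong[OF exchangeD(3)[OF ex_st, unfolded qs_diff iota2_simps], of "\<lambda>x. nth2 x (Suc (Suc n)) 0"]
  by (simp add: norm comm_op_def)

lemma raw_CB: "comm_op (cC (Suc n)) (cB 0) =
    - (sc hq * (sc q * (cC (Suc n) * cB 0 - cC 0 * (cB (Suc n) - cA n))))"
  using arg_cong[OF exchangeD(4)[OF ex_st, unfolded qs_diff iota2_simps], of "\<lambda>x. nth2 x (Suc (Suc n)) 0"]
  by (simp add: norm comm_op_def)

lemma raw_AD: "comm_op (cA 0) (cD (Suc n)) =
    sc hq * (sc (inverse q) * (cA 0 * cD (Suc n) - (cA (Suc n) - cB n) * cD 0))"
  using arg_cong[OF exchangeD(5)[OF ex_st, unfolded qs_diff iota2_simps], of "\<lambda>x. nth2 x (Suc (Suc n)) 0"]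
  by (simp add: norm comm_op_def)

lemma raw_BD: "comm_op (cB 0) (cD (Suc n)) =
    - (sc hq * (sc q * (cB 0 * cD (Suc n) - (cB (Suc n) - cA n) * cD 0)))"
  using arg_cong[OF exchangeD(6)[OF ex_st, unfolded qs_diff iota2_simps], of "\<lambda>x. nth2 x (Suc (Suc n)) 0"]
  by (simp add: norm comm_op_def)

lemma iota2_anti: "iota2 (tt - ss) = - (iota2 (ss - tt) :: 'f op fps fps)"
  using unital_hom.i_minus[OF hom2, of "ss - tt :: 'f laurent fps fps"] by (simp only: minus_diff_eq)

lemma const_pass: "fps_const fps_X * (x * y) = x * (fps_const fps_X * y)" "fps_X * (x * y) = x * (fps_X * y)"
  for x y :: "'f op fps fps"
proof -
  have "fps_const fps_X * x = x * fps_const fps_X" by (rule fps_const_comm) (simp add: fps_mult_fps_X_commute)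
  then show "fps_const fps_X * (x * y) = x * (fps_const fps_X * y)" by (simp only: mult.assoc[symmetric])
  show "fps_X * (x * y) = x * (fps_X * y)" by (metis mult.assoc fps_mult_fps_X_commute)
qed

text \<open>
  The remaining defining relations express symmetry in the two variables. The right-hand sides of an
  exchange relation for \<open>(s, t)\<close> and for \<open>(t, s)\<close> are opposite to each other, and so are the factors
  \<open>s - t\<close> and \<open>t - s\<close>; hence the commutators agree.
\<close>

lemma sym_aux0:
  assumes st: "iota2 (ss - tt) * K1 = Q" and ts: "iota2 (tt - ss) * K2 = Q'" and Q: "Q' = - Q"
  shows "K1 = (K2 :: 'f op fps fps)"
proof -
  have "iota2 (ss - tt) * (K1 - K2) = iota2 (ss - tt) * K1 + iota2 (tt - ss) * K2"
    unfolding iota2_anti by (simp add: right_diff_distrib)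
  also have "\<dots> = 0" unfolding st ts Q by simp
  finally have "K1 - K2 = 0" by (rule cancel_diff[OF q q4])
  then show ?thesis by (simp only: right_minus_eq)
qed

lemma sym_AB: "comm_op (cA i) (cB j) = comm_op (cA j) (cB i)"
proof -
  have "at_s (cX FA) * at_t (cX FB) - at_t (cX FB) * at_s (cX FA) = at_t (cX FA) * at_s (cX FB) - at_s (cX FB) * at_t (cX FA)"
    by (rule sym_aux0[OF exchangeD(2)[OF ex_st] exchangeD(2)[OF ex_ts]]) (simp add: algebra_simps)
  from arg_cong[OF this, of "\<lambda>x. nth2 x i j"] show ?thesis
    by (simp add: nth2_simps comm_op_def)
qed

lemma sym_CD: "comm_op (cC i) (cD j) = comm_op (cC j) (cD i)"
proof -
  have 1: "1 - tt * ss = 1 - ss * (tt :: 'f laurent fps fps)" "(qs q - qs' q) * tt * ss = (qs q - qs' q) * ss * tt"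
    by (simp_all add: ac_simps)
  have "at_s (cX FC) * at_t (cX FD) - at_t (cX FD) * at_s (cX FC) = at_t (cX FC) * at_s (cX FD) - at_s (cX FD) * at_t (cX FC)"
  proof (rule sym_aux0[OF exchangeD(7)[OF ex_st] exchangeD(7)[OF ex_ts]], unfold 1 iota2_anti)
    have 2: "at_t (cX FA) * at_s (cX FA) = at_s (cX FA) * at_t (cX FA)" "at_t (cX FB) * at_s (cX FB) = at_s (cX FB) * at_t (cX FB)"
      using exchangeD(1)[OF ex_st, of FA] exchangeD(1)[OF ex_st, of FB] by simp_all
    have 3: "- c * (x * (a - b) + - y * (a' - b')) = - (- c * (x * (b - a) + y * (a' - b')))" for c x y a b a' b' :: "'f op fps fps"
      by (simp add: algebra_simps)
    show "- iota2 ((qs q - qs' q) * ss * tt) * (iota2 (1 - ss * tt) * (at_t (cX FA) * at_s (cX FB) - at_s (cX FA) * at_t (cX FB)) +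
        - iota2 (ss - tt) * (at_t (cX FA) * at_s (cX FA) - at_t (cX FB) * at_s (cX FB))) =
      - (- iota2 ((qs q - qs' q) * ss * tt) * (iota2 (1 - ss * tt) * (at_s (cX FA) * at_t (cX FB) - at_t (cX FA) * at_s (cX FB)) +
        iota2 (ss - tt) * (at_s (cX FA) * at_t (cX FA) - at_s (cX FB) * at_t (cX FB))))"
      unfolding 2 by (rule 3)
  qed
  from arg_cong[OF this, of "\<lambda>x. nth2 x i j"] show ?thesis
    by (simp add: nth2_simps comm_op_def)
qed

text \<open>
  The same where the right-hand side has a factor \<open>s\<close>, respectively \<open>t\<close>, which has to be balanced.
  This is the origin of the index shift for \<open>G\<close> and \<open>Gt\<close> in the symmetric relations.
\<close>

lemma sym_aux:
  assumes st: "iota2 (ss - tt) * K1 = iota2 (r * ss) * Q" and ts: "iota2 (tt - ss) * K2 = iota2 (r * tt) * Q'" and Q: "Q' = - Q"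
  shows "fps_const fps_X * K1 = fps_X * (K2 :: 'f op fps fps)"
proof -
  have 1: "iota2 (ss - tt) * K1 = iota2 r * (fps_X * Q)" using st by (simp only: iota2_simps mult.assoc)
  have 2: "iota2 (ss - tt) * K2 = iota2 r * (fps_const fps_X * Q)"
    using ts unfolding iota2_anti Q by (simp only: iota2_simps mult.assoc mult_minus_left mult_minus_right neg_equal_iff_equal)
  have "iota2 (ss - tt) * (fps_const fps_X * K1 - fps_X * K2)
     = fps_const fps_X * (iota2 (ss - tt) * K1) - fps_X * (iota2 (ss - tt) * K2)"
    by (simp only: right_diff_distrib const_pass)
  also have "\<dots> = 0" unfolding 1 2 by (simp only: const_pass(1)[of "iota2 r"] const_pass(2)[of "iota2 r"] const_pass(1)[of fps_X] diff_self)
  finally have "fps_const fps_X * K1 - fps_X * K2 = 0" by (rule cancel_diff[OF q q4])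
  then show ?thesis by (simp only: right_minus_eq)
qed

lemma sym_aux_minus:
  assumes st: "iota2 (ss - tt) * K1 = - iota2 (r * ss) * Q" and ts: "iota2 (tt - ss) * K2 = - iota2 (r * tt) * Q'" and Q: "Q' = - Q"
  shows "fps_const fps_X * K1 = fps_X * (K2 :: 'f op fps fps)"
proof (rule sym_aux)
  show "iota2 (ss - tt) * K1 = iota2 (r * ss) * (- Q)" using st by simp
  show "iota2 (tt - ss) * K2 = iota2 (r * tt) * (- Q')" using ts by simp
qed (simp add: Q)

lemma sym_CA: "comm_op (cC (Suc i)) (cA j) = comm_op (cC (Suc j)) (cA i)"
proof -
  have "fps_const fps_X * (at_s (cX FC) * at_t (cX FA) - at_t (cX FA) * at_s (cX FC)) = fps_X * (at_t (cX FC) * at_s (cX FA) - at_s (cX FA) * at_t (cX FC))"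
    by (rule sym_aux[OF exchangeD(3)[OF ex_st] exchangeD(3)[OF ex_ts]]) (simp add: algebra_simps)
  from arg_cong[OF this, of "\<lambda>x. nth2 x (Suc i) (Suc j)"] show ?thesis
    by (simp add: nth2_simps comm_op_def)
qed

lemma sym_CB: "comm_op (cC (Suc i)) (cB j) = comm_op (cC (Suc j)) (cB i)"
proof -
  have "fps_const fps_X * (at_s (cX FC) * at_t (cX FB) - at_t (cX FB) * at_s (cX FC)) = fps_X * (at_t (cX FC) * at_s (cX FB) - at_s (cX FB) * at_t (cX FC))"
    by (rule sym_aux_minus[OF exchangeD(4)[OF ex_st] exchangeD(4)[OF ex_ts]]) (simp add: algebra_simps)
  from arg_cong[OF this, of "\<lambda>x. nth2 x (Suc i) (Suc j)"] show ?thesis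
    by (simp add: nth2_simps comm_op_def)
qed

lemma sym_AD: "comm_op (cA i) (cD (Suc j)) = comm_op (cA j) (cD (Suc i))"
proof -
  have "fps_const fps_X * (at_t (cX FA) * at_s (cX FD) - at_s (cX FD) * at_t (cX FA)) = fps_X * (at_s (cX FA) * at_t (cX FD) - at_t (cX FD) * at_s (cX FA))"
    by (rule sym_aux[OF exchangeD(5)[OF ex_st] exchangeD(5)[OF ex_ts]]) (simp add: algebra_simps)
  from arg_cong[OF this, of "\<lambda>x. nth2 x (Suc j) (Suc i)"] show ?thesis
    by (simp add: nth2_simps comm_op_def)
qed

lemma sym_BD: "comm_op (cB i) (cD (Suc j)) = comm_op (cB j) (cD (Suc i))"
proof -
  have "fps_const fps_X * (at_t (cX FB) * at_s (cX FD) - at_s (cX FD) * at_t (cX FB)) = fps_X * (at_s (cX FB) * at_t (cX FD) - at_t (cX FD) * at_s (cX FB))"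
    by (rule sym_aux_minus[OF exchangeD(6)[OF ex_st] exchangeD(6)[OF ex_ts]]) (simp add: algebra_simps)
  from arg_cong[OF this, of "\<lambda>x. nth2 x (Suc j) (Suc i)"] show ?thesis
    by (simp add: nth2_simps comm_op_def)
qed

end
end

section \<open>The recursion over sites, coefficient by coefficient\<close>

context
  fixes q :: "'f::field"
  assumes q: "q \<noteq> 0" and q4: "q + inverse q \<noteq> 0"
begin

abbreviation (input) "pinv \<equiv> cst (inverse (q + inverse q))"

text \<open>
  The series \<open>phi\<close> of site \<open>k\<close> are polynomials of degree at most two, hence a coefficient of the
  dressed family involves at most three consecutive coefficients of the old one.
\<close>

definition phis :: "nat \<Rightarrow> fam \<Rightarrow> fam \<Rightarrow> 'f laurent fps" where
  "phis k j a = site_coeffs.phi (fps_const (cst q)) (fps_const (cst (inverse q)))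
     (fps_const pinv) (fps_const (gV k 1)) (fps_const (gV k (-1))) (fps_const (gc k 1)) j a
     (fps_const (gh k 1)) (fps_const (gh k (-1))) fps_X"

definition Nop :: "nat \<Rightarrow> fam \<Rightarrow> 'f op" where
  "Nop k j = (case j of FC \<Rightarrow> Fop q k | FD \<Rightarrow> Gop q k | _ \<Rightarrow> 1)"
definition Hop :: "nat \<Rightarrow> fam \<Rightarrow> 'f op" where
  "Hop k j = (case j of FC \<Rightarrow> Gop q k | FD \<Rightarrow> Fop q k | _ \<Rightarrow> 1)"

abbreviation (input) "eL k \<equiv> gV k 1 * (gc k 1 - pinv * (cst (inverse q) * gh k 1 + cst q * gh k (-1)))"
abbreviation (input) "fL k \<equiv> gV k 1 * (gc k 1 - pinv * (cst q * gh k 1 + cst (inverse q) * gh k (-1)))"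

lemma phis_nth:
  "fps_nth (phis k FA FA) i = (if i = 0 then gh k 1 else if i = 1 then - (pinv * (gV k 1 + gV k (-1))) else 0)"
  "fps_nth (phis k FA FB) i = (if i = 1 then gc k 1 - gh k 1 else 0)"
  "fps_nth (phis k FA FC) i = (if i = 0 then eL k else 0)"
  "fps_nth (phis k FA FD) i = (if i = 0 then cst q * gV k (-1) * gh k 1 else 0)"
  "fps_nth (phis k FB FA) i = (if i = 1 then gc k 1 - gh k (-1) else 0)"
  "fps_nth (phis k FB FB) i = (if i = 0 then gh k (-1) else if i = 1 then - (pinv * (gV k 1 + gV k (-1))) else 0)"
  "fps_nth (phis k FB FC) i = (if i = 0 then cst q * gV k (-1) * gh k (-1) * eL k else 0)"
  "fps_nth (phis k FB FD) i = (if i = 0 then 1 else 0)"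
  "fps_nth (phis k FC FA) i = (if i = 1 then cst (inverse q) * gh k 1 else if i = 2 then - gV k (-1) else 0)"
  "fps_nth (phis k FC FB) i = (if i = 1 then gV k (-1) else if i = 2 then - (cst (inverse q) * gh k 1) else 0)"
  "fps_nth (phis k FC FC) i = (if i = 0 then 1 else if i = 1 then - (pinv * (gV k 1 * (cst (inverse q))^2 * gh k 1 + gV k (-1) * (cst q)^2 * gh k (-1))) else 0)"
  "fps_nth (phis k FC FD) i = (if i = 1 then gV k (-1) * gh k 1 else 0)"
  "fps_nth (phis k FD FA) i = (if i = 1 then gV k (-1) * fL k else if i = 2 then - (cst (inverse q) * gh k (-1) * fL k) else 0)"
  "fps_nth (phis k FD FB) i = (if i = 1 then cst (inverse q) * gh k (-1) * fL k else if i = 2 then - (gV k (-1) * fL k) else 0)"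
  "fps_nth (phis k FD FC) i = (if i = 1 then gV k (-1) * gh k (-1) * fL k * eL k else 0)"
  "fps_nth (phis k FD FD) i = (if i = 0 then 1 else if i = 1 then - (pinv * (gV k 1 * (cst (inverse q))^2 * gh k (-1) + gV k (-1) * (cst q)^2 * gh k 1)) else 0)"
  by (auto simp: phis_def site_coeffs.phi.simps site_coeffs.e_def site_coeffs.f_def mult.assoc fps_X_mult_nth
      fps_mult_left_const_nth algebra_simps simp del: )

definition term_op :: "nat \<Rightarrow> fam \<Rightarrow> fam \<Rightarrow> nat \<Rightarrow> 'f op" where
  "term_op k j a i = Nop k j * (iota (fps_nth (phis k j a) i) * Hop k a)"

lemma fam_rep_Suc_nth:
  "fps_nth (fam_rep q (Suc k) j) n = (\<Sum>a\<in>UNIV. term_op k j a 0 * fps_nth (fam_rep q k a) n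
      + (if n = 0 then 0 else term_op k j a 1 * fps_nth (fam_rep q k a) (n - 1))
      + (if n \<le> 1 then 0 else term_op k j a 2 * fps_nth (fam_rep q k a) (n - 2)))"
proof -
  have high: "fps_nth (phis k j a) i = 0" if "i > 2" for a i
    using that by (cases j; cases a) (simp_all add: phis_nth)
  have hat: "dress_syntax.hat (fps_const (Fop q k)) (fps_const (Gop q k)) Z a = fps_const (Hop k a) * Z a" for Z a
    by (cases a) (simp_all add: dress_syntax.hat_def Hop_def)
  have N: "dress_syntax.N (fps_const (Fop q k)) (fps_const (Gop q k)) j = fps_const (Nop k j)"
    by (cases j) (simp_all add: dress_syntax.N_def Nop_def)
  have one: "fps_nth (fps_const (Nop k j) * (iota1 (phis k j a) * (fps_const (Hop k a) * f))) n =
     term_op k j a 0 * fps_nth f n + (if n = 0 then 0 else term_op k j a 1 * fps_nth f (n - 1))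
      + (if n \<le> 1 then 0 else term_op k j a 2 * fps_nth f (n - 2))" for a f
  proof -
    have "fps_nth (fps_const (Nop k j) * (iota1 (phis k j a) * (fps_const (Hop k a) * f))) n =
      (\<Sum>i=0..n. term_op k j a i * fps_nth f (n - i))"
      by (simp only: fps_mult_left_const_nth fps_mult_nth[of "iota1 (phis k j a)"] fmap_nth sum_distrib_left term_op_def mult.assoc)
    also have "\<dots> = (\<Sum>i\<in>{0..n} \<inter> {0, 1, 2}. term_op k j a i * fps_nth f (n - i))"
    proof (rule sum.mono_neutral_right)
      show "\<forall>i\<in>{0..n} - {0..n} \<inter> {0, 1, 2}. term_op k j a i * fps_nth f (n - i) = 0"
      proof
        fix i assume "i \<in> {0..n} - {0..n} \<inter> {0, 1, 2}"
        then have "i > 2" by auto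
        then show "term_op k j a i * fps_nth f (n - i) = 0"
          by (simp add: term_op_def high unital_hom.i_0[OF unital_hom_iota])
      qed
    qed auto
    also have "{0..n} \<inter> {0, 1, 2} = (if n = 0 then {0} else if n = 1 then {0, 1} else {0, 1, 2})"
      by auto
    finally show ?thesis by (auto simp: add.assoc)
  qed
  show ?thesis
    unfolding fam_rep.simps dress_syntax.dress_def hat N phis_def[symmetric] sum_distrib_left
    by (simp only: fps_sum_nth one)
qed

lemma fam_rep_0: "fps_nth (fam_rep q k FC) 0 = iota (cst (- (q + inverse q)))" "fps_nth (fam_rep q k FD) 0 = 1"
proof (induction k)
  case (Suc k)
  have F: "Fop q k * (Gop q k * T) = T" "Gop q k * (Fop q k * T) = T" for T
    using FG_op[OF q] GF_op[OF q] by (simp_all flip: mult.assoc)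
  {
    case 1
    show ?case unfolding fam_rep_Suc_nth sum_fam
      by (simp add: term_op_def phis_nth Nop_def Hop_def mult.assoc F Suc unital_hom.i_0[OF unital_hom_iota] unital_hom.i_1[OF unital_hom_iota])
  next
    case 2
    show ?case unfolding fam_rep_Suc_nth sum_fam
      by (simp add: term_op_def phis_nth Nop_def Hop_def mult.assoc F Suc GF_op[OF q] unital_hom.i_0[OF unital_hom_iota] unital_hom.i_1[OF unital_hom_iota])
  }
qed simp_all

end

section \<open>A representation of the algebra\<close>

text \<open>
  The homomorphism from the free algebra given by the images of the generators.
\<close>

definition ev :: "('x \<Rightarrow> 'f::field op) \<Rightarrow> ('f, 'x) free_algebra \<Rightarrow> 'f op" where
  "ev g P = (\<Sum>w\<in>Poly_Mapping.keys P. iota (cst (Poly_Mapping.lookup P w)) * (case w of Word xs \<Rightarrow> prod_list (map g xs)))"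

lemma ev_superset:
  assumes "finite A" "Poly_Mapping.keys P \<subseteq> A"
  shows "ev g P = (\<Sum>w\<in>A. iota (cst (Poly_Mapping.lookup P w)) * (case w of Word xs \<Rightarrow> prod_list (map g xs)))"
  unfolding ev_def using assms
  by (intro sum.mono_neutral_left) (auto simp: in_keys_iff cst_hom unital_hom.i_0[OF unital_hom_iota])

lemma ev_add: "ev g (P + Q) = ev g P + ev g Q"
proof -
  interpret unital_hom iota by (rule unital_hom_iota)
  let ?A = "Poly_Mapping.keys P \<union> Poly_Mapping.keys Q"
  have "Poly_Mapping.keys (P + Q) \<subseteq> ?A" by (rule Poly_Mapping.keys_add)
  then show ?thesis
    using ev_superset[of ?A "P + Q" g] ev_superset[of ?A P g] ev_superset[of ?A Q g]
    by (simp add: lookup_add cst_hom i_add distrib_right sum.distrib)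
qed

lemma ev_single: "ev g (Poly_Mapping.single (Word xs) c) = iota (cst c) * prod_list (map g xs)"
  using ev_superset[of "{Word xs}" "Poly_Mapping.single (Word xs) c" g] by simp

lemma ev_mult: "ev g (P * Q) = ev g P * ev g Q"
proof -
  interpret unital_hom iota by (rule unital_hom_iota)
  have single: "ev g (Poly_Mapping.single v c * Poly_Mapping.single w d) =
      ev g (Poly_Mapping.single v c) * ev g (Poly_Mapping.single w d)" for v w c d
  proof -
    obtain xs ys where [simp]: "v = Word xs" "w = Word ys" by (cases v; cases w)
    have "iota (cst c) * prod_list (map g xs) * (iota (cst d) * prod_list (map g ys)) =
      iota (cst c) * (prod_list (map g xs) * iota (cst d)) * prod_list (map g ys)" by (simp only: mult.assoc)
    also have "\<dots> = iota (cst c) * (iota (cst d) * prod_list (map g xs)) * prod_list (map g ys)" by (simp only: iota_cst)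
    finally show ?thesis by (simp add: mult_single ev_single cst_hom i_mult mult.assoc)
  qed
  have "ev g (Poly_Mapping.single v c * Q) = ev g (Poly_Mapping.single v c) * ev g Q" for v c
    by (induction Q rule: laurent_induct) (simp_all add: single distrib_left ev_add)
  then show ?thesis by (induction P rule: laurent_induct) (simp_all add: distrib_right ev_add)
qed

lemma ev_const: "ev g (const c) = iota (cst c)"
  using ev_single[of g "[]" c] by (simp add: const_def zero_word_def)

lemma unital_hom_ev: "unital_hom (ev g)"
  by standard (simp_all add: ev_add ev_mult const_one[symmetric] ev_const cst_hom unital_hom.i_1[OF unital_hom_iota] del: const_one)

lemma ev_var: "ev g (var x) = g x"
  using ev_single[of g "[x]" 1] by (simp add: var_def cst_hom unital_hom.i_1[OF unital_hom_iota])

lemma ev_word: "ev g (prod_list (map var xs)) = prod_list (map g xs)"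
  by (induction xs) (simp_all add: ev_mult ev_var unital_hom.i_1[OF unital_hom_ev])

text \<open>
  The kernel of the homomorphism is an ideal that contains the generators of the ideal of relations.
\<close>

lemma ev_ideal:
  assumes rel: "\<And>X Y. aq_rel q X Y \<Longrightarrow> ev g X = ev g Y" and P: "P \<in> aq_ideal q"
  shows "ev g P = 0"
proof -
  interpret e: unital_hom "ev g" by (rule unital_hom_ev)
  have "ideal {P. ev g P = 0} class_ring"
  proof (rule idealI)
    show "ring (class_ring :: ('a, alt_gen) free_algebra ring)" by (rule class_ring.ring_axioms)
    interpret A: group "add_monoid (class_ring :: ('a, alt_gen) free_algebra ring)"
      by (rule abelian_group.a_group) (rule class_ring.abelian_group_axioms)
    have inv: "inv\<^bsub>add_monoid class_ring\<^esub> a = - a" for a :: "('a, alt_gen) free_algebra"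
      by (rule A.inv_equality) simp_all
    show "subgroup {P. ev g P = 0} (add_monoid class_ring)"
    proof (rule A.subgroupI)
      show "{P. ev g P = 0} \<noteq> {}" using e.i_0 by blast
      show "inv\<^bsub>add_monoid class_ring\<^esub> a \<in> {P. ev g P = 0}" if "a \<in> {P. ev g P = 0}" for a
        using that unfolding inv by (simp add: e.i_minus)
      show "a \<otimes>\<^bsub>add_monoid class_ring\<^esub> b \<in> {P. ev g P = 0}" if "a \<in> {P. ev g P = 0}" "b \<in> {P. ev g P = 0}" for a b
        using that by (simp add: e.i_add)
    qed simp
  qed (simp_all add: e.i_mult)
  then have "aq_ideal q \<subseteq> {P. ev g P = 0}"
    unfolding aq_ideal_def using rel
    by (intro ring.genideal_minimal[OF class_ring.ring_axioms]) (auto simp: e.i_diff)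
  with P show ?thesis by auto
qed

text \<open>
  The factors are forced by the relation \<open>[A\<^sub>n, B\<^sub>0] = (q - 1/q) (C\<^sub>0 D\<^sub>n\<^sub>+\<^sub>1 - C\<^sub>n\<^sub>+\<^sub>1 D\<^sub>0)\<close>, where
  \<open>C\<^sub>0 = - (q + 1/q)\<close> and \<open>D\<^sub>0 = 1\<close>: its right-hand side has to be \<open>Gt - G\<close> divided by \<open>q + 1/q\<close>.
\<close>

fun gen_op :: "'f::field \<Rightarrow> nat \<Rightarrow> alt_gen \<Rightarrow> 'f op" where
  "gen_op q k (Wneg n) = fps_nth (fam_rep q k FA) n"
| "gen_op q k (Wpos n) = fps_nth (fam_rep q k FB) n"
| "gen_op q k (G n) = iota (cst ((q + inverse q) * (q - inverse q))) * fps_nth (fam_rep q k FC) (Suc n)"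
| "gen_op q k (Gt n) = iota (cst (- ((q - inverse q) * (q + inverse q)^2))) * fps_nth (fam_rep q k FD) (Suc n)"

context
  fixes q :: "'f::field" and k :: nat
  assumes q: "q \<noteq> 0" and q4: "q + inverse q \<noteq> 0"
begin

lemmas sc_hom' = sc_hom[OF q q4]

lemma sc_fold:
  fixes T U :: "'f op"
  shows "sc x * (sc y * T) = sc (x * y) * T" "T * (sc z * U) = sc z * (T * U)"
  by (simp_all only: sc_hom' mult.assoc sc_comm(2)[OF q q4, of T z U])

lemma coeff_AB:
  "comm_op (fps_nth (fam_rep q k FA) n) (fps_nth (fam_rep q k FB) 0) = sc (q - inverse q) *
     (fps_nth (fam_rep q k FC) 0 * fps_nth (fam_rep q k FD) (Suc n) - fps_nth (fam_rep q k FC) (Suc n) * fps_nth (fam_rep q k FD) 0)"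
  "comm_op (fps_nth (fam_rep q k FA) 0) (fps_nth (fam_rep q k FB) n) = sc (q - inverse q) *
     (fps_nth (fam_rep q k FC) 0 * fps_nth (fam_rep q k FD) (Suc n) - fps_nth (fam_rep q k FC) (Suc n) * fps_nth (fam_rep q k FD) 0)"
  using raw_AB[OF q q4, of "Suc n" k 0] raw_AB[OF q q4, of 0 k "Suc n"] by (simp_all add: algebra_simps)

lemma gen_op_rel: "aq_rel q X Y \<Longrightarrow> ev (gen_op q k) X = ev (gen_op q k) Y"
proof -
  let ?g = "gen_op q k"
  interpret e: unital_hom "ev ?g" by (rule unital_hom_ev)
  have comm: "ev ?g (comm (var x) (var y)) = comm_op (?g x) (?g y)" for x y
    by (simp add: comm_def comm_op_def e.i_diff e.i_mult ev_var)
  have qcomm: "ev ?g (qcomm q (var x) (var y)) = sc q * (?g x * ?g y) - sc (inverse q) * (?g y * ?g x)" for x y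
    by (simp add: qcomm_def e.i_diff e.i_mult ev_var ev_const mult.assoc)
  define p where "p = q + inverse q"
  define h where "h = q - inverse q"
  have p0: "p \<noteq> 0" using q4 by (simp add: p_def)
  have rho: "rho q = - (h * p * (h * p))"
    using q by (simp add: p_def h_def rho_def field_simps power2_eq_square)
  note C0 = fam_rep_0(1)[OF q q4, of k, folded p_def] and D0 = fam_rep_0(2)[OF q q4, of k]
  note g = gen_op.simps[of q k, folded p_def h_def] and rels = raw_CA[OF q q4, of k, folded p_def h_def] raw_CB[OF q q4, of k, folded p_def h_def]
    raw_AD[OF q q4, of k, folded p_def h_def] raw_BD[OF q q4, of k, folded p_def h_def]
  note AB = coeff_AB[folded p_def h_def]
  define A where "A n = fps_nth (fam_rep q k FA) n" for n
  define B where "B n = fps_nth (fam_rep q k FB) n" for n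
  define C where "C n = fps_nth (fam_rep q k FC) n" for n
  define D where "D n = fps_nth (fam_rep q k FD) n" for n
  note fold = A_def[symmetric] B_def[symmetric] C_def[symmetric] D_def[symmetric]
  have same: "A i * A j = A j * A i" "B i * B j = B j * B i" "C i * C j = C j * C i" "D i * D j = D j * D i" for i j
    unfolding A_def B_def C_def D_def by (rule comm_same[OF q q4])+
  have scale: "comm_op (sc z * x) y = sc z * comm_op x y" "comm_op x (sc z * y) = sc z * comm_op x y" for z :: 'f and x y
    by (simp_all add: comm_op_def right_diff_distrib mult.assoc sc_fold(2))
  have anti: "comm_op x y = - comm_op y x" for x y :: "'f op" by (simp add: comm_op_def)
  note AB' = AB[unfolded C0 D0, unfolded fold] and rels' = rels[unfolded C0 D0, unfolded fold]
  have pass: "A i * (sc z * U) = sc z * (A i * U)" "B i * (sc z * U) = sc z * (B i * U)"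
      "C i * (sc z * U) = sc z * (C i * U)" "D i * (sc z * U) = sc z * (D i * U)" for i z U
    by (rule sc_fold(2))+
  note lin = pass distrib_left right_diff_distrib sc_fold(1) sc_hom'(1,3-6) mult_minus_right
  have c: "1 - h * inverse q = inverse q * inverse q" "1 + h * q = q * q" using q by (simp_all add: h_def algebra_simps)
  have cancel: "q * inverse q = 1" "q * (inverse q * x) = x" for x using q by simp_all
  have e: "inverse p * (h * (p * p)) = h * p" "inverse p * (p * h) = h" using p0 by simp_all
  show "aq_rel q X Y \<Longrightarrow> ev ?g X = ev ?g Y"
  proof (induction rule: aq_rel.induct)
    case (1 n)
    show ?case
      unfolding comm e.i_mult e.i_diff ev_const ev_var g fold AB'(2) p_def[symmetric]
      by (simp add: lin e power2_eq_square)
  next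
    case (2 n)
    show ?case
      unfolding comm e.i_mult e.i_diff ev_const ev_var g fold AB'(1) p_def[symmetric]
      by (simp add: lin e power2_eq_square)
  next
    case (3 n)
    have 1: "A 0 * C (Suc n) = sc (1 - h * inverse q) * (C (Suc n) * A 0) - sc (h * inverse q * p) * (A (Suc n) - B n)"
      using rels'(1)[of n] by (simp add: comm_op_def lin left_diff_distrib distrib_right algebra_simps)
    show ?case
      unfolding qcomm e.i_mult e.i_diff ev_const ev_var g fold rho
      by (simp add: lin 1[unfolded c] cancel ac_simps power2_eq_square)
  next
    case (4 n)
    have 1: "D (Suc n) * A 0 = sc (1 - h * inverse q) * (A 0 * D (Suc n)) + sc (h * inverse q) * (A (Suc n) - B n)"
      using rels'(3)[of n] by (simp add: comm_op_def lin left_diff_distrib distrib_right algebra_simps)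
    show ?case
      unfolding qcomm e.i_mult e.i_diff ev_const ev_var g fold rho
      by (simp add: lin 1[unfolded c] cancel ac_simps power2_eq_square)
  next
    case (5 n)
    have 1: "B 0 * C (Suc n) = sc (1 + h * q) * (C (Suc n) * B 0) + sc (h * q * p) * (B (Suc n) - A n)"
      using rels'(2)[of n] by (simp add: comm_op_def lin left_diff_distrib distrib_right algebra_simps)
    show ?case
      unfolding qcomm e.i_mult e.i_diff ev_const ev_var g fold rho
      by (simp add: lin 1[unfolded c] cancel ac_simps power2_eq_square)
  next
    case (6 n)
    have 1: "D (Suc n) * B 0 = sc (1 + h * q) * (B 0 * D (Suc n)) - sc (h * q) * (B (Suc n) - A n)"
      using rels'(4)[of n] by (simp add: comm_op_def lin left_diff_distrib distrib_right algebra_simps)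
    show ?case
      unfolding qcomm e.i_mult e.i_diff ev_const ev_var g fold rho
      by (simp add: lin 1[unfolded c] cancel ac_simps power2_eq_square)
  next
    case (9 i j)
    show ?case
      unfolding e.i_add comm g fold scale
      using sym_AB[OF q q4, of k i j, unfolded fold] by (simp add: e.i_0 anti[of "B i" "A j"] flip: distrib_left)
  next
    case (10 i j)
    show ?case
      unfolding e.i_add comm g fold scale
      using sym_CA[OF q q4, of k i j, unfolded fold] by (simp add: e.i_0 anti[of "A i"] flip: distrib_left)
  next
    case (11 i j)
    show ?case
      unfolding e.i_add comm g fold scale
      using sym_AD[OF q q4, of k i j, unfolded fold] by (simp add: e.i_0 anti[of _ "A j"] flip: distrib_left)
  next
    case (12 i j)
    show ?case
      unfolding e.i_add comm g fold scale
      using sym_CB[OF q q4, of k i j, unfolded fold] by (simp add: e.i_0 anti[of "B i"] flip: distrib_left)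
  next
    case (13 i j)
    show ?case
      unfolding e.i_add comm g fold scale
      using sym_BD[OF q q4, of k i j, unfolded fold] by (simp add: e.i_0 anti[of _ "B j"] flip: distrib_left)
  next
    case (16 i j)
    show ?case
      unfolding e.i_add comm g fold scale
      using sym_CD[OF q q4, of k "Suc i" "Suc j", unfolded fold] by (simp add: e.i_0 anti[of "D (Suc i)"] sc_fold(1) mult.commute flip: distrib_left)
  qed (simp_all add: comm g fold comm_op_def e.i_0 sc_fold(1) pass mult.assoc same)
qed

end

section \<open>Leading terms of operators\<close>

text \<open>
  Weights of the variables: \<open>V\<close>, \<open>c\<close>, \<open>h\<close>, \<open>y\<close> of site \<open>k\<close> have the weights \<open>2 om k\<close>, \<open>1\<close>, \<open>0\<close>, \<open>om k\<close>. Since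
  \<open>om\<close> grows by a factor of \<open>4\<close>, a contribution of the last site outweighs all that the earlier sites
  can contribute.
\<close>

definition om :: "nat \<Rightarrow> int" where "om k = 4 ^ (k + 1)"

lemma om_Suc: "om (Suc k) = 4 * om k" by (simp add: om_def)
lemma om_ge: "4 \<le> om k"
  unfolding om_def using one_le_power[of "4::int" k] by simp

definition weight :: "nat \<Rightarrow> int" where
  "weight j = (if j mod 4 = 0 then 2 * om (j div 4) else if j mod 4 = 1 then 1 else if j mod 4 = 2 then 0 else om (j div 4))"

lemma weight_simps: "weight (4 * k) = 2 * om k" "weight (4 * k + 1) = 1" "weight (4 * k + 2) = 0" "weight (4 * k + 3) = om k"
  by (simp_all add: weight_def mod_mult_self4 div_mult_self4) (presburger?; simp add: weight_def)?

definition wt :: "(nat \<Rightarrow>\<^sub>0 int) \<Rightarrow> int" where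
  "wt l = (\<Sum>j\<in>Poly_Mapping.keys l. weight j * Poly_Mapping.lookup l j)"

lemma wt_superset: "finite A \<Longrightarrow> Poly_Mapping.keys l \<subseteq> A \<Longrightarrow> wt l = (\<Sum>j\<in>A. weight j * Poly_Mapping.lookup l j)"
  unfolding wt_def by (intro sum.mono_neutral_left) (auto simp: in_keys_iff)

lemma wt_add: "wt (l + m) = wt l + wt m"
proof -
  let ?A = "Poly_Mapping.keys l \<union> Poly_Mapping.keys m"
  have "Poly_Mapping.keys (l + m) \<subseteq> ?A" by (rule Poly_Mapping.keys_add)
  then show ?thesis
    using wt_superset[of ?A "l + m"] wt_superset[of ?A l] wt_superset[of ?A m]
    by (simp add: lookup_add distrib_left sum.distrib)
qed

lemma wt_0: "wt 0 = 0" by (simp add: wt_def)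

lemma wt_unit: "wt (unit_vec j n) = weight j * n"
  using wt_superset[of "{j}" "unit_vec j n"] by simp

text \<open>
  \<open>wb r n\<close> bounds the weights of the monomials in \<open>r\<close>; \<open>low T n\<close> says that \<open>T\<close> raises weights by at
  most \<open>n\<close>.
\<close>

definition wb :: "'f::field laurent \<Rightarrow> int \<Rightarrow> bool" where
  "wb r n \<longleftrightarrow> (\<forall>m\<in>Poly_Mapping.keys r. wt m \<le> n)"

definition low :: "'f::field op \<Rightarrow> int \<Rightarrow> bool" where
  "low T n \<longleftrightarrow> (\<forall>p b. wb p b \<longrightarrow> wb (Rep_op T p) (b + n))"

lemma wb_le: "wb r m \<Longrightarrow> m \<le> n \<Longrightarrow> wb r n" unfolding wb_def by force
lemma wb_add: "wb r m \<Longrightarrow> wb s n \<Longrightarrow> wb (r + s) (max m n)"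
  unfolding wb_def using Poly_Mapping.keys_add[of r s] by fastforce
lemma wb_minus: "wb r m \<Longrightarrow> wb (- r) m" unfolding wb_def by simp
lemma wb_diff: "wb r m \<Longrightarrow> wb s n \<Longrightarrow> wb (r - s) (max m n)"
  using wb_add[of r m "- s" n] wb_minus[of s n] by simp
lemma wb_mult: "wb r m \<Longrightarrow> wb s n \<Longrightarrow> wb (r * s) (m + n)"
  unfolding wb_def using keys_mult[of r s] by (fastforce simp: wt_add)
lemma wb_0: "wb 0 n" by (simp add: wb_def)
lemma wb_cst: "wb (cst c) 0" by (simp add: wb_def cst_def wt_0)
lemma wb_1: "wb 1 0" using wb_cst[of 1] by (simp add: cst_hom)
lemma wb_mon: "wb (mon l) (wt l)" by (simp add: wb_def mon_def)
lemma wb_gens: "wb (gV k n) (2 * om k * n)" "wb (gc k n) n" "wb (gh k n) 0" "wb (gy k n) (om k * n)"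
  using wb_mon[of "unit_vec (4 * k) n"] wb_mon[of "unit_vec (4 * k + 1) n"] wb_mon[of "unit_vec (4 * k + 2) n"] wb_mon[of "unit_vec (4 * k + 3) n"]
  unfolding gV_def gc_def gh_def gy_def wt_unit weight_simps by simp_all
lemmas wb_intros = wb_add wb_diff wb_minus wb_mult wb_cst wb_1 wb_gens

lemma low_le: "low T m \<Longrightarrow> m \<le> n \<Longrightarrow> low T n"
  unfolding low_def by (meson add_left_mono wb_le)
lemma low_add: "low S n \<Longrightarrow> low T n \<Longrightarrow> low (S + T) n"
  unfolding low_def plus_op.rep_eq by (metis max.idem wb_add)
lemma low_mult: "low S m \<Longrightarrow> low T n \<Longrightarrow> low (S * T) (m + n)"
  unfolding low_def times_op.rep_eq by (metis add.assoc add.commute)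
lemma low_0: "low 0 n" by (simp add: low_def zero_op.rep_eq wb_0)
lemma low_1: "low 1 0" by (simp add: low_def one_op.rep_eq)
lemma low_sum: "finite A \<Longrightarrow> (\<And>a. a \<in> A \<Longrightarrow> low (f a) n) \<Longrightarrow> low (sum f A) n"
  by (induction A rule: finite_induct) (auto intro: low_0 low_add)
lemma low_iota: "wb r n \<Longrightarrow> low (iota r) n"
  unfolding low_def iota.rep_eq using wb_mult by (metis add.commute)
lemma low_scaling: "low (scaling \<chi>) 0"
  unfolding low_def wb_def scaling.rep_eq by (auto simp: in_keys_iff lookup_scale)

lemma low_F: "low (Fop q k) (om k)" and low_G: "low (Gop q k) (- om k)"
  using low_mult[OF low_iota[OF wb_gens(4)[of k 1]] low_scaling] low_mult[OF low_iota[OF wb_gens(4)[of k "-1"]] low_scaling]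
  by (simp_all add: Fop_def Gop_def)

text \<open>
  A leading term with exponent \<open>d\<close>: a monomial times a diagonal operator without zero entries, up to
  operators of smaller weight. The diagonal part has to be carried along because the operators do not
  commute; having no zero entries, it cannot destroy the monomial, so leading exponents add.
\<close>

definition lead :: "'f::field op \<Rightarrow> (nat \<Rightarrow>\<^sub>0 int) \<Rightarrow> bool" where
  "lead T d \<longleftrightarrow> (\<exists>\<chi> R. (\<forall>l. \<chi> l \<noteq> 0) \<and> T = iota (mon d) * scaling \<chi> + R \<and> low R (wt d - 1))"

lemma lead_low: "lead T d \<Longrightarrow> low T (wt d)"
proof -
  assume "lead T d"
  then obtain \<chi> R where T: "T = iota (mon d) * scaling \<chi> + R" and R: "low R (wt d - 1)" by (auto simp: lead_def)
  have "low (iota (mon d) * scaling \<chi>) (wt d)" using low_mult[OF low_iota[OF wb_mon] low_scaling] by simp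
  then show ?thesis unfolding T by (intro low_add low_le[OF R]) auto
qed

lemma lead_add: "lead T d \<Longrightarrow> low R (wt d - 1) \<Longrightarrow> lead (T + R) d"
  unfolding lead_def by (metis add.assoc low_add)

lemma scaling_const: "scaling (\<lambda>l. c) = iota (cst c)"
  by (rule op_eqI) (simp add: scaling.rep_eq iota.rep_eq scale_mon)

lemma scaling_pass: "scaling \<chi> * iota (mon d) = iota (mon d) * scaling (\<lambda>l. \<chi> (d + l))"
proof (rule op_eqI)
  fix l
  show "Rep_op (scaling \<chi> * iota (mon d)) (mon l) = Rep_op (iota (mon d) * scaling (\<lambda>l. \<chi> (d + l))) (mon l)"
    by (simp add: times_op.rep_eq scaling.rep_eq iota.rep_eq scale_mon mon_mult mult.left_commute)
qed

lemma lead_mult: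
  assumes "lead S c" "lead T d"
  shows "lead (S * T) (c + d)"
proof -
  obtain \<chi> R where \<chi>: "\<And>l. \<chi> l \<noteq> 0" and S: "S = iota (mon c) * scaling \<chi> + R" and R: "low R (wt c - 1)" using assms(1) by (auto simp: lead_def)
  obtain \<psi> Q where \<psi>: "\<And>l. \<psi> l \<noteq> 0" and T: "T = iota (mon d) * scaling \<psi> + Q" and Q: "low Q (wt d - 1)" using assms(2) by (auto simp: lead_def)
  define S0 where "S0 = iota (mon c) * scaling \<chi>"
  define T0 where "T0 = iota (mon d) * scaling \<psi>"
  have "S0 * T0 = iota (mon c) * (scaling \<chi> * iota (mon d)) * scaling \<psi>" by (simp add: S0_def T0_def mult.assoc)
  also have "\<dots> = iota (mon c) * iota (mon d) * (scaling (\<lambda>l. \<chi> (d + l)) * scaling \<psi>)" by (simp only: scaling_pass mult.assoc)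
  also have "\<dots> = iota (mon (c + d)) * scaling (\<lambda>l. \<chi> (d + l) * \<psi> l)"
    by (simp only: scaling_mult mon_mult[symmetric] unital_hom.i_mult[OF unital_hom_iota])
  finally have main: "S0 * T0 = iota (mon (c + d)) * scaling (\<lambda>l. \<chi> (d + l) * \<psi> l)" .
  have S0: "low S0 (wt c)" using low_mult[OF low_iota[OF wb_mon] low_scaling] by (simp add: S0_def)
  have T: "S * T = S0 * T0 + (S0 * Q + R * T)" by (simp add: S T S0_def[symmetric] T0_def[symmetric] algebra_simps)
  have "low (S0 * Q + R * T) (wt (c + d) - 1)"
    using low_mult[OF S0 Q] low_mult[OF R lead_low[OF assms(2)]] by (intro low_add) (simp_all add: wt_add algebra_simps)
  then show ?thesis unfolding lead_def T main using \<chi> \<psi> by (intro exI[of _ "\<lambda>l. \<chi> (d + l) * \<psi> l"]) auto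
qed

lemma lead_iota:
  assumes "c \<noteq> 0" "wb r (wt d - 1)"
  shows "lead (iota (cst c * mon d + r)) d"
proof -
  interpret unital_hom iota by (rule unital_hom_iota)
  have "iota (cst c * mon d + r) = iota (mon d) * scaling (\<lambda>_. c) + iota r"
    by (simp add: i_add i_mult scaling_const iota_cst)
  then show ?thesis unfolding lead_def using assms low_iota[OF assms(2)]
    by (intro exI[of _ "\<lambda>_. c"] exI[of _ "iota r"]) simp
qed

lemma lead_cst: "c \<noteq> 0 \<Longrightarrow> lead (iota (cst c)) 0"
  using lead_iota[of c 0 0] by (simp add: wb_0 mon_0)

context
  fixes q :: "'f::field"
  assumes q: "q \<noteq> 0" and q4: "q + inverse q \<noteq> 0"
begin

lemma lead_scaling: "(\<And>l. \<chi> l \<noteq> 0) \<Longrightarrow> lead (iota (mon d) * scaling \<chi>) d"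
  unfolding lead_def by (intro exI[of _ \<chi>] exI[of _ 0]) (simp add: low_0)

lemma lead_F: "lead (Fop q k) (unit_vec (4 * k + 3) 1)" and lead_G: "lead (Gop q k) (unit_vec (4 * k + 3) (-1))"
  unfolding Fop_def Gop_def gy_def using q by (auto intro!: lead_scaling simp: chi_def)

lemmas term_unfold = term_op_def[OF q q4] Nop_def[OF q q4] Hop_def[OF q q4] phis_nth[OF q q4]
  unital_hom.i_0[OF unital_hom_iota] unital_hom.i_1[OF unital_hom_iota]

lemma low_term:
  assumes "i = 0 \<or> i = 1 \<or> i = 2" "\<not> (i = 1 \<and> j = a)"
  shows "low (term_op q k j a i) (om k + 1)"
proof -
  note om = om_ge[of k]
  show ?thesis
    using assms
    apply (cases j; cases a; elim disjE; simp add: term_unfold low_0)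
    apply ((rule low_le, (rule low_mult low_iota low_F low_G low_1 wb_intros)+)[1], use om in \<open>simp add: max_def; fail\<close>)+
    done
qed

end

section \<open>Leading terms of the generators\<close>

lemma finite_fam: "finite (UNIV :: fam set)"
proof -
  have "UNIV = {FA, FB, FC, FD}" using fam.exhaust by auto
  then show ?thesis by (metis finite.emptyI finite_insert)
qed

fun gidx :: "alt_gen \<Rightarrow> nat" where
  "gidx (Wneg n) = n" | "gidx (Wpos n) = n" | "gidx (G n) = n" | "gidx (Gt n) = n"

fun gpred :: "alt_gen \<Rightarrow> alt_gen" where
  "gpred (Wneg n) = Wneg (n - 1)" | "gpred (Wpos n) = Wpos (n - 1)" | "gpred (G n) = G (n - 1)" | "gpred (Gt n) = Gt (n - 1)"

text \<open>
  The contribution of the last site to the leading exponent. A generator of positive index gets a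
  factor \<open>V\<close>, for \<open>G\<close> and \<open>Gt\<close> \<open>V h\<close> and \<open>V / h\<close>, from the diagonal entry of \<open>phi\<close> and passes on to the generator with the index lowered by
  one; a generator of index \<open>0\<close> takes its leading term from the scalars \<open>C\<^sub>0\<close>, \<open>D\<^sub>0\<close>. There \<open>Wneg 0\<close>
  comes from \<open>E C\<^sub>0\<close>, with leading exponent \<open>V c / y\<close>, and \<open>Wpos 0\<close> from \<open>F D\<^sub>0\<close>.
\<close>

fun site_exp :: "nat \<Rightarrow> alt_gen \<Rightarrow> (nat \<Rightarrow>\<^sub>0 int)" where
  "site_exp k (Wneg n) = unit_vec (4 * k) 1 + (if n = 0 then unit_vec (4 * k + 1) 1 + unit_vec (4 * k + 3) (-1) else 0)"
| "site_exp k (Wpos n) = (if n = 0 then unit_vec (4 * k + 3) 1 else unit_vec (4 * k) 1)"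
| "site_exp k (G n) = unit_vec (4 * k) 1 + unit_vec (4 * k + 2) 1"
| "site_exp k (Gt n) = unit_vec (4 * k) 1 + unit_vec (4 * k + 2) (-1)"

primrec lead_exp :: "nat \<Rightarrow> alt_gen \<Rightarrow> (nat \<Rightarrow>\<^sub>0 int)" where
  "lead_exp 0 g = 0"
| "lead_exp (Suc k) g = site_exp k g + (if gidx g = 0 then 0 else lead_exp k (gpred g))"

text \<open>
  The generators without their scalar factors, which do not matter for leading terms.
\<close>

fun raw_op :: "'f::field \<Rightarrow> nat \<Rightarrow> alt_gen \<Rightarrow> 'f op" where
  "raw_op q k (Wneg n) = fps_nth (fam_rep q k FA) n"
| "raw_op q k (Wpos n) = fps_nth (fam_rep q k FB) n"
| "raw_op q k (G n) = fps_nth (fam_rep q k FC) (Suc n)"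
| "raw_op q k (Gt n) = fps_nth (fam_rep q k FD) (Suc n)"

lemma wt_site_exp: "wt (site_exp k g) \<ge> om k"
  "gidx g \<noteq> 0 \<Longrightarrow> wt (site_exp k g) = 2 * om k" "wt (site_exp k (G n)) = 2 * om k" "wt (site_exp k (Gt n)) = 2 * om k"
  using om_ge[of k] by (cases g; simp add: wt_add wt_unit wt_0 weight_simps[simplified])+

lemma wt_lead_exp: "wt (lead_exp k g) \<ge> 0"
proof (induction k arbitrary: g)
  case (Suc k)
  show ?case using Suc[of "gpred g"] wt_site_exp(1)[of k g] om_ge[of k] by (simp add: wt_add wt_0)
qed (simp add: wt_0)

context
  fixes q :: "'f::field"
  assumes q: "q \<noteq> 0" and q4: "q + inverse q \<noteq> 0"
begin

lemma low_term0:
  assumes "(j, a) \<noteq> (FA, FC)" "(j, a) \<noteq> (FB, FD)"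
  shows "low (term_op q k j a 0) 1"
proof -
  note om = om_ge[of k]
  show ?thesis
    using assms
    apply (cases j; cases a; simp add: term_unfold[OF q q4] low_0 FG_op[OF q] GF_op[OF q])
    apply ((rule low_le, (rule low_mult low_iota low_F low_G low_1 wb_intros)+)[1], use om in \<open>simp add: max_def; fail\<close>)+
    done
qed

lemma lead_term0:
  "lead (term_op q k FA FC 0) (unit_vec (4 * k) 1 + (unit_vec (4 * k + 1) 1 + unit_vec (4 * k + 3) (-1)))"
  "lead (term_op q k FB FD 0) (unit_vec (4 * k + 3) 1)"
proof -
  let ?d = "unit_vec (4 * k) 1 + unit_vec (4 * k + 1) 1"
  let ?r = "- (gV k 1 * (cst (inverse (q + inverse q)) * (cst (inverse q) * gh k 1 + cst q * gh k (-1))))"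
  have "wb ?r (wt ?d - 1)"
    by (rule wb_le, (rule wb_intros)+) (simp add: wt_add wt_unit weight_simps[simplified])
  from lead_iota[of 1, OF _ this] have "lead (iota (gV k 1 * gc k 1 + ?r)) ?d"
    by (simp add: cst_hom gV_def gc_def mon_mult)
  moreover have "gV k 1 * gc k 1 + ?r = gV k 1 * (gc k 1 - cst (inverse (q + inverse q)) * (cst (inverse q) * gh k 1 + cst q * gh k (-1)))"
    by (simp add: right_diff_distrib)
  ultimately have "lead (iota (gV k 1 * (gc k 1 - cst (inverse (q + inverse q)) * (cst (inverse q) * gh k 1 + cst q * gh k (-1))))) ?d" by simp
  from lead_mult[OF this lead_G[OF q q4, of k]]
  show "lead (term_op q k FA FC 0) (unit_vec (4 * k) 1 + (unit_vec (4 * k + 1) 1 + unit_vec (4 * k + 3) (-1)))"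
    by (simp add: term_unfold[OF q q4] add.assoc)
  show "lead (term_op q k FB FD 0) (unit_vec (4 * k + 3) 1)"
    using lead_F[OF q q4] by (simp add: term_unfold[OF q q4])
qed

lemma lead_term1:
  "lead (term_op q k FA FA 1) (unit_vec (4 * k) 1)" "lead (term_op q k FB FB 1) (unit_vec (4 * k) 1)"
  "lead (term_op q k FC FC 1) (unit_vec (4 * k) 1 + unit_vec (4 * k + 2) 1)"
  "lead (term_op q k FD FD 1) (unit_vec (4 * k) 1 + unit_vec (4 * k + 2) (-1))"
proof -
  let ?p = "inverse (q + inverse q)"
  have p: "?p \<noteq> 0" using q4 by simp
  have AB: "lead (iota (- (cst ?p * (gV k 1 + gV k (-1))))) (unit_vec (4 * k) 1)"
  proof -
    have "wb (- (cst ?p * gV k (-1))) (wt (unit_vec (4 * k) 1) - 1)"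
      by (rule wb_le, (rule wb_intros)+) (use om_ge[of k] in \<open>simp add: wt_add wt_unit weight_simps[simplified]\<close>)
    from lead_iota[of "- ?p", OF _ this] show ?thesis using p by (simp add: cst_hom gV_def distrib_left)
  qed
  then show "lead (term_op q k FA FA 1) (unit_vec (4 * k) 1)" "lead (term_op q k FB FB 1) (unit_vec (4 * k) 1)"
    by (simp_all add: term_unfold[OF q q4])
  have CD: "lead (iota (- (cst ?p * (gV k 1 * (cst (inverse q))\<^sup>2 * gh k e + gV k (-1) * (cst q)\<^sup>2 * gh k (- e)))))
      (unit_vec (4 * k) 1 + unit_vec (4 * k + 2) e)" for e
  proof -
    have "wb (- (cst ?p * (gV k (-1) * (cst q * cst q) * gh k (- e)))) (wt (unit_vec (4 * k) 1 + unit_vec (4 * k + 2) e) - 1)"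
      by (rule wb_le, (rule wb_intros)+) (use om_ge[of k] in \<open>simp add: wt_add wt_unit weight_simps[simplified]\<close>)
    from lead_iota[of "- (?p * inverse q * inverse q)", OF _ this] p q
    have "lead (iota (cst (- (?p * inverse q * inverse q)) * (gV k 1 * gh k e) + - (cst ?p * (gV k (-1) * (cst q * cst q) * gh k (- e)))))
      (unit_vec (4 * k) 1 + unit_vec (4 * k + 2) e)" by (simp add: gV_def gh_def mon_mult)
    moreover have "cst (- (?p * inverse q * inverse q)) * (gV k 1 * gh k e) + - (cst ?p * (gV k (-1) * (cst q * cst q) * gh k (- e)))
       = - (cst ?p * (gV k 1 * (cst (inverse q))\<^sup>2 * gh k e + gV k (-1) * (cst q)\<^sup>2 * gh k (- e)))"
      by (simp add: cst_hom power2_eq_square algebra_simps)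
    ultimately show ?thesis by simp
  qed
  have cancel: "unit_vec (4 * k + 3) 1 + (u + unit_vec (4 * k + 3) (- 1)) = u" "unit_vec (4 * k + 3) (-1) + (u + unit_vec (4 * k + 3) 1) = u" for u
    by (simp_all add: add.commute[of u] flip: add.assoc single_add)
  show "lead (term_op q k FC FC 1) (unit_vec (4 * k) 1 + unit_vec (4 * k + 2) 1)"
    using lead_mult[OF lead_F[OF q q4, of k] lead_mult[OF CD[of 1] lead_G[OF q q4, of k]], unfolded cancel]
    by (simp add: term_unfold[OF q q4])
  show "lead (term_op q k FD FD 1) (unit_vec (4 * k) 1 + unit_vec (4 * k + 2) (-1))"
    using lead_mult[OF lead_G[OF q q4, of k] lead_mult[OF CD[of "-1"] lead_F[OF q q4, of k]], unfolded cancel]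
    by (simp add: term_unfold[OF q q4])
qed

text \<open>
  The operators \<open>term_op\<close> in the recursion have weight at most \<open>2 om k\<close>, hence by induction the weight of a solution with
  \<open>k + 1\<close> sites is at most \<open>3 om k - 3 \<le> om (k + 1) - 3\<close>. The slack of \<open>3\<close> absorbs the weight \<open>1\<close> of
  the variables \<open>c\<close>.
\<close>

lemma low_fam_rep: "low (fps_nth (fam_rep q k a) n) (om k - 3)"
proof (induction k arbitrary: a n)
  case 0
  have "low (iota (cst c)) 1" for c :: 'f by (rule low_le[OF low_iota[OF wb_cst]]) simp
  then show ?case using low_le[OF low_1, of 1]
    by (cases a) (auto simp: low_0 om_def)
next
  case (Suc k)
  have om: "om k \<ge> 4" by (rule om_ge)
  have tm: "low (term_op q k a b i) (2 * om k)" if "i = 0 \<or> i = 1 \<or> i = 2" for b i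
  proof (cases "i = 1 \<and> a = b")
    case True
    then show ?thesis
      using lead_term1[THEN lead_low] by (cases b) (auto simp: wt_add wt_unit weight_simps[simplified] simp del: One_nat_def)
  next
    case False
    show ?thesis by (rule low_le[OF low_term[OF q q4 that False]]) (use om in simp)
  qed
  have "low (term_op q k a b i * fps_nth (fam_rep q k b) m) (om (Suc k) - 3)" if "i = 0 \<or> i = 1 \<or> i = 2" for b i m
    by (rule low_le[OF low_mult[OF tm[OF that] Suc]]) (use om in \<open>simp add: om_Suc\<close>)
  then show ?case unfolding fam_rep_Suc_nth[OF q q4]
    by (intro low_sum[OF finite_fam] low_add) (auto simp: low_0)
qed

text \<open>
  The diagonal entry of degree one wins: it has weight \<open>2 om k\<close>, while all other terms have weight at
  most \<open>om k + 1\<close> from the last site and \<open>om k - 3\<close> from the earlier ones.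
\<close>

lemma lead_Suc:
  assumes "lead (term_op q k j j 1) d" "lead (fps_nth (fam_rep q k j) n) e" "wt d = 2 * om k" "wt e \<ge> 0"
  shows "lead (fps_nth (fam_rep q (Suc k) j) (Suc n)) (d + e)"
proof -
  let ?f = "\<lambda>i a m. term_op q k j a i * fps_nth (fam_rep q k a) m"
  let ?g = "\<lambda>a. ?f 0 a (Suc n) + (if a = j then 0 else ?f 1 a n) + (if Suc n \<le> 1 then 0 else ?f 2 a (Suc n - 2))"
  have "fps_nth (fam_rep q (Suc k) j) (Suc n) = (\<Sum>a\<in>UNIV. ?g a + (if a = j then ?f 1 a n else 0))"
    unfolding fam_rep_Suc_nth[OF q q4] by (intro sum.cong refl) (auto simp: algebra_simps)
  also have "\<dots> = ?f 1 j n + (\<Sum>a\<in>UNIV. ?g a)"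
    by (subst sum.distrib) (simp add: sum_fam, cases j; simp)
  finally have eq: "fps_nth (fam_rep q (Suc k) j) (Suc n) = ?f 1 j n + (\<Sum>a\<in>UNIV. ?g a)" .
  have low: "low (?f i a m) (wt (d + e) - 1)" if "i = 0 \<or> i = 1 \<or> i = 2" "\<not> (i = 1 \<and> j = a)" for i a m
    by (rule low_le[OF low_mult[OF low_term[OF q q4 that] low_fam_rep]]) (use assms(3,4) in \<open>simp add: wt_add\<close>)
  have "low (\<Sum>a\<in>UNIV. ?g a) (wt (d + e) - 1)"
    by (intro low_sum[OF finite_fam] low_add) (auto intro!: low low_0)
  with lead_mult[OF assms(1,2)] show ?thesis unfolding eq by (rule lead_add)
qed

lemma lead_zero:
  assumes "lead (term_op q k j b 0) d" "lead (fps_nth (fam_rep q k b) 0) 0" "(j, b) = (FA, FC) \<or> (j, b) = (FB, FD)" "wt d \<ge> om k"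
  shows "lead (fps_nth (fam_rep q (Suc k) j) 0) d"
proof -
  let ?f = "\<lambda>a. term_op q k j a 0 * fps_nth (fam_rep q k a) 0"
  have eq: "fps_nth (fam_rep q (Suc k) j) 0 = ?f b + (\<Sum>a\<in>UNIV. if a = b then 0 else ?f a)"
    unfolding fam_rep_Suc_nth[OF q q4] sum_fam by (cases b) simp_all
  have "low (?f a) (wt d - 1)" if "a \<noteq> b" for a
  proof (rule low_le[OF low_mult[OF low_term0 low_fam_rep]])
    show "(j, a) \<noteq> (FA, FC)" "(j, a) \<noteq> (FB, FD)" using that assms(3) by auto
  qed (use assms(4) in simp)
  then have "low (\<Sum>a\<in>UNIV. if a = b then 0 else ?f a) (wt d - 1)"
    by (intro low_sum[OF finite_fam]) (auto simp: low_0)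
  with lead_mult[OF assms(1,2)] show ?thesis unfolding eq by (intro lead_add) simp_all
qed

lemma lead_raw_op: "gidx g < k \<Longrightarrow> lead (raw_op q k g) (lead_exp k g)"
proof (induction k arbitrary: g)
  case (Suc k)
  have C0: "lead (fps_nth (fam_rep q k FC) 0) 0" and D0: "lead (fps_nth (fam_rep q k FD) 0) 0"
    using fam_rep_0[OF q q4, of k] lead_cst[of "- (q + inverse q)"] lead_cst[of 1] q4
    by (simp_all add: cst_hom unital_hom.i_1[OF unital_hom_iota] del: minus_add_distrib add: neg_equal_iff_equal)
  show ?case
  proof (cases g)
    case (Wneg n)
    show ?thesis
    proof (cases n)
      case 0
      show ?thesis using lead_zero[OF lead_term0(1) C0] om_ge[of k] by (simp add: Wneg 0 wt_add wt_unit weight_simps[simplified])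
    next
      case (Suc m)
      show ?thesis using lead_Suc[OF lead_term1(1) _ _ wt_lead_exp[of k "Wneg m"]] Suc.IH[of "Wneg m"] Suc.prems
        by (simp add: Wneg Suc wt_unit weight_simps[simplified])
    qed
  next
    case (Wpos n)
    show ?thesis
    proof (cases n)
      case 0
      show ?thesis using lead_zero[OF lead_term0(2) D0] om_ge[of k] by (simp add: Wpos 0 wt_add wt_unit weight_simps[simplified])
    next
      case (Suc m)
      show ?thesis using lead_Suc[OF lead_term1(2) _ _ wt_lead_exp[of k "Wpos m"]] Suc.IH[of "Wpos m"] Suc.prems
        by (simp add: Wpos Suc wt_unit weight_simps[simplified])
    qed
  next
    case (G n)
    show ?thesis
    proof (cases n)
      case 0
      show ?thesis using lead_Suc[OF lead_term1(3) C0] by (simp add: G 0 wt_add wt_0 wt_unit weight_simps[simplified])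
    next
      case (Suc m)
      show ?thesis using lead_Suc[OF lead_term1(3) _ _ wt_lead_exp[of k "G m"]] Suc.IH[of "G m"] Suc.prems
        by (simp add: G Suc wt_add wt_unit weight_simps[simplified])
    qed
  next
    case (Gt n)
    show ?thesis
    proof (cases n)
      case 0
      show ?thesis using lead_Suc[OF lead_term1(4) D0] by (simp add: Gt 0 wt_add wt_0 wt_unit weight_simps[simplified])
    next
      case (Suc m)
      show ?thesis using lead_Suc[OF lead_term1(4) _ _ wt_lead_exp[of k "Gt m"]] Suc.IH[of "Gt m"] Suc.prems
        by (simp add: Gt Suc wt_add wt_unit weight_simps[simplified])
    qed
  qed
qed simp

end

section \<open>Independence of words with different letters\<close>

text \<open>
  The leading exponent of a word depends on its multiset of letters only. It splits into the part of
  the last site and the exponent, for one site less, of the multiset in which letters of index \<open>0\<close> are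
  removed and the other indices are lowered by one.
\<close>

definition mexp :: "nat \<Rightarrow> alt_gen multiset \<Rightarrow> (nat \<Rightarrow>\<^sub>0 int)" where
  "mexp k M = (\<Sum>x\<in>#M. lead_exp k x)"

definition msite :: "nat \<Rightarrow> alt_gen multiset \<Rightarrow> (nat \<Rightarrow>\<^sub>0 int)" where
  "msite k M = (\<Sum>x\<in>#M. site_exp k x)"

definition mpred :: "alt_gen multiset \<Rightarrow> alt_gen multiset" where
  "mpred M = image_mset gpred (filter_mset (\<lambda>x. gidx x \<noteq> 0) M)"

lemma lookup_unit: "Poly_Mapping.lookup (unit_vec j n) i = (if i = j then n else 0)"
  by (simp add: lookup_single when_def)

lemma mexp_Suc: "mexp (Suc k) M = msite k M + mexp k (mpred M)"
  by (induction M) (simp_all add: mexp_def msite_def mpred_def ac_simps)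

lemma lookup_lead_exp: "4 * k \<le> j \<Longrightarrow> Poly_Mapping.lookup (lead_exp k g) j = 0"
proof (induction k arbitrary: g)
  case (Suc k)
  have "Poly_Mapping.lookup (site_exp k g) j = 0"
    using Suc.prems by (cases g) (auto simp: lookup_add lookup_unit)
  then show ?case using Suc by (simp add: lookup_add)
qed simp

lemma lookup_mexp: "4 * k \<le> j \<Longrightarrow> Poly_Mapping.lookup (mexp k M) j = 0"
  by (induction M) (simp_all add: mexp_def lookup_add lookup_lead_exp)

lemma lookup_msite_less: "j < 4 * k \<Longrightarrow> Poly_Mapping.lookup (msite k M) j = 0"
proof (induction M)
  case (add x M)
  then show ?case by (cases x) (auto simp: msite_def lookup_add lookup_unit)
qed (simp add: msite_def)

definition is_G :: "alt_gen \<Rightarrow> bool" where "is_G x \<longleftrightarrow> (\<exists>n. x = G n)"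
definition is_Gt :: "alt_gen \<Rightarrow> bool" where "is_Gt x \<longleftrightarrow> (\<exists>n. x = Gt n)"

lemma lookup_msite:
  "Poly_Mapping.lookup (msite k M) (4 * k + 1) = int (count M (Wneg 0))"
  "Poly_Mapping.lookup (msite k M) (4 * k + 3) = int (count M (Wpos 0)) - int (count M (Wneg 0))"
  "Poly_Mapping.lookup (msite k M) (4 * k + 2) = int (size (filter_mset is_G M)) - int (size (filter_mset is_Gt M))"
  "Poly_Mapping.lookup (msite k M) (4 * k) = int (size M) - int (count M (Wpos 0))"
proof (induction M)
  case (add x M)
  {
    case 1 show ?case using add(1) by (cases x) (auto simp: msite_def lookup_add lookup_unit)
  next
    case 2 show ?case using add(2) by (cases x) (auto simp: msite_def lookup_add lookup_unit)
  next
    case 3 show ?case using add(3) by (cases x) (auto simp: msite_def lookup_add lookup_unit is_G_def is_Gt_def)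
  next
    case 4 show ?case using add(4) by (cases x) (auto simp: msite_def lookup_add lookup_unit)
  }
qed (simp_all add: msite_def)

lemma mpred_counts:
  "size M = size (mpred M) + count M (Wneg 0) + count M (Wpos 0) + count M (G 0) + count M (Gt 0)"
  "size (filter_mset is_G M) = size (filter_mset is_G (mpred M)) + count M (G 0)"
  "size (filter_mset is_Gt M) = size (filter_mset is_Gt (mpred M)) + count M (Gt 0)"
proof (induction M)
  case (add x M)
  {
    case 1 show ?case using add(1) by (cases x) (auto simp: mpred_def)
  next
    case 2 show ?case using add(2) by (cases x) (auto simp: mpred_def is_G_def)
  next
    case 3 show ?case using add(3) by (cases x) (auto simp: mpred_def is_Gt_def)
  }
qed (simp_all add: mpred_def)

lemma count_mpred: "gidx x \<noteq> 0 \<Longrightarrow> count (mpred M) (gpred x) = count M x"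
proof (induction M)
  case (add y M)
  have "gpred y = gpred x \<longleftrightarrow> y = x" if "gidx y \<noteq> 0"
    using that add.prems by (cases x; cases y) auto
  then show ?case using add by (auto simp: mpred_def)
qed (simp add: mpred_def)

text \<open>
  The exponents of different sites do not interfere, so the lowered multiset is known by induction.
  Only the numbers of the four letters of index \<open>0\<close> are missing. The exponents of \<open>c\<close> and \<open>y\<close> give
  those of \<open>Wneg 0\<close> and \<open>Wpos 0\<close>; the exponents of \<open>h\<close> and \<open>V\<close> give the difference and the sum of
  those of \<open>G 0\<close> and \<open>Gt 0\<close>.
\<close>

lemma mexp_inj:
  "\<forall>x\<in>#M. gidx x < k \<Longrightarrow> \<forall>x\<in>#N. gidx x < k \<Longrightarrow> mexp k M = mexp k N \<Longrightarrow> M = N"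
proof (induction k arbitrary: M N)
  case 0
  then show ?case by (metis multiset_nonemptyE not_less_zero)
next
  case (Suc k)
  have eq: "msite k M + mexp k (mpred M) = msite k N + mexp k (mpred N)"
    using Suc.prems(3) by (simp add: mexp_Suc)
  have "Poly_Mapping.lookup (mexp k (mpred M)) j = Poly_Mapping.lookup (mexp k (mpred N)) j" for j
    using arg_cong[OF eq, of "\<lambda>l. Poly_Mapping.lookup l j"] lookup_mexp[of k j] lookup_msite_less[of j k]
    by (cases "j < 4 * k") (simp_all add: lookup_add)
  then have e: "mexp k (mpred M) = mexp k (mpred N)" by (rule poly_mapping_eqI)
  have less: "\<forall>x\<in>#mpred A. gidx x < k" if "\<forall>x\<in>#A. gidx x < Suc k" for A
  proof
    fix x assume "x \<in># mpred A"
    then obtain y where "y \<in># A" "gidx y \<noteq> 0" "x = gpred y" by (auto simp: mpred_def)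
    then show "gidx x < k" using that by (cases y) fastforce+
  qed
  have pred: "mpred M = mpred N" using Suc.IH[OF less less e] Suc.prems by blast
  have site: "msite k M = msite k N" using eq e by simp
  note l = lookup_msite[of k M] lookup_msite[of k N]
  have W: "count M (Wneg 0) = count N (Wneg 0)" "count M (Wpos 0) = count N (Wpos 0)"
    using l site by simp_all
  have "int (count M (G 0)) - int (count M (Gt 0)) = int (count N (G 0)) - int (count N (Gt 0))"
    using l(3,7) mpred_counts(2,3)[of M] mpred_counts(2,3)[of N] site pred by simp
  moreover have "int (count M (G 0)) + int (count M (Gt 0)) = int (count N (G 0)) + int (count N (Gt 0))"
    using l(4,8) mpred_counts(1)[of M] mpred_counts(1)[of N] site pred W by simp
  ultimately have GG: "count M (G 0) = count N (G 0)" "count M (Gt 0) = count N (Gt 0)" by simp_all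
  show ?case
  proof (rule multiset_eqI)
    fix x
    show "count M x = count N x"
    proof (cases "gidx x = 0")
      case True
      then show ?thesis using W GG by (cases x) auto
    next
      case False
      then show ?thesis using count_mpred[OF False, of M] count_mpred[OF False, of N] pred by simp
    qed
  qed
qed

text \<open>
  Applied to the constant polynomial, an operator with a leading term shows its leading exponent.
\<close>

lemma lead_lookup:
  assumes "lead T d" "wt d \<le> wt e"
  shows "Poly_Mapping.lookup (Rep_op T (mon 0)) e \<noteq> 0 \<longleftrightarrow> e = d"
proof -
  obtain \<chi> R where \<chi>: "\<And>l. \<chi> l \<noteq> 0" and T: "T = iota (mon d) * scaling \<chi> + R" and R: "low R (wt d - 1)"
    using assms(1) by (auto simp: lead_def)
  have "wb (Rep_op R (mon 0)) (wt d - 1)"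
    using R wb_mon[of 0] unfolding low_def by (metis add_0 wt_0)
  then have "e \<notin> Poly_Mapping.keys (Rep_op R (mon 0))"
    using assms(2) unfolding wb_def by (auto dest!: bspec[of _ _ e])
  then have "Poly_Mapping.lookup (Rep_op R (mon 0)) e = 0" by (simp add: in_keys_iff)
  moreover have "Rep_op (iota (mon d) * scaling \<chi>) (mon 0) = Poly_Mapping.single d (\<chi> 0)"
    by (simp add: times_op.rep_eq iota.rep_eq scaling.rep_eq mon_0 scale_single[of _ 0 1, simplified]) (simp add: mon_def mult_single)
  ultimately show ?thesis
    using \<chi> by (simp add: T plus_op.rep_eq lookup_add lookup_single when_def)
qed

context
  fixes q :: "'f::field"
  assumes q: "q \<noteq> 0" and qq: "q - inverse q \<noteq> 0" and q4: "q + inverse q \<noteq> 0"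
begin

lemma lead_gen_op: "gidx g < k \<Longrightarrow> lead (gen_op q k g) (lead_exp k g)"
proof -
  assume g: "gidx g < k"
  show ?thesis
  proof (cases g)
    case (G n)
    then show ?thesis
      using lead_mult[OF lead_cst lead_raw_op[OF q q4 g], of "(q + inverse q) * (q - inverse q)"] qq q4 by simp
  next
    case (Gt n)
    then show ?thesis
      using lead_mult[OF lead_cst lead_raw_op[OF q q4 g], of "- ((q - inverse q) * (q + inverse q)\<^sup>2)"] qq q4 by simp
  qed (use lead_raw_op[OF q q4 g] in simp_all)
qed

lemma lead_word: "\<forall>x\<in>set u. gidx x < k \<Longrightarrow> lead (prod_list (map (gen_op q k) u)) (mexp k (mset u))"
proof (induction u)
  case Nil
  show ?case using lead_cst[of "1::'f"] by (simp add: mexp_def cst_hom unital_hom.i_1[OF unital_hom_iota])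
next
  case (Cons x u)
  then show ?case using lead_mult[OF lead_gen_op[of x k] Cons.IH] by (simp add: mexp_def)
qed

text \<open>
  In a vanishing combination, applied to the constant polynomial, the leading monomial of a word with
  largest weight among those with nonzero coefficient cannot cancel: the other leading exponents are
  different, by \<open>mexp_inj\<close>, and their lower terms have smaller weight.
\<close>

theorem words_independent:
  assumes U: "finite U" "inj_on mset U"
    and sum: "(\<Sum>u\<in>U. const (c u) * prod_list (map var u)) \<in> aq_ideal q"
  shows "\<forall>u\<in>U. c u = 0"
proof (rule ccontr)
  assume "\<not> ?thesis"
  then have ne: "{u\<in>U. c u \<noteq> 0} \<noteq> {}" by auto
  \<comment> \<open>as many sites as needed for all indices that occur\<close>
  define k where "k = Suc (Max (insert 0 (gidx ` (\<Union>u\<in>U. set u))))"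
  have k: "gidx x < k" if "u \<in> U" "x \<in> set u" for u x
    unfolding k_def using that U(1) by (intro le_imp_less_Suc Max_ge) auto
  define e where "e u = mexp k (mset u)" for u
  define T where "T u = prod_list (map (gen_op q k) u)" for u
  have lead: "lead (T u) (e u)" if "u \<in> U" for u
    unfolding T_def e_def using k that by (intro lead_word) blast
  have inj: "u = v" if "u \<in> U" "v \<in> U" "e u = e v" for u v
    using mexp_inj[of "mset u" k "mset v"] k that U(2) by (auto simp: e_def dest: inj_onD)
  interpret ev: unital_hom "ev (gen_op q k)" by (rule unital_hom_ev)
  have "(\<Sum>u\<in>U. iota (cst (c u)) * T u) = 0"
    using ev_ideal[OF gen_op_rel[OF q q4] sum, of k]
    by (simp add: ev.i_sum ev_mult ev_const ev_word T_def)
  then have "Rep_op (\<Sum>u\<in>U. iota (cst (c u)) * T u) (mon 0) = 0" by (simp add: zero_op.rep_eq)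
  moreover have "Rep_op (\<Sum>u\<in>A. iota (cst (c u)) * T u) p = (\<Sum>u\<in>A. cst (c u) * Rep_op (T u) p)" for A p
    by (induction A rule: infinite_finite_induct)
      (simp_all add: zero_op.rep_eq plus_op.rep_eq times_op.rep_eq iota.rep_eq)
  ultimately have zero: "(\<Sum>u\<in>U. c u * Poly_Mapping.lookup (Rep_op (T u) (mon 0)) l) = 0" for l
    by (metis (no_types, lifting) lookup_cst_mult lookup_sum lookup_zero sum.cong)
  \<comment> \<open>a word of largest leading weight with nonzero coefficient\<close>
  obtain v where v: "v \<in> U" "c v \<noteq> 0" and max: "\<And>u. u \<in> U \<Longrightarrow> c u \<noteq> 0 \<Longrightarrow> wt (e u) \<le> wt (e v)"
  proof -
    let ?S = "{u\<in>U. c u \<noteq> 0}"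
    have fin: "finite ((\<lambda>u. wt (e u)) ` ?S)" using U(1) by simp
    have "Max ((\<lambda>u. wt (e u)) ` ?S) \<in> (\<lambda>u. wt (e u)) ` ?S" using Max_in[OF fin] ne by simp
    then obtain v where "v \<in> ?S" "wt (e v) = Max ((\<lambda>u. wt (e u)) ` ?S)" by (metis (no_types, lifting) imageE)
    moreover have "wt (e u) \<le> Max ((\<lambda>u. wt (e u)) ` ?S)" if "u \<in> ?S" for u
      using Max_ge[OF fin] that by blast
    ultimately have "v \<in> ?S" "\<forall>u\<in>?S. wt (e u) \<le> wt (e v)" by simp_all
    then show thesis using that by auto
  qed
  have "(\<Sum>u\<in>U. c u * Poly_Mapping.lookup (Rep_op (T u) (mon 0)) (e v)) = c v * Poly_Mapping.lookup (Rep_op (T v) (mon 0)) (e v)"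
  proof (subst sum.remove[OF U(1) v(1)], subst sum.neutral)
    show "\<forall>u\<in>U - {v}. c u * Poly_Mapping.lookup (Rep_op (T u) (mon 0)) (e v) = 0"
    proof
      fix u assume u: "u \<in> U - {v}"
      then have "e v \<noteq> e u" using inj v by auto
      then show "c u * Poly_Mapping.lookup (Rep_op (T u) (mon 0)) (e v) = 0"
        using lead_lookup[OF lead[of u], of "e v"] max[of u] u by auto
    qed
  qed simp
  then show False
    using zero[of "e v"] v lead_lookup[OF lead[OF v(1)], of "e v"] by auto
qed

end

section \<open>Exchanging two generators\<close>

lemma const_pass_left: "X * (const c * Y) = const c * (X * Y)" for X Y :: "('f::field, 'x) free_algebra"
  by (metis const_central mult.assoc)

lemma const_diff: "const (a - b) = const a - const b"
  by (simp add: const_def single_diff)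

lemma const_0: "const 0 = 0" by (simp add: const_def)

lemma aq_ideal_closed:
  fixes q :: "'f::field"
  shows "0 \<in> aq_ideal q" "X \<in> aq_ideal q \<Longrightarrow> Y \<in> aq_ideal q \<Longrightarrow> X + Y \<in> aq_ideal q"
    "X \<in> aq_ideal q \<Longrightarrow> Z * X \<in> aq_ideal q" "X \<in> aq_ideal q \<Longrightarrow> X * Z \<in> aq_ideal q"
proof -
  interpret ideal "aq_ideal q" class_ring by (rule ideal_aq_ideal)
  show "0 \<in> aq_ideal q" using zero_closed by simp
  show "X \<in> aq_ideal q \<Longrightarrow> Y \<in> aq_ideal q \<Longrightarrow> X + Y \<in> aq_ideal q" using a_closed[of X Y] by simp
  show "X \<in> aq_ideal q \<Longrightarrow> Z * X \<in> aq_ideal q" using I_l_closed[of X Z] by simp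
  show "X \<in> aq_ideal q \<Longrightarrow> X * Z \<in> aq_ideal q" using I_r_closed[of X Z] by simp
qed

lemma aq_ideal_minus: "X \<in> aq_ideal q \<Longrightarrow> - X \<in> aq_ideal q"
  using aq_ideal_closed(3)[of X q "- 1"] by simp
lemma aq_ideal_diff: "X \<in> aq_ideal q \<Longrightarrow> Y \<in> aq_ideal q \<Longrightarrow> X - Y \<in> aq_ideal q"
  using aq_ideal_closed(2)[of X q "- Y"] aq_ideal_minus[of Y q] by simp

lemma aq_rel_ideal: "aq_rel q X Y \<Longrightarrow> X - Y \<in> aq_ideal q"
proof -
  assume "aq_rel q X Y"
  then have "X - Y \<in> {X - Y | X Y. aq_rel q X Y}" by blast
  then show ?thesis unfolding aq_ideal_def
    using ring.genideal_self[OF class_ring.ring_axioms, of "{X - Y | X Y. aq_rel q X Y}"] by auto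
qed

definition wd :: "'x list \<Rightarrow> ('f::field, 'x) free_algebra" where "wd u = prod_list (map var u)"

lemma wd_append: "wd (u @ v) = wd u * wd v" by (simp add: wd_def)

text \<open>
  Combinations of words from \<open>L\<close>, modulo the relations. Working in the free algebra modulo the ideal
  keeps the type class of rings available.
\<close>

inductive_set spanI :: "'f::field \<Rightarrow> alt_gen list set \<Rightarrow> ('f, alt_gen) free_algebra set" for q L where
  ideal: "P \<in> aq_ideal q \<Longrightarrow> P \<in> spanI q L"
| word: "u \<in> L \<Longrightarrow> wd u \<in> spanI q L"
| add: "P \<in> spanI q L \<Longrightarrow> Q \<in> spanI q L \<Longrightarrow> P + Q \<in> spanI q L"
| scale: "P \<in> spanI q L \<Longrightarrow> const c * P \<in> spanI q L"

lemma spanI_minus: "P \<in> spanI q L \<Longrightarrow> - P \<in> spanI q L"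
proof -
  assume "P \<in> spanI q L"
  then have "const (0 - 1) * P \<in> spanI q L" by (rule spanI.scale)
  then show ?thesis unfolding const_diff const_0 const_one by simp
qed

lemma spanI_diff: "P \<in> spanI q L \<Longrightarrow> Q \<in> spanI q L \<Longrightarrow> P - Q \<in> spanI q L"
  using spanI.add[of P q L "- Q"] spanI_minus[of Q q L] by simp
lemma spanI_cong: "P - Q \<in> aq_ideal q \<Longrightarrow> Q \<in> spanI q L \<Longrightarrow> P \<in> spanI q L"
  using spanI.add[OF spanI.ideal[of "P - Q"]] by fastforce
lemma spanI_unscale: "c \<noteq> 0 \<Longrightarrow> const c * P \<in> spanI q L \<Longrightarrow> P \<in> spanI q L"
  using spanI.scale[of "const c * P" q L "inverse c"] by (simp add: const_mult[symmetric] const_one flip: mult.assoc)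

lemma spanI_sub:
  assumes "P \<in> spanI q L" "\<And>u. u \<in> L \<Longrightarrow> wd u \<in> spanI q L'"
  shows "P \<in> spanI q L'"
  using assms(1) by induction (auto intro: spanI.intros assms(2))

lemma spanI_mult:
  assumes "P \<in> spanI q K" "Q \<in> spanI q L" "\<And>u v. u \<in> K \<Longrightarrow> v \<in> L \<Longrightarrow> wd (u @ v) \<in> spanI q M"
  shows "P * Q \<in> spanI q M"
  using assms(1)
proof induction
  case (word u)
  show ?case using assms(2)
  proof induction
    case (word v)
    then show ?case using assms(3)[OF \<open>u \<in> K\<close>] by (simp add: wd_append)
  qed (auto intro: spanI.intros aq_ideal_closed simp: distrib_left const_pass_left)
qed (auto intro: spanI.intros aq_ideal_closed simp: distrib_right mult.assoc)

text \<open>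
  Let \<open>Y\<^sub>n = k (A\<^sub>n - B\<^sub>n\<^sub>-\<^sub>1)\<close>, so that the first relation reads \<open>A\<^sub>0 C\<^sub>n = y C\<^sub>n A\<^sub>0 + Y\<^sub>n\<close>. Used on the
  right or on the left factors of \<open>T = C\<^sub>i A\<^sub>0 C\<^sub>j - C\<^sub>j A\<^sub>0 C\<^sub>i\<close>, it gives
  \<open>T = C\<^sub>i Y\<^sub>j - C\<^sub>j Y\<^sub>i\<close> and \<open>y T = Y\<^sub>j C\<^sub>i - Y\<^sub>i C\<^sub>j\<close>. One of the two is a combination of allowed words, and
  the difference shows \<open>[C\<^sub>i, Y\<^sub>j] - [C\<^sub>j, Y\<^sub>i] = (1 - y) T\<close>. By the symmetry for \<open>B\<close>, the same follows for
  \<open>[C\<^sub>i, A\<^sub>j] - [C\<^sub>j, A\<^sub>i]\<close>. With the symmetry \<open>[C\<^sub>i\<^sub>+\<^sub>1, A\<^sub>j] = [C\<^sub>j\<^sub>+\<^sub>1, A\<^sub>i]\<close> the index of \<open>A\<close> can be lowered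
  at the cost of that of \<open>C\<close>, until the scalar \<open>C\<^sub>0\<close> appears.
\<close>

lemma exchange_span:
  fixes q y z k :: "'f::field" and C A B :: "nat \<Rightarrow> ('f, alt_gen) free_algebra"
  assumes k: "k \<noteq> 0" and C0: "C 0 = const z"
    and r: "\<And>n. A 0 * C n - const y * (C n * A 0) - const k * (A n - (if n = 0 then 0 else B (n - 1))) \<in> aq_ideal q"
    and CC: "\<And>i j. C i * C j - C j * C i \<in> aq_ideal q"
    and sA: "\<And>i j. comm (C (Suc i)) (A j) - comm (C (Suc j)) (A i) \<in> aq_ideal q"
    and sB: "\<And>i j. comm (C (Suc i)) (B j) - comm (C (Suc j)) (B i) \<in> aq_ideal q"
    and N: "(\<forall>i j. C i * A j \<in> spanI q L \<and> C i * B j \<in> spanI q L) \<or>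
       y \<noteq> 0 \<and> (\<forall>i j. A j * C i \<in> spanI q L \<and> B j * C i \<in> spanI q L)"
  shows "comm (C i) (A j) \<in> spanI q L"
proof -
  define Y where "Y n = const k * (A n - (if n = 0 then 0 else B (n - 1)))" for n
  note rY = r[folded Y_def]
  have comm_Y: "comm (C i) (Y j) - comm (C j) (Y i) \<in> spanI q L" for i j
  proof -
    define T where "T = C i * (A 0 * C j) - C j * (A 0 * C i)"
    define R where "R n = A 0 * C n - const y * (C n * A 0) - Y n" for n
    define K where "K = C i * C j - C j * C i"
    have R: "R n \<in> aq_ideal q" for n using rY[of n] by (simp add: R_def)
    have K: "K \<in> aq_ideal q" using CC by (simp add: K_def)
    have T1: "T - (C i * Y j - C j * Y i) = C i * R j - C j * R i + const y * (K * A 0)"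
      unfolding T_def R_def K_def by (simp add: right_diff_distrib left_diff_distrib const_pass_left mult.assoc)
    have T2: "const y * T - (Y j * C i - Y i * C j) = R j * C i - R i * C j + A 0 * K"
      unfolding T_def R_def K_def by (simp add: right_diff_distrib left_diff_distrib const_pass_left mult.assoc)
    have T3: "comm (C i) (Y j) - comm (C j) (Y i) - const (1 - y) * T =
       (R j * C i - C i * R j) + (C j * R i - R i * C j) + A 0 * K - const y * (K * A 0)"
      unfolding T_def R_def K_def comm_def const_diff const_one
      by (simp add: right_diff_distrib left_diff_distrib const_pass_left mult.assoc)
    have Ysp: "C i * Y j \<in> spanI q L" if "\<forall>i j. C i * A j \<in> spanI q L \<and> C i * B j \<in> spanI q L" for i j
      using that unfolding Y_def const_pass_left by (auto intro!: spanI.scale spanI_diff simp: right_diff_distrib)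
    have Ysp': "Y j * C i \<in> spanI q L" if "\<forall>i j. A j * C i \<in> spanI q L \<and> B j * C i \<in> spanI q L" for i j
      using that unfolding Y_def mult.assoc by (auto intro!: spanI.scale spanI_diff simp: left_diff_distrib)
    have "T \<in> spanI q L"
      using N
    proof
      assume a: "\<forall>i j. C i * A j \<in> spanI q L \<and> C i * B j \<in> spanI q L"
      have "T - (C i * Y j - C j * Y i) \<in> aq_ideal q" unfolding T1
        by (intro aq_ideal_closed aq_ideal_diff R K)
      then show ?thesis by (rule spanI_cong) (intro spanI_diff Ysp a)
    next
      assume a: "y \<noteq> 0 \<and> (\<forall>i j. A j * C i \<in> spanI q L \<and> B j * C i \<in> spanI q L)"
      have "const y * T - (Y j * C i - Y i * C j) \<in> aq_ideal q" unfolding T2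
        by (intro aq_ideal_closed aq_ideal_diff R K)
      then have "const y * T \<in> spanI q L" by (rule spanI_cong) (intro spanI_diff Ysp' a[THEN conjunct2])
      then show ?thesis using a spanI_unscale by blast
    qed
    then have "const (1 - y) * T \<in> spanI q L" by (rule spanI.scale)
    moreover have "comm (C i) (Y j) - comm (C j) (Y i) - const (1 - y) * T \<in> aq_ideal q"
      unfolding T3 by (intro aq_ideal_closed aq_ideal_diff R K)
    ultimately show ?thesis using spanI_cong by blast
  qed
  have C0_comm: "comm (C 0) X = 0" for X by (simp add: comm_def C0 const_central)
  have A_anti: "comm (C i) (A j) - comm (C j) (A i) \<in> spanI q L" for i j
  proof (rule spanI_unscale[OF k])
    have "const k * comm (C a) (A b) = comm (C a) (Y b) + const k * (if b = 0 then 0 else comm (C a) (B (b - 1)))" for a b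
      by (simp add: comm_def Y_def right_diff_distrib left_diff_distrib const_pass_left mult.assoc)
    then have "const k * (comm (C i) (A j) - comm (C j) (A i)) = (comm (C i) (Y j) - comm (C j) (Y i))
       + const k * ((if j = 0 then 0 else comm (C i) (B (j - 1))) - (if i = 0 then 0 else comm (C j) (B (i - 1))))"
      by (simp add: right_diff_distrib)
    moreover have "(if j = 0 then 0 else comm (C i) (B (j - 1))) - (if i = 0 then 0 else comm (C j) (B (i - 1))) \<in> aq_ideal q"
      using sB[of "i - 1" "j - 1"] by (cases i; cases j) (auto simp: C0_comm aq_ideal_closed(1))
    ultimately show "const k * (comm (C i) (A j) - comm (C j) (A i)) \<in> spanI q L"
      using spanI.add[OF comm_Y[of i j] spanI.scale[OF spanI.ideal]] by (simp only:)
  qed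
  show ?thesis
  proof (induction j arbitrary: i)
    case 0
    show ?case using A_anti[of i 0] by (simp add: C0_comm)
  next
    case (Suc j)
    have "comm (C (Suc j)) (A i) \<in> spanI q L"
      using spanI_cong[OF sA[of j i] Suc.IH[of "Suc i"]] .
    then show ?case using spanI.add[OF A_anti[of i "Suc j"]] by fastforce
  qed
qed

lemma wd_Cons: "wd (x # u) = var x * wd u" and wd_2: "wd [x, y] = var x * var y" and wd_1: "wd [x] = var x"
  by (simp_all add: wd_def)

lemma comm_anti: "comm X Y = - comm Y X" by (simp add: comm_def)

text \<open>
  Results of an exchange of two letters: \<open>G\<close> in front of a letter \<open>W\<close>, or \<open>Gt\<close> behind it. Single letters
  \<open>W\<close> arise from the scalars of index \<open>0\<close>.
\<close>

definition LG where "LG = {[G i, m] | i m. m \<in> range Wneg \<union> range Wpos} \<union> {[m] | m. m \<in> range Wneg \<union> range Wpos}"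
definition LT where "LT = {[m, Gt i] | i m. m \<in> range Wneg \<union> range Wpos} \<union> {[m] | m. m \<in> range Wneg \<union> range Wpos}"

abbreviation "onlyG u \<equiv> set u \<subseteq> range G"
abbreviation "onlyT u \<equiv> set u \<subseteq> range Gt"
abbreviation "onlyM u \<equiv> set u \<subseteq> range Wneg \<union> range Wpos"

context
  fixes q :: "'f::field"
  assumes q: "q \<noteq> 0" and h0: "q - inverse q \<noteq> 0" and p0: "q + inverse q \<noteq> 0"
begin

abbreviation "I \<equiv> aq_ideal q"

text \<open>
  The letters \<open>G\<close> and \<open>Gt\<close>, extended by a scalar of index \<open>0\<close>. The scalar satisfies
  \<open>rho q = (q - 1/q) gam\<close>, so that the \<open>q\<close>-commutator of a letter \<open>W\<close> of index \<open>0\<close> with it is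
  \<open>rho q\<close> times this letter, as the defining relations say for larger indices.
\<close>

definition gam :: 'f where "gam = - ((q - inverse q) * (q + inverse q)^2)"
definition gG :: "nat \<Rightarrow> ('f, alt_gen) free_algebra" where "gG n = (if n = 0 then const gam else var (G (n - 1)))"
definition gT :: "nat \<Rightarrow> ('f, alt_gen) free_algebra" where "gT n = (if n = 0 then const gam else var (Gt (n - 1)))"

lemma rho: "rho q = (q - inverse q) * gam"
  using q by (simp add: rho_def gam_def field_simps power2_eq_square)
lemma rho0: "rho q \<noteq> 0" using h0 p0 by (simp add: rho gam_def)

lemma rel_var:
  "comm (var (G i)) (var (G j)) \<in> I" "comm (var (Gt i)) (var (Gt j)) \<in> I"
  "comm (var (Wneg i)) (var (Wneg j)) \<in> I" "comm (var (Wpos i)) (var (Wpos j)) \<in> I"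
  "comm (var (Wneg i)) (var (Wpos j)) + comm (var (Wpos i)) (var (Wneg j)) \<in> I"
  "comm (var (Wneg i)) (var (G j)) + comm (var (G i)) (var (Wneg j)) \<in> I"
  "comm (var (Wneg i)) (var (Gt j)) + comm (var (Gt i)) (var (Wneg j)) \<in> I"
  "comm (var (Wpos i)) (var (G j)) + comm (var (G i)) (var (Wpos j)) \<in> I"
  "comm (var (Wpos i)) (var (Gt j)) + comm (var (Gt i)) (var (Wpos j)) \<in> I"
  "comm (var (Gt i)) (var (G j)) + comm (var (G i)) (var (Gt j)) \<in> I"
  using aq_rel_ideal[OF aq_rel.intros(14)[of q i j]] aq_rel_ideal[OF aq_rel.intros(15)[of q i j]]
    aq_rel_ideal[OF aq_rel.intros(7)[of q i j]] aq_rel_ideal[OF aq_rel.intros(8)[of q i j]]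
    aq_rel_ideal[OF aq_rel.intros(9)[of q i j]] aq_rel_ideal[OF aq_rel.intros(10)[of q i j]]
    aq_rel_ideal[OF aq_rel.intros(11)[of q i j]] aq_rel_ideal[OF aq_rel.intros(12)[of q i j]]
    aq_rel_ideal[OF aq_rel.intros(13)[of q i j]] aq_rel_ideal[OF aq_rel.intros(16)[of q i j]]
  by simp_all

lemma rel_q_aux: "const q * X * Y - const (inverse q) * Y * X - (const (rho q) * U - const (rho q) * V) \<in> I \<Longrightarrow>
    X * Y - const (inverse q * inverse q) * (Y * X) - const (inverse q * rho q) * (U - V) \<in> I"
  "const q * X * Y - const (inverse q) * Y * X - (const (rho q) * U - const (rho q) * V) \<in> I \<Longrightarrow>
    Y * X - const (q * q) * (X * Y) - const (- (q * rho q)) * (U - V) \<in> I"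
proof -
  assume *: "const q * X * Y - const (inverse q) * Y * X - (const (rho q) * U - const (rho q) * V) \<in> I"
  have c: "const (inverse q) * (const q * Z) = Z" "const q * (const (inverse q) * Z) = Z" for Z :: "('f, alt_gen) free_algebra"
    using q by (simp_all add: const_one flip: const_mult mult.assoc)
  show "X * Y - const (inverse q * inverse q) * (Y * X) - const (inverse q * rho q) * (U - V) \<in> I"
    using aq_ideal_closed(3)[OF *, of "const (inverse q)"] by (simp add: right_diff_distrib mult.assoc c const_mult)
  have m: "const (- x) = - const x" for x :: 'f using const_diff[of 0 x] by (simp add: const_0)
  have "- const q * (const q * X * Y - const (inverse q) * Y * X - (const (rho q) * U - const (rho q) * V)) \<in> I"
    by (rule aq_ideal_closed(3)[OF *])
  then show "Y * X - const (q * q) * (X * Y) - const (- (q * rho q)) * (U - V) \<in> I"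
    by (simp add: right_diff_distrib left_diff_distrib mult.assoc c const_mult m algebra_simps)
qed

lemma base_q: "X * const gam - const (inverse q * inverse q) * (const gam * X) - const (inverse q * rho q) * X \<in> I"
  "X * const gam - const (q * q) * (const gam * X) - const (- (q * rho q)) * X \<in> I"
proof -
  have 1: "X * const gam - const a * (const gam * X) - const b * X = const (gam - a * gam - b) * X" for a b
    by (simp add: const_central[of gam X, symmetric] const_diff const_mult left_diff_distrib mult.assoc)
  have "gam - inverse q * inverse q * gam - inverse q * rho q = 0" "gam - q * q * gam - - (q * rho q) = 0"
    using q by (simp_all add: rho field_simps)
  then show "X * const gam - const (inverse q * inverse q) * (const gam * X) - const (inverse q * rho q) * X \<in> I"
    "X * const gam - const (q * q) * (const gam * X) - const (- (q * rho q)) * X \<in> I"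
    unfolding 1 by (simp_all add: const_0 aq_ideal_closed(1))
qed

text \<open>
  The relations with a \<open>q\<close>-commutator, in the form of the first hypothesis of \<open>exchange_span\<close>.
\<close>

lemma r_all:
  "var (Wneg 0) * gG n - const (inverse q * inverse q) * (gG n * var (Wneg 0)) - const (inverse q * rho q) * (var (Wneg n) - (if n = 0 then 0 else var (Wpos (n - 1)))) \<in> I"
  "var (Wpos 0) * gG n - const (q * q) * (gG n * var (Wpos 0)) - const (- (q * rho q)) * (var (Wpos n) - (if n = 0 then 0 else var (Wneg (n - 1)))) \<in> I"
  "var (Wneg 0) * gT n - const (q * q) * (gT n * var (Wneg 0)) - const (- (q * rho q)) * (var (Wneg n) - (if n = 0 then 0 else var (Wpos (n - 1)))) \<in> I"
  "var (Wpos 0) * gT n - const (inverse q * inverse q) * (gT n * var (Wpos 0)) - const (inverse q * rho q) * (var (Wpos n) - (if n = 0 then 0 else var (Wneg (n - 1)))) \<in> I"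
  using base_q rel_q_aux(1)[OF aq_rel_ideal[OF aq_rel.intros(3), unfolded qcomm_def], of "n - 1"]
    rel_q_aux(2)[OF aq_rel_ideal[OF aq_rel.intros(5), unfolded qcomm_def], of "n - 1"]
    rel_q_aux(2)[OF aq_rel_ideal[OF aq_rel.intros(4), unfolded qcomm_def], of "n - 1"]
    rel_q_aux(1)[OF aq_rel_ideal[OF aq_rel.intros(6), unfolded qcomm_def], of "n - 1"]
  by (cases n; simp add: gG_def gT_def)+

lemma gG_comm: "gG i * gG j - gG j * gG i \<in> I" and gT_comm: "gT i * gT j - gT j * gT i \<in> I"
  using rel_var(1)[of "i - 1" "j - 1"] rel_var(2)[of "i - 1" "j - 1"]
  by (auto simp: gG_def gT_def comm_def const_central aq_ideal_closed(1))

lemma gen_sym: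
  "comm (gG (Suc i)) (var (Wneg j)) - comm (gG (Suc j)) (var (Wneg i)) \<in> I"
  "comm (gG (Suc i)) (var (Wpos j)) - comm (gG (Suc j)) (var (Wpos i)) \<in> I"
  "comm (gT (Suc i)) (var (Wneg j)) - comm (gT (Suc j)) (var (Wneg i)) \<in> I"
  "comm (gT (Suc i)) (var (Wpos j)) - comm (gT (Suc j)) (var (Wpos i)) \<in> I"
  using rel_var(6)[of i j] rel_var(8)[of i j] rel_var(7)[of i j] rel_var(9)[of i j]
  by (simp_all add: gG_def gT_def comm_anti[of "var (Wneg i)"] comm_anti[of "var (Wpos i)"])

lemma gG_LG: "m \<in> range Wneg \<union> range Wpos \<Longrightarrow> gG i * var m \<in> spanI q LG"
proof (cases i)
  case 0
  assume "m \<in> range Wneg \<union> range Wpos"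
  then have "wd [m] \<in> spanI q LG" by (intro spanI.word) (auto simp: LG_def)
  then show ?thesis using 0 by (auto simp: gG_def wd_1 intro: spanI.scale)
next
  case (Suc j)
  assume "m \<in> range Wneg \<union> range Wpos"
  then have "wd [G j, m] \<in> spanI q LG" by (intro spanI.word) (auto simp: LG_def)
  then show ?thesis using Suc by (simp add: gG_def wd_2)
qed

lemma gT_LT: "m \<in> range Wneg \<union> range Wpos \<Longrightarrow> var m * gT i \<in> spanI q LT"
proof (cases i)
  case 0
  assume "m \<in> range Wneg \<union> range Wpos"
  then have "wd [m] \<in> spanI q LT" by (intro spanI.word) (auto simp: LT_def)
  then show ?thesis using 0 by (auto simp: gT_def wd_1 const_central[symmetric] intro: spanI.scale)
next
  case (Suc j)
  assume "m \<in> range Wneg \<union> range Wpos"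
  then have "wd [m, Gt j] \<in> spanI q LT" by (intro spanI.word) (auto simp: LT_def)
  then show ?thesis using Suc by (simp add: gT_def wd_2)
qed

lemma M_G: assumes "m \<in> range Wneg \<union> range Wpos" shows "wd [m, G i] \<in> spanI q LG"
proof -
  have k: "inverse q * rho q \<noteq> 0" "- (q * rho q) \<noteq> 0" using q rho0 by simp_all
  have "comm (gG (Suc i)) (var m) \<in> spanI q LG"
    using assms
  proof
    assume "m \<in> range Wneg"
    then show ?thesis
      using exchange_span[where C = gG and A = "\<lambda>n. var (Wneg n)" and B = "\<lambda>n. var (Wpos n)" and L = LG, OF k(1) _ r_all(1) gG_comm gen_sym(1,2)]
      by (auto simp: gG_def[of 0] gG_LG)
  next
    assume "m \<in> range Wpos"
    then show ?thesis
      using exchange_span[where C = gG and A = "\<lambda>n. var (Wpos n)" and B = "\<lambda>n. var (Wneg n)" and L = LG, OF k(2) _ r_all(2) gG_comm gen_sym(2,1)]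
      by (auto simp: gG_def[of 0] gG_LG)
  qed
  then have "gG (Suc i) * var m - comm (gG (Suc i)) (var m) \<in> spanI q LG" by (intro spanI_diff gG_LG assms)
  then show ?thesis by (simp add: comm_def gG_def wd_2)
qed

lemma T_M: assumes "m \<in> range Wneg \<union> range Wpos" shows "wd [Gt i, m] \<in> spanI q LT"
proof -
  have k: "inverse q * rho q \<noteq> 0" "- (q * rho q) \<noteq> 0" and y: "inverse q * inverse q \<noteq> 0" "q * q \<noteq> 0" using q rho0 by simp_all
  have "comm (gT (Suc i)) (var m) \<in> spanI q LT"
    using assms
  proof
    assume "m \<in> range Wneg"
    then show ?thesis
      using exchange_span[where C = gT and A = "\<lambda>n. var (Wneg n)" and B = "\<lambda>n. var (Wpos n)" and L = LT, OF k(2) _ r_all(3) gT_comm gen_sym(3,4)] y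
      by (auto simp: gT_def[of 0] gT_LT)
  next
    assume "m \<in> range Wpos"
    then show ?thesis
      using exchange_span[where C = gT and A = "\<lambda>n. var (Wpos n)" and B = "\<lambda>n. var (Wneg n)" and L = LT, OF k(1) _ r_all(4) gT_comm gen_sym(4,3)] y
      by (auto simp: gT_def[of 0] gT_LT)
  qed
  then have "var m * gT (Suc i) + comm (gT (Suc i)) (var m) \<in> spanI q LT" by (intro spanI.add gT_LT assms)
  then show ?thesis by (simp add: comm_def gT_def wd_2)
qed

end

section \<open>Moving \<open>G\<close> to the left and \<open>Gt\<close> to the right\<close>

text \<open>
  Normal forms at the intermediate stages: words in \<open>G\<close> followed by words in \<open>Gt\<close>; \<open>n\<close> letters \<open>W\<close>, in
  any order, after letters \<open>G\<close> or before letters \<open>Gt\<close>.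
\<close>

definition LCD where "LCD = {c @ d | c d. onlyG c \<and> onlyT d}"

definition LM where "LM n = {c @ u | c u. onlyG c \<and> onlyM u \<and> length u = n}"

definition LR where "LR n = {u @ d | u d. onlyM u \<and> onlyT d \<and> length u = n}"

definition LL where "LL = (\<Union>n. LM n)"

context
  fixes q :: "'f::field"
  assumes q: "q \<noteq> 0" and h0: "q - inverse q \<noteq> 0" and p0: "q + inverse q \<noteq> 0"
begin

lemma LCD_words: "wd [] \<in> spanI q LCD" "wd [G i] \<in> spanI q LCD" "wd [Gt j] \<in> spanI q LCD" "wd [G i, Gt j] \<in> spanI q LCD" "wd [G i, G j] \<in> spanI q LCD"
proof -
  have "[] \<in> LCD" "[G i] \<in> LCD" "[Gt j] \<in> LCD" "[G i, Gt j] \<in> LCD" "[G i, G j] \<in> LCD"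
    unfolding LCD_def
    by (rule CollectI, rule exI[of _ "[]"], rule exI[of _ "[]"], simp)
      (rule CollectI, rule exI[of _ "[G i]"], rule exI[of _ "[]"], simp,
       rule CollectI, rule exI[of _ "[]"], rule exI[of _ "[Gt j]"], simp,
       rule CollectI, rule exI[of _ "[G i]"], rule exI[of _ "[Gt j]"], simp,
       rule CollectI, rule exI[of _ "[G i, G j]"], rule exI[of _ "[]"], simp)
  then show "wd [] \<in> spanI q LCD" "wd [G i] \<in> spanI q LCD" "wd [Gt j] \<in> spanI q LCD" "wd [G i, Gt j] \<in> spanI q LCD" "wd [G i, G j] \<in> spanI q LCD"
    by (auto intro: spanI.word)
qed

abbreviation "vA n \<equiv> (var (Wneg n) :: ('f, alt_gen) free_algebra)"
abbreviation "vB n \<equiv> (var (Wpos n) :: ('f, alt_gen) free_algebra)"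
abbreviation "vC n \<equiv> (var (G n) :: ('f, alt_gen) free_algebra)"
abbreviation "vD n \<equiv> (var (Gt n) :: ('f, alt_gen) free_algebra)"

text \<open>
  By induction on the index of \<open>A\<close>. Index \<open>0\<close> is a defining relation. For the step, the commutator of
  \<open>A\<^sub>i\<close> with the relation that defines \<open>B\<^sub>j\<^sub>+\<^sub>1\<close> through \<open>[C\<^sub>j, B\<^sub>0]\<^sub>q\<close> is antisymmetrised in \<open>i\<close> and \<open>j\<close>. The
  terms with \<open>[A\<^sub>i, C\<^sub>j]\<close> cancel, and what remains contains only \<open>[A\<^sub>i, B\<^sub>0]\<close>, which is again known from a
  defining relation. So \<open>[A\<^sub>i, B\<^sub>j\<^sub>+\<^sub>1]\<close> may be replaced by \<open>[A\<^sub>j, B\<^sub>i\<^sub>+\<^sub>1]\<close>, and the latter equals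
  \<open>[A\<^sub>i\<^sub>+\<^sub>1, B\<^sub>j]\<close>.
\<close>

lemma comm_AB: "comm (vA i) (vB j) \<in> spanI q LCD"
proof (induction i arbitrary: j)
  case 0
  have "comm (vA 0) (vB j) - const (inverse (q + inverse q)) * (vD j - vC j) \<in> aq_ideal q"
    by (rule aq_rel_ideal[OF aq_rel.intros(1)])
  then show ?case
    by (rule spanI_cong) (intro spanI.scale spanI_diff LCD_words[unfolded wd_1])
next
  case (Suc i)
  define W where "W n = comm (vA n) (vB 0)" for n
  define c where "c = inverse (q + inverse q)"
  define S where "S n = W n - const c * (vD n - vC n)" for n
  have S: "S n \<in> aq_ideal q" for n
    unfolding S_def W_def c_def by (rule aq_rel_ideal[OF aq_rel.intros(2)])
  define r where "r n = qcomm q (vC n) (vB 0) - (const (rho q) * vB (Suc n) - const (rho q) * vA n)" for n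
  have r: "r n \<in> aq_ideal q" for n unfolding r_def by (rule aq_rel_ideal[OF aq_rel.intros(5)])
  define F where "F = comm (vA i) (vC j) - comm (vA j) (vC i)"
  have F: "F \<in> aq_ideal q"
    using rel_var(6)[OF q h0 p0, of i j] comm_anti[of "vC i" "vA j"] by (simp add: F_def)
  have AA: "comm (vA i) (vA j) \<in> aq_ideal q" by (rule rel_var(3)[OF q h0 p0])
  have CD: "comm (vD i) (vC j) - comm (vD j) (vC i) \<in> aq_ideal q"
    using rel_var(10)[OF q h0 p0, of i j] comm_anti[of "vC i" "vD j"] by simp
  have CC: "comm (vC i) (vC j) \<in> aq_ideal q" by (rule rel_var(1)[OF q h0 p0])
  \<comment> \<open>modulo the relations, rho q * E = (q - 1/q) * Z, and the factors W in Z are linear in G and Gt\<close>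
  define E where "E = comm (vA i) (vB (Suc j)) - comm (vA j) (vB (Suc i))"
  define Z where "Z = vC j * W i - vC i * W j"
  have "const (rho q) * E = const q * Z - const (inverse q) * (W i * vC j - W j * vC i)
      - ((vA i * r j - r j * vA i) - (vA j * r i - r i * vA j))
      + (const q * (F * vB 0) - const (inverse q) * (vB 0 * F)) + (const (rho q) * comm (vA i) (vA j) + const (rho q) * comm (vA i) (vA j))"
    unfolding E_def Z_def W_def r_def F_def comm_def qcomm_def
    by (simp add: right_diff_distrib left_diff_distrib const_pass_left mult.assoc)
  moreover have "W i * vC j - W j * vC i = Z + (comm (S i) (vC j) - comm (S j) (vC i))
      + const c * ((comm (vD i) (vC j) - comm (vD j) (vC i)) - comm (vC i) (vC j) - comm (vC i) (vC j))"
    unfolding S_def Z_def comm_def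
    by (simp add: right_diff_distrib left_diff_distrib const_pass_left mult.assoc)
  ultimately have eq: "const (rho q) * E - const (q - inverse q) * Z =
      - (const (inverse q) * ((comm (S i) (vC j) - comm (S j) (vC i))
      + const c * ((comm (vD i) (vC j) - comm (vD j) (vC i)) - comm (vC i) (vC j) - comm (vC i) (vC j))))
      - ((vA i * r j - r j * vA i) - (vA j * r i - r i * vA j))
      + (const q * (F * vB 0) - const (inverse q) * (vB 0 * F)) + (const (rho q) * comm (vA i) (vA j) + const (rho q) * comm (vA i) (vA j))"
    by (simp add: const_diff left_diff_distrib distrib_left)
  have commS: "comm (S a) X \<in> aq_ideal q" for a X
    unfolding comm_def by (intro aq_ideal_diff aq_ideal_closed(3,4) S)
  have I: "const (rho q) * E - const (q - inverse q) * Z \<in> aq_ideal q"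
    unfolding eq
    by (intro aq_ideal_closed(2-4) aq_ideal_diff aq_ideal_minus commS CD CC r F AA)
  have "vC a * W b \<in> spanI q LCD" for a b
  proof -
    have "vC a * W b - const c * (vC a * vD b - vC a * vC b) = vC a * S b"
      by (simp add: S_def right_diff_distrib const_pass_left)
    then have "vC a * W b - const c * (vC a * vD b - vC a * vC b) \<in> aq_ideal q" by (simp add: S aq_ideal_closed(3))
    then show ?thesis by (rule spanI_cong) (intro spanI.scale spanI_diff LCD_words[unfolded wd_2])
  qed
  then have "Z \<in> spanI q LCD" unfolding Z_def by (intro spanI_diff)
  then have "const (rho q) * E \<in> spanI q LCD" using spanI_cong[OF I spanI.scale] by blast
  then have "E \<in> spanI q LCD" using spanI_unscale[OF rho0[OF q h0 p0]] by blast
  then have 1: "comm (vA j) (vB (Suc i)) \<in> spanI q LCD"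
    using spanI_diff[OF Suc.IH[of "Suc j"]] unfolding E_def by fastforce
  have "comm (vA (Suc i)) (vB j) - comm (vA j) (vB (Suc i)) \<in> aq_ideal q"
    using rel_var(5)[OF q h0 p0, of "Suc i" j] comm_anti[of "vB (Suc i)" "vA j"] by simp
  then show ?case using 1 by (rule spanI_cong)
qed

abbreviation "isM m \<equiv> m \<in> range Wneg \<union> range Wpos"

lemma spanI_mult_words:
  "P \<in> spanI q K \<Longrightarrow> (\<And>v. v \<in> K \<Longrightarrow> wd (v @ u) \<in> spanI q L) \<Longrightarrow> P * wd u \<in> spanI q L"
  "P \<in> spanI q K \<Longrightarrow> (\<And>v. v \<in> K \<Longrightarrow> wd (u @ v) \<in> spanI q L) \<Longrightarrow> wd u * P \<in> spanI q L"
  using spanI_mult[of P q K "wd u" "{u}" L] spanI_mult[of "wd u" q "{u}" P K L] spanI.word[of u "{u}" q] by auto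

text \<open>
  Words are treated letter by letter with the exchange of two letters. The number of letters \<open>W\<close> does
  not change.
\<close>

lemma M_past_G: "isM m \<Longrightarrow> onlyG c \<Longrightarrow> wd (m # c) \<in> spanI q (LM 1)"
proof (induction c arbitrary: m)
  case Nil
  then have "[m] \<in> LM 1" unfolding LM_def by (intro CollectI exI[of _ "[]"] exI[of _ "[m]"]) auto
  then show ?case by (rule spanI.word)
next
  case (Cons g c)
  then obtain i where g: "g = G i" and c: "onlyG c" by auto
  have "wd [m, G i] * wd c \<in> spanI q (LM 1)"
  proof (rule spanI_mult_words(1)[OF M_G[OF q h0 p0 Cons.prems(1)]])
    fix v assume "v \<in> LG"
    then consider k m' where "v = [G k, m']" "isM m'" | m' where "v = [m']" "isM m'" by (auto simp: LG_def)
    then show "wd (v @ c) \<in> spanI q (LM 1)"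
    proof cases
      case 1
      have "wd [G k] * wd (m' # c) \<in> spanI q (LM 1)"
      proof (rule spanI_mult_words(2)[OF Cons.IH[OF 1(2) c]])
        fix w assume "w \<in> LM 1"
        then obtain c' u where "w = c' @ u" "onlyG c'" "onlyM u" "length u = 1" by (auto simp: LM_def)
        then have "[G k] @ w \<in> LM 1" unfolding LM_def by (intro CollectI exI[of _ "G k # c'"] exI[of _ u]) auto
        then show "wd ([G k] @ w) \<in> spanI q (LM 1)" by (rule spanI.word)
      qed
      then show ?thesis using 1 by (simp add: wd_def mult.assoc)
    qed (use Cons.IH[OF _ c] in simp)
  qed
  then show ?case by (simp add: g wd_def mult.assoc)
qed

lemma T_past_M1: "onlyT d \<Longrightarrow> isM m \<Longrightarrow> wd (d @ [m]) \<in> spanI q (LR 1)"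
proof (induction d arbitrary: m rule: rev_induct)
  case Nil
  then have "[m] \<in> LR 1" unfolding LR_def by (intro CollectI exI[of _ "[m]"] exI[of _ "[]"]) auto
  then show ?case by (simp add: spanI.word)
next
  case (snoc g d)
  then obtain i where g: "g = Gt i" and d: "onlyT d" by auto
  have "wd d * wd [Gt i, m] \<in> spanI q (LR 1)"
  proof (rule spanI_mult_words(2)[OF T_M[OF q h0 p0 snoc.prems(2)]])
    fix v assume "v \<in> LT"
    then consider k m' where "v = [m', Gt k]" "isM m'" | m' where "v = [m']" "isM m'" by (auto simp: LT_def)
    then show "wd (d @ v) \<in> spanI q (LR 1)"
    proof cases
      case 1
      have "wd (d @ [m']) * wd [Gt k] \<in> spanI q (LR 1)"
      proof (rule spanI_mult_words(1)[OF snoc.IH[OF d 1(2)]])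
        fix w assume "w \<in> LR 1"
        then obtain u d' where "w = u @ d'" "onlyT d'" "onlyM u" "length u = 1" by (auto simp: LR_def)
        then have "w @ [Gt k] \<in> LR 1" unfolding LR_def by (intro CollectI exI[of _ u] exI[of _ "d' @ [Gt k]"]) auto
        then show "wd (w @ [Gt k]) \<in> spanI q (LR 1)" by (rule spanI.word)
      qed
      then show ?thesis using 1 by (simp add: wd_def mult.assoc)
    qed (use snoc.IH[OF d] in simp)
  qed
  then show ?case by (simp add: g wd_def mult.assoc)
qed

lemma T_past_M: "onlyT d \<Longrightarrow> onlyM u \<Longrightarrow> wd (d @ u) \<in> spanI q (LR (length u))"
proof (induction u rule: rev_induct)
  case Nil
  then have "d \<in> LR 0" unfolding LR_def by (intro CollectI exI[of _ "[]"] exI[of _ d]) auto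
  then show ?case by (simp add: spanI.word)
next
  case (snoc m u)
  then have u: "onlyM u" and m: "isM m" by auto
  have "wd (d @ u) * wd [m] \<in> spanI q (LR (Suc (length u)))"
  proof (rule spanI_mult_words(1)[OF snoc.IH[OF snoc.prems(1) u]])
    fix v assume "v \<in> LR (length u)"
    then obtain u' d' where v: "v = u' @ d'" "onlyT d'" "onlyM u'" "length u' = length u" by (auto simp: LR_def)
    have "wd u' * wd (d' @ [m]) \<in> spanI q (LR (Suc (length u)))"
    proof (rule spanI_mult_words(2)[OF T_past_M1[OF v(2) m]])
      fix w assume "w \<in> LR 1"
      then obtain a e where "w = a @ e" "onlyT e" "onlyM a" "length a = 1" by (auto simp: LR_def)
      then have "u' @ w \<in> LR (Suc (length u))" using v unfolding LR_def by (intro CollectI exI[of _ "u' @ a"] exI[of _ e]) auto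
      then show "wd (u' @ w) \<in> spanI q (LR (Suc (length u)))" by (rule spanI.word)
    qed
    then show "wd (v @ [m]) \<in> spanI q (LR (Suc (length u)))" using v by (simp add: wd_def mult.assoc)
  qed
  then show ?case by (simp add: wd_def mult.assoc)
qed

lemma GM_span: "x \<in> range G \<or> isM x \<Longrightarrow> P \<in> spanI q LL \<Longrightarrow> wd [x] * P \<in> spanI q LL"
proof (erule spanI_mult_words(2))
  fix v assume x: "x \<in> range G \<or> isM x" and "v \<in> LL"
  then obtain c u where v: "v = c @ u" "onlyG c" "onlyM u" by (auto simp: LL_def LM_def)
  from x show "wd ([x] @ v) \<in> spanI q LL"
  proof
    assume "x \<in> range G"
    then have "[x] @ v \<in> LL" using v unfolding LL_def LM_def by (intro UN_I[of "length u"] CollectI exI[of _ "x # c"] exI[of _ u]) auto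
    then show ?thesis by (rule spanI.word)
  next
    assume "isM x"
    have "wd (x # c) * wd u \<in> spanI q LL"
    proof (rule spanI_mult_words(1)[OF M_past_G[OF \<open>isM x\<close> v(2)]])
      fix w assume "w \<in> LM 1"
      then obtain c' a where "w = c' @ a" "onlyG c'" "onlyM a" by (auto simp: LM_def)
      then have "w @ u \<in> LL" using v unfolding LL_def LM_def
        by (intro UN_I[of "length (a @ u)"] CollectI exI[of _ c'] exI[of _ "a @ u"]) auto
      then show "wd (w @ u) \<in> spanI q LL" by (rule spanI.word)
    qed
    then show ?thesis using v by (simp add: wd_def mult.assoc)
  qed
qed

text \<open>
  Letters \<open>Gt\<close> are first eliminated through \<open>Gt k = G k + (q + 1/q) [Wneg 0, Wpos k]\<close>. They come back
  only when the letters \<open>W\<close> are sorted.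
\<close>

lemma word_LL: "wd w \<in> spanI q LL"
proof (induction w)
  case Nil
  have "[] \<in> LL" unfolding LL_def LM_def by (intro UN_I[of 0] CollectI exI[of _ "[]"]) auto
  then show ?case by (rule spanI.word)
next
  case (Cons x w)
  have eq: "wd (x # w) = wd [x] * wd w" by (simp add: wd_def)
  show ?case
  proof (cases "x \<in> range G \<or> isM x")
    case True
    then show ?thesis unfolding eq by (rule GM_span[OF _ Cons])
  next
    case False
    then obtain k where x: "x = Gt k" by (cases x) auto
    let ?p = "q + inverse q"
    have "- const ?p * (comm (vA 0) (vB k) - const (inverse ?p) * (vD k - vC k)) \<in> aq_ideal q"
      by (rule aq_ideal_closed(3)[OF aq_rel_ideal[OF aq_rel.intros(1)]])
    moreover have "const ?p * (const (inverse ?p) * X) = X" for X :: "('f, alt_gen) free_algebra"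
      using p0 by (simp add: const_one flip: const_mult mult.assoc)
    ultimately have "(vD k - (vC k + const ?p * comm (vA 0) (vB k))) * wd w \<in> aq_ideal q"
      by (intro aq_ideal_closed(4)) (simp add: right_diff_distrib algebra_simps)
    moreover have "(vC k + const ?p * comm (vA 0) (vB k)) * wd w =
       wd [G k] * wd w + const ?p * (wd [Wneg 0] * (wd [Wpos k] * wd w) - wd [Wpos k] * (wd [Wneg 0] * wd w))"
      by (simp add: wd_1 comm_def distrib_right left_diff_distrib mult.assoc)
    moreover have "\<dots> \<in> spanI q LL"
      by (intro spanI.add spanI.scale spanI_diff GM_span Cons) auto
    ultimately have "vD k * wd w \<in> spanI q LL"
      by (intro spanI_cong[of "vD k * wd w" "(vC k + const ?p * comm (vA 0) (vB k)) * wd w"]) (simp_all add: left_diff_distrib)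
    then show ?thesis by (simp add: x wd_Cons)
  qed
qed

end

section \<open>Spanning by sorted words\<close>

text \<open>
  \<open>AB n\<close>: sorted words of \<open>n\<close> letters \<open>W\<close>. \<open>Low n\<close>: words with fewer than \<open>n\<close> letters \<open>W\<close>, enclosed by letters
  \<open>G\<close> and \<open>Gt\<close>. \<open>KK\<close>: words in which the four blocks are in order.
\<close>

definition AB where "AB n = {a @ b | a b. set a \<subseteq> range Wneg \<and> set b \<subseteq> range Wpos \<and> length (a @ b) = n}"
definition Low where "Low n = {c @ w @ d | c w d. onlyG c \<and> onlyM w \<and> onlyT d \<and> length w < n}"
definition KK where "KK = {c @ a @ b @ d | c a b d. onlyG c \<and> set a \<subseteq> range Wneg \<and> set b \<subseteq> range Wpos \<and> onlyT d}"

lemma LowI: "onlyG c \<Longrightarrow> onlyM w \<Longrightarrow> onlyT d \<Longrightarrow> length w < n \<Longrightarrow> c @ w @ d \<in> Low n"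
  unfolding Low_def by blast
lemma ABI: "set a \<subseteq> range Wneg \<Longrightarrow> set b \<subseteq> range Wpos \<Longrightarrow> length (a @ b) = n \<Longrightarrow> a @ b \<in> AB n"
  unfolding AB_def by blast
lemma KKI: "onlyG c \<Longrightarrow> set a \<subseteq> range Wneg \<Longrightarrow> set b \<subseteq> range Wpos \<Longrightarrow> onlyT d \<Longrightarrow> c @ a @ b @ d \<in> KK"
  unfolding KK_def by blast

lemma insert_sorted:
  assumes total: "\<And>x y. ord x y \<or> ord y x" and trans: "\<And>x y z. ord x y \<Longrightarrow> ord y z \<Longrightarrow> ord x z"
  shows "sorted_wrt ord v \<Longrightarrow> \<exists>v'. mset v' = add_mset x (mset v) \<and> sorted_wrt ord v'"
proof (induction v)
  case Nil
  then show ?case by (intro exI[of _ "[x]"]) simp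
next
  case (Cons y v)
  show ?case
  proof (cases "ord x y")
    case True
    then show ?thesis using Cons.prems trans by (intro exI[of _ "x # y # v"]) auto
  next
    case False
    then have yx: "ord y x" using total by blast
    obtain v' where v': "mset v' = add_mset x (mset v)" "sorted_wrt ord v'" using Cons by auto
    have "set v' = insert x (set v)" using arg_cong[OF v'(1), of set_mset] by simp
    then show ?thesis using v' yx Cons.prems by (intro exI[of _ "y # v'"]) auto
  qed
qed

lemma ex_sorted:
  assumes total: "\<And>x y. ord x y \<or> ord y x" and trans: "\<And>x y z. ord x y \<Longrightarrow> ord y z \<Longrightarrow> ord x z"
  shows "\<exists>v. mset v = mset u \<and> sorted_wrt ord v"
proof (induction u)
  case (Cons x u)
  then obtain v where "mset v = mset u" "sorted_wrt ord v" by blast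
  then show ?case using insert_sorted[of ord v x, OF total trans] by auto
qed simp

lemma sorted_unique:
  assumes anti: "\<And>x y. ord x y \<Longrightarrow> ord y x \<Longrightarrow> x = y"
  shows "sorted_wrt ord u \<Longrightarrow> sorted_wrt ord v \<Longrightarrow> mset u = mset v \<Longrightarrow> u = v"
proof (induction u arbitrary: v)
  case (Cons x u)
  then obtain y v' where v: "v = y # v'" by (cases v) auto
  have sets: "insert x (set u) = insert y (set v')" using arg_cong[OF Cons.prems(3), of set_mset] v by simp
  have "x = y"
    using sets Cons.prems(1,2) v anti[of x y] by (metis insertE insertI1 sorted_wrt.simps(2))
  then show ?case using Cons v by auto
qed simp

context
  fixes q :: "'f::field"
  assumes q: "q \<noteq> 0" and h0: "q - inverse q \<noteq> 0" and p0: "q + inverse q \<noteq> 0"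
begin

lemmas mw = spanI_mult_words[OF q h0 p0]

lemma M_Low: "isM m \<Longrightarrow> P \<in> spanI q (Low n) \<Longrightarrow> wd [m] * P \<in> spanI q (Low (Suc n))"
proof (erule mw(2))
  fix v assume m: "isM m" and "v \<in> Low n"
  then obtain c w d where v: "v = c @ w @ d" "onlyG c" "onlyM w" "onlyT d" "length w < n" by (auto simp: Low_def)
  have "wd (m # c) * wd (w @ d) \<in> spanI q (Low (Suc n))"
  proof (rule mw(1)[OF M_past_G[OF q h0 p0 m v(2)]])
    fix x assume "x \<in> LM 1"
    then obtain c' a where x: "x = c' @ a" "onlyG c'" "onlyM a" "length a = 1" by (auto simp: LM_def)
    have "c' @ (a @ w) @ d \<in> Low (Suc n)" using x v by (intro LowI) auto
    then show "wd (x @ w @ d) \<in> spanI q (Low (Suc n))" using x(1) by (simp add: spanI.word)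
  qed
  then show "wd ([m] @ v) \<in> spanI q (Low (Suc n))" using v by (simp add: wd_def mult.assoc)
qed

lemma Low_M: "onlyM b \<Longrightarrow> P \<in> spanI q (Low n) \<Longrightarrow> P * wd b \<in> spanI q (Low (n + length b))"
proof (erule mw(1))
  fix v assume b: "onlyM b" and "v \<in> Low n"
  then obtain c w d where v: "v = c @ w @ d" "onlyG c" "onlyM w" "onlyT d" "length w < n" by (auto simp: Low_def)
  have "wd (c @ w) * wd (d @ b) \<in> spanI q (Low (n + length b))"
  proof (rule mw(2)[OF T_past_M[OF q h0 p0 v(4) b]])
    fix x assume "x \<in> LR (length b)"
    then obtain a d' where x: "x = a @ d'" "onlyM a" "onlyT d'" "length a = length b" by (auto simp: LR_def)
    have "c @ (w @ a) @ d' \<in> Low (n + length b)" using x v by (intro LowI) auto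
    then show "wd ((c @ w) @ x) \<in> spanI q (Low (n + length b))" using x(1) by (simp add: spanI.word)
  qed
  then show "wd (v @ b) \<in> spanI q (Low (n + length b))" using v by (simp add: wd_def mult.assoc)
qed

lemma spanI_mono: "P \<in> spanI q K \<Longrightarrow> K \<subseteq> L \<Longrightarrow> P \<in> spanI q L"
  by (erule spanI_sub) (auto intro: spanI.word)

text \<open>
  Each exchange costs a commutator, in which two letters \<open>W\<close> are replaced by letters \<open>G\<close> and \<open>Gt\<close>; the
  letters \<open>Gt\<close> then move to the right end.
\<close>

lemma pos_past_neg: "set a \<subseteq> range Wneg \<Longrightarrow> wd (Wpos j # a) \<in> spanI q (insert (a @ [Wpos j]) (Low (Suc (length a))))"
proof (induction a)
  case Nil
  show ?case by (rule spanI.word) simp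
next
  case (Cons x a)
  then obtain i where x: "x = Wneg i" and a: "set a \<subseteq> range Wneg" by auto
  have "wd [Wpos j, Wneg i] = wd [Wneg i, Wpos j] - comm (var (Wneg i)) (var (Wpos j))" by (simp add: wd_2 comm_def)
  also have "\<dots> \<in> spanI q (insert [Wneg i, Wpos j] LCD)"
    by (rule spanI_diff[OF spanI.word spanI_mono[OF comm_AB[OF q h0 p0]]]) auto
  finally have "wd [Wpos j, Wneg i] * wd a \<in> spanI q (insert ((x # a) @ [Wpos j]) (Low (Suc (length (x # a)))))"
  proof (rule mw(1))
    fix v assume "v \<in> insert [Wneg i, Wpos j] LCD"
    then show "wd (v @ a) \<in> spanI q (insert ((x # a) @ [Wpos j]) (Low (Suc (length (x # a)))))"
    proof
      assume v: "v = [Wneg i, Wpos j]"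
      have "wd [Wneg i] * wd (Wpos j # a) \<in> spanI q (insert ((x # a) @ [Wpos j]) (Low (Suc (length (x # a)))))"
      proof (rule mw(2)[OF Cons.IH[OF a]])
        fix w assume "w \<in> insert (a @ [Wpos j]) (Low (Suc (length a)))"
        then show "wd ([Wneg i] @ w) \<in> spanI q (insert ((x # a) @ [Wpos j]) (Low (Suc (length (x # a)))))"
        proof
          assume "w \<in> Low (Suc (length a))"
          then have "wd [Wneg i] * wd w \<in> spanI q (Low (Suc (Suc (length a))))"
            by (intro M_Low spanI.word) auto
          then have "wd [Wneg i] * wd w \<in> spanI q (insert ((x # a) @ [Wpos j]) (Low (Suc (length (x # a)))))" by (rule spanI_mono) auto
          then show ?thesis by (simp add: wd_def)
        qed (auto simp: x intro: spanI.word)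
      qed
      then show ?thesis using v by (simp add: wd_def mult.assoc)
    next
      assume "v \<in> LCD"
      then obtain c d where v: "v = c @ d" "onlyG c" "onlyT d" by (auto simp: LCD_def)
      have aM: "onlyM a" using a by auto
      have "wd c * wd (d @ a) \<in> spanI q (insert ((x # a) @ [Wpos j]) (Low (Suc (length (x # a)))))"
      proof (rule mw(2)[OF T_past_M[OF q h0 p0 v(3) aM]])
        fix w assume "w \<in> LR (length a)"
        then obtain u d' where w: "w = u @ d'" "onlyM u" "onlyT d'" "length u = length a" by (auto simp: LR_def)
        have "c @ u @ d' \<in> Low (Suc (length (x # a)))" using w v by (intro LowI) auto
        then show "wd (c @ w) \<in> spanI q (insert ((x # a) @ [Wpos j]) (Low (Suc (length (x # a)))))"
          using w by (intro spanI.word) simp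
      qed
      then show ?thesis using v by (simp add: wd_def mult.assoc)
    qed
  qed
  then show ?case by (simp add: x wd_def mult.assoc)
qed

lemma M_sort: "onlyM u \<Longrightarrow> wd u \<in> spanI q (AB (length u) \<union> Low (length u))"
proof (induction u)
  case Nil
  have "[] @ [] \<in> AB 0" by (rule ABI) auto
  then show ?case by (intro spanI.word) simp
next
  case (Cons m u)
  then have m: "isM m" and u: "onlyM u" by auto
  have "wd [m] * wd u \<in> spanI q (AB (length (m # u)) \<union> Low (length (m # u)))"
  proof (rule mw(2)[OF Cons.IH[OF u]])
    fix v assume "v \<in> AB (length u) \<union> Low (length u)"
    then show "wd ([m] @ v) \<in> spanI q (AB (length (m # u)) \<union> Low (length (m # u)))"
    proof
      assume "v \<in> Low (length u)"
      then have "wd [m] * wd v \<in> spanI q (Low (Suc (length u)))" by (intro M_Low m spanI.word)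
      then have "wd [m] * wd v \<in> spanI q (AB (length (m # u)) \<union> Low (length (m # u)))" by (rule spanI_mono) auto
      then show ?thesis by (simp add: wd_def)
    next
      assume "v \<in> AB (length u)"
      then obtain a b where v: "v = a @ b" and a: "set a \<subseteq> range Wneg" and b: "set b \<subseteq> range Wpos" and l: "length (a @ b) = length u"
        by (auto simp: AB_def)
      from m show ?thesis
      proof
        assume "m \<in> range Wneg"
        then have "(m # a) @ b \<in> AB (length (m # u))" using a b l by (intro ABI) auto
        then show ?thesis using v by (intro spanI.word) simp
      next
        assume "m \<in> range Wpos"
        then obtain j where mj: "m = Wpos j" by auto
        have "wd (Wpos j # a) * wd b \<in> spanI q (AB (length (m # u)) \<union> Low (length (m # u)))"
        proof (rule mw(1)[OF pos_past_neg[OF a]])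
          fix w assume "w \<in> insert (a @ [Wpos j]) (Low (Suc (length a)))"
          then show "wd (w @ b) \<in> spanI q (AB (length (m # u)) \<union> Low (length (m # u)))"
          proof
            assume w: "w = a @ [Wpos j]"
            have "a @ (Wpos j # b) \<in> AB (length (m # u))" using a b l by (intro ABI) auto
            then show ?thesis using w by (intro spanI.word) simp
          next
            assume "w \<in> Low (Suc (length a))"
            moreover have "onlyM b" using b by auto
            ultimately have "wd w * wd b \<in> spanI q (Low (Suc (length a) + length b))" by (intro Low_M spanI.word)
            then have "wd w * wd b \<in> spanI q (AB (length (m # u)) \<union> Low (length (m # u)))" by (rule spanI_mono) (use l in auto)
            then show ?thesis by (simp add: wd_def)
          qed
        qed
        then show ?thesis using v mj by (simp add: wd_def mult.assoc)
      qed
    qed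
  qed
  then show ?case by (simp add: wd_def)
qed

text \<open>
  Sorting leaves words with fewer letters \<open>W\<close>, to which the same applies.
\<close>

lemma M_KK: "onlyM u \<Longrightarrow> wd u \<in> spanI q KK"
proof (induction u rule: length_induct)
  case (1 u)
  show ?case
  proof (rule spanI_sub[OF M_sort[OF 1(2)]])
    fix v assume "v \<in> AB (length u) \<union> Low (length u)"
    then show "wd v \<in> spanI q KK"
    proof
      assume "v \<in> AB (length u)"
      then obtain a b where v: "v = a @ b" and a: "set a \<subseteq> range Wneg" and b: "set b \<subseteq> range Wpos" by (auto simp: AB_def)
      have "[] @ a @ b @ [] \<in> KK" using a b by (intro KKI) auto
      then show ?thesis using v by (intro spanI.word) simp
    next
      assume "v \<in> Low (length u)"
      then obtain c w d where v: "v = c @ w @ d" "onlyG c" "onlyM w" "onlyT d" "length w < length u" by (auto simp: Low_def)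
      have w: "wd w \<in> spanI q KK" using 1(1) v by blast
      have "wd c * wd w \<in> spanI q KK"
      proof (rule mw(2)[OF w])
        fix x assume "x \<in> KK"
        then obtain c' a b d' where x: "x = c' @ a @ b @ d'" "onlyG c'" "set a \<subseteq> range Wneg" "set b \<subseteq> range Wpos" "onlyT d'" by (auto simp: KK_def)
        have "(c @ c') @ a @ b @ d' \<in> KK" using x v by (intro KKI) auto
        then show "wd (c @ x) \<in> spanI q KK" using x(1) by (intro spanI.word) simp
      qed
      then have "wd c * wd w * wd d \<in> spanI q KK"
      proof (rule mw(1))
        fix x assume "x \<in> KK"
        then obtain c' a b d' where x: "x = c' @ a @ b @ d'" "onlyG c'" "set a \<subseteq> range Wneg" "set b \<subseteq> range Wpos" "onlyT d'" by (auto simp: KK_def)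
        have "c' @ a @ b @ (d' @ d) \<in> KK" using x v by (intro KKI) auto
        then show "wd (x @ d) \<in> spanI q KK" using x(1) by (intro spanI.word) simp
      qed
      then show ?thesis using v by (simp add: wd_def mult.assoc)
    qed
  qed
qed

lemma word_KK: "wd w \<in> spanI q KK"
proof (rule spanI_sub[OF word_LL[OF q h0 p0]])
  fix v assume "v \<in> LL"
  then obtain c u where v: "v = c @ u" "onlyG c" "onlyM u" by (auto simp: LL_def LM_def)
  have "wd c * wd u \<in> spanI q KK"
  proof (rule mw(2)[OF M_KK[OF v(3)]])
    fix x assume "x \<in> KK"
    then obtain c' a b d' where x: "x = c' @ a @ b @ d'" "onlyG c'" "set a \<subseteq> range Wneg" "set b \<subseteq> range Wpos" "onlyT d'" by (auto simp: KK_def)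
    have "(c @ c') @ a @ b @ d' \<in> KK" using x v by (intro KKI) auto
    then show "wd (c @ x) \<in> spanI q KK" using x(1) by (intro spanI.word) simp
  qed
  then show "wd v \<in> spanI q KK" using v by (simp add: wd_def)
qed

text \<open>
  Within a set of letters that commute modulo the relations, only the multiset of a word matters.
\<close>

lemma perm_cong:
  assumes S: "\<And>x y. x \<in> S \<Longrightarrow> y \<in> S \<Longrightarrow> comm (var x) (var y) \<in> aq_ideal q"
  shows "set u \<subseteq> S \<Longrightarrow> mset u = mset v \<Longrightarrow> wd u - wd v \<in> aq_ideal q"
proof (induction u arbitrary: v)
  case Nil
  then show ?case by (simp add: aq_ideal_closed(1))
next
  case (Cons x u)
  have move: "set (x # v1) \<subseteq> S \<Longrightarrow> wd (x # v1 @ v2) - wd (v1 @ x # v2) \<in> aq_ideal q" for v1 v2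
  proof (induction v1)
    case Nil
    then show ?case by (simp add: aq_ideal_closed(1))
  next
    case (Cons y v1)
    have "wd (x # (y # v1) @ v2) - wd ((y # v1) @ x # v2) =
       comm (var x) (var y) * wd (v1 @ v2) + var y * (wd (x # v1 @ v2) - wd (v1 @ x # v2))"
      by (simp add: wd_Cons comm_def algebra_simps)
    also have "\<dots> \<in> aq_ideal q"
      using Cons.prems by (intro aq_ideal_closed(2) aq_ideal_closed(4)[OF S] aq_ideal_closed(3)[OF Cons.IH]) auto
    finally show ?case .
  qed
  have "x \<in> set v" using Cons.prems(2) by (metis list.set_intros(1) set_mset_mset)
  then obtain v1 v2 where v: "v = v1 @ x # v2" by (auto dest: split_list)
  have "set v = insert x (set u)" using arg_cong[OF Cons.prems(2), of set_mset] by simp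
  then have vS: "set (x # v1) \<subseteq> S" using Cons.prems(1) v by auto
  have "mset u = mset (v1 @ v2)" using Cons.prems(2) v by simp
  then have "wd u - wd (v1 @ v2) \<in> aq_ideal q" using Cons by simp
  then have "var x * (wd u - wd (v1 @ v2)) + (wd (x # v1 @ v2) - wd (v1 @ x # v2)) \<in> aq_ideal q"
    by (intro aq_ideal_closed(2,3) move[OF vS])
  then show ?case using v by (simp add: wd_Cons right_diff_distrib)
qed

text \<open>
  A word whose four blocks are in order becomes sorted when each block is permuted.
\<close>

theorem sorted_span:
  assumes total: "\<And>x y. ord x y \<or> ord y x" and trans: "\<And>x y z. ord x y \<Longrightarrow> ord y z \<Longrightarrow> ord x z"
    and types: "\<And>i j. ord (G i) (Wneg j)" "\<And>i j. ord (Wneg i) (Wpos j)" "\<And>i j. ord (Wpos i) (Gt j)"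
  shows "P \<in> spanI q {u. sorted_wrt ord u}"
proof -
  note comms = rel_var(1-4)[OF q h0 p0]
  have ex: "\<exists>v. mset v = mset u \<and> sorted_wrt ord v" for u
    by (rule ex_sorted) (rule total, erule (1) trans)
  have word: "wd w \<in> spanI q {u. sorted_wrt ord u}" for w
  proof (rule spanI_sub[OF word_KK])
    fix v assume "v \<in> KK"
    then obtain c a b d where v: "v = c @ a @ b @ d" "onlyG c" "set a \<subseteq> range Wneg" "set b \<subseteq> range Wpos" "onlyT d" by (auto simp: KK_def)
    obtain c' where c': "mset c' = mset c" "sorted_wrt ord c'" using ex by blast
    obtain a' where a': "mset a' = mset a" "sorted_wrt ord a'" using ex by blast
    obtain b' where b': "mset b' = mset b" "sorted_wrt ord b'" using ex by blast
    obtain d' where d': "mset d' = mset d" "sorted_wrt ord d'" using ex by blast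
    have sets: "set c' \<subseteq> range G" "set a' \<subseteq> range Wneg" "set b' \<subseteq> range Wpos" "set d' \<subseteq> range Gt"
      using v c' a' b' d' by (metis set_mset_mset)+
    have ord: "ord x y" if "x \<in> range G \<and> y \<in> range Wneg \<union> range Wpos \<union> range Gt \<or> x \<in> range Wneg \<and> y \<in> range Wpos \<union> range Gt \<or> x \<in> range Wpos \<and> y \<in> range Gt" for x y
      using that types trans by (elim disjE conjE UnE rangeE) blast+
    have "sorted_wrt ord (c' @ a' @ b' @ d')"
      unfolding sorted_wrt_append using c' a' b' d' sets by (auto intro!: ord)
    then have sp: "wd (c' @ a' @ b' @ d') \<in> spanI q {u. sorted_wrt ord u}" by (intro spanI.word) simp
    have pc: "wd c - wd c' \<in> aq_ideal q"
    proof (rule perm_cong[of "range G"])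
      show "comm (var x) (var y) \<in> aq_ideal q" if "x \<in> range G" "y \<in> range G" for x y
        using that comms by (elim rangeE) simp
    qed (use v(2) c'(1) in simp_all)
    have pa: "wd a - wd a' \<in> aq_ideal q"
    proof (rule perm_cong[of "range Wneg"])
      show "comm (var x) (var y) \<in> aq_ideal q" if "x \<in> range Wneg" "y \<in> range Wneg" for x y
        using that comms by (elim rangeE) simp
    qed (use v(3) a'(1) in simp_all)
    have pb: "wd b - wd b' \<in> aq_ideal q"
    proof (rule perm_cong[of "range Wpos"])
      show "comm (var x) (var y) \<in> aq_ideal q" if "x \<in> range Wpos" "y \<in> range Wpos" for x y
        using that comms by (elim rangeE) simp
    qed (use v(4) b'(1) in simp_all)
    have pd: "wd d - wd d' \<in> aq_ideal q"
    proof (rule perm_cong[of "range Gt"])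
      show "comm (var x) (var y) \<in> aq_ideal q" if "x \<in> range Gt" "y \<in> range Gt" for x y
        using that comms by (elim rangeE) simp
    qed (use v(5) d'(1) in simp_all)
    have "(wd c - wd c') * (wd a * wd b * wd d) + wd c' * ((wd a - wd a') * (wd b * wd d)) + wd c' * (wd a' * ((wd b - wd b') * wd d))
       + wd c' * (wd a' * (wd b' * (wd d - wd d'))) \<in> aq_ideal q"
      by (intro aq_ideal_closed(2)) (auto intro: aq_ideal_closed(3,4) pc pa pb pd)
    then have "wd v - wd (c' @ a' @ b' @ d') \<in> aq_ideal q"
      by (simp add: v wd_append algebra_simps)
    then show "wd v \<in> spanI q {u. sorted_wrt ord u}" using sp by (rule spanI_cong)
  qed
  show ?thesis
  proof (induction P rule: laurent_induct)
    case (monom w c)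
    obtain xs where w: "w = Word xs" by (cases w)
    have "wd xs = Poly_Mapping.single (Word xs) (1 :: 'f)"
      by (induction xs) (simp_all add: wd_def var_def mult_single flip: single_one zero_word_def)
    then have "Poly_Mapping.single w c = const c * wd xs" by (simp add: w const_def mult_single zero_word_def)
    then show ?case using word[of xs] by (simp add: spanI.scale)
  qed (rule spanI.add)
qed

end

section \<open>The basis of the quotient\<close>

lemma spanI_explicit:
  "P \<in> spanI q L \<Longrightarrow> \<exists>A c. finite A \<and> A \<subseteq> L \<and> P - (\<Sum>u\<in>A. const (c u) * wd u) \<in> aq_ideal q"
proof (induction rule: spanI.induct)
  case (ideal P)
  then show ?case by (intro exI[of _ "{}"]) simp
next
  case (word u)
  then show ?case
    by (intro exI[of _ "{u}"] exI[of _ "\<lambda>_. 1"]) (simp add: const_one aq_ideal_closed(1))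
next
  case (add P Q)
  then obtain A c B d where A: "finite A" "A \<subseteq> L" "P - (\<Sum>u\<in>A. const (c u) * wd u) \<in> aq_ideal q"
    and B: "finite B" "B \<subseteq> L" "Q - (\<Sum>u\<in>B. const (d u) * wd u) \<in> aq_ideal q" by blast
  define e where "e u = (if u \<in> A then c u else 0) + (if u \<in> B then d u else 0)" for u
  have restrict: "(\<Sum>u\<in>A \<union> B. const (if u \<in> C then f u else 0) * wd u) = (\<Sum>u\<in>C. const (f u) * wd u)"
    if "C \<subseteq> A \<union> B" for C :: "alt_gen list set" and f
    by (rule sum.mono_neutral_cong_right) (use A(1) B(1) that in \<open>auto simp: const_0\<close>)
  have "(\<Sum>u\<in>A \<union> B. const (e u) * wd u) = (\<Sum>u\<in>A. const (c u) * wd u) + (\<Sum>u\<in>B. const (d u) * wd u)"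
    unfolding e_def const_add distrib_right sum.distrib by (simp add: restrict)
  then have "P + Q - (\<Sum>u\<in>A \<union> B. const (e u) * wd u) =
      (P - (\<Sum>u\<in>A. const (c u) * wd u)) + (Q - (\<Sum>u\<in>B. const (d u) * wd u))" by simp
  also have "\<dots> \<in> aq_ideal q" by (intro aq_ideal_closed(2) A B)
  finally show ?case using A(1,2) B(1,2) by blast
next
  case (scale P k)
  then obtain A c where A: "finite A" "A \<subseteq> L" "P - (\<Sum>u\<in>A. const (c u) * wd u) \<in> aq_ideal q" by blast
  have "const k * P - (\<Sum>u\<in>A. const (k * c u) * wd u) = const k * (P - (\<Sum>u\<in>A. const (c u) * wd u))"
    by (simp add: right_diff_distrib sum_distrib_left const_mult mult.assoc)
  also have "\<dots> \<in> aq_ideal q" by (rule aq_ideal_closed(3)[OF A(3)])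
  finally show ?case using A(1,2) by (intro exI[of _ A] exI[of _ "\<lambda>u. k * c u"]) simp
qed

text \<open>
  The projection to the quotient, through which all operations of \<^term>\<open>Aq q\<close> are expressed.
\<close>

definition cls :: "'f::field \<Rightarrow> ('f, alt_gen) free_algebra \<Rightarrow> ('f, alt_gen) free_algebra set" where
  "cls q X = aq_ideal q +>\<^bsub>class_ring\<^esub> X"

lemma cls_eq_iff: "cls q X = cls q Y \<longleftrightarrow> X - Y \<in> aq_ideal q"
proof
  have set: "cls q X = {Z + X | Z. Z \<in> aq_ideal q}" for X
    by (auto simp: cls_def a_r_coset_def')
  {
    assume "cls q X = cls q Y"
    moreover have "X \<in> cls q X" unfolding set by (auto intro!: exI[of _ 0] aq_ideal_closed(1))
    ultimately obtain Z where "Z \<in> aq_ideal q" "X = Z + Y" by (auto simp: set)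
    then show "X - Y \<in> aq_ideal q" by simp
  next
    assume d: "X - Y \<in> aq_ideal q"
    have sub: "cls q X \<subseteq> cls q Y" if "X - Y \<in> aq_ideal q" for X Y
    proof
      fix W assume "W \<in> cls q X"
      then obtain Z where Z: "Z \<in> aq_ideal q" "W = Z + X" by (auto simp: set)
      then have "W = (Z + (X - Y)) + Y" "Z + (X - Y) \<in> aq_ideal q"
        using that by (auto intro: aq_ideal_closed(2))
      then show "W \<in> cls q Y" unfolding set by blast
    qed
    show "cls q X = cls q Y" using sub[OF d] sub[of Y X] aq_ideal_minus[OF d] by simp
  }
qed

lemma
  shows carrier_Aq: "carrier (Aq q) = range (cls q)"
    and cls_mult: "cls q X \<otimes>\<^bsub>Aq q\<^esub> cls q Y = cls q (X * Y)"
    and cls_add: "cls q X \<oplus>\<^bsub>Aq q\<^esub> cls q Y = cls q (X + Y)"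
    and cls_one: "\<one>\<^bsub>Aq q\<^esub> = cls q 1"
    and cls_zero: "\<zero>\<^bsub>Aq q\<^esub> = cls q 0"
    and cls_smult: "c \<odot>\<^bsub>Aq q\<^esub> cls q X = cls q (const c * X)"
proof -
  let ?Q = "class_ring Quot aq_ideal q"
  interpret R: ring "class_ring :: ('a, alt_gen) free_algebra ring" by (rule class_ring.ring_axioms)
  interpret Q: ring ?Q by (rule ideal.quotient_is_ring[OF ideal_aq_ideal])
  have eq: "cls q = a_r_coset class_ring (aq_ideal q)" by (simp add: cls_def fun_eq_iff)
  interpret h: ring_hom_ring class_ring ?Q "cls q"
    unfolding eq by (rule ideal.rcos_ring_hom_ring[OF ideal_aq_ideal])
  show "carrier (Aq q) = range (cls q)"
    by (auto simp: Aq_simps FactRing_def A_RCOSETS_def' cls_def)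
  show m: "cls q X \<otimes>\<^bsub>Aq q\<^esub> cls q Y = cls q (X * Y)" for X Y
    using h.hom_mult[of X Y] by (simp add: Aq_simps(1-5))
  show "cls q X \<oplus>\<^bsub>Aq q\<^esub> cls q Y = cls q (X + Y)"
    using h.hom_add[of X Y] by (simp add: Aq_simps(1-5))
  show "\<one>\<^bsub>Aq q\<^esub> = cls q 1" using h.hom_one by (simp add: Aq_simps(1-5))
  show "\<zero>\<^bsub>Aq q\<^esub> = cls q 0" using h.hom_zero by (simp add: Aq_simps(1-5))
  show "c \<odot>\<^bsub>Aq q\<^esub> cls q X = cls q (const c * X)"
    using m[of "const c" X] by (simp add: Aq_simps cls_def)
qed

lemma list_prod_alt: "list_prod (Aq q) (map (alt q) u) = cls q (wd u)"
proof (induction u)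
  case Nil
  show ?case by (simp add: list_prod_def cls_one wd_def)
next
  case (Cons x u)
  have "alt q x = cls q (var x)" by (simp add: alt_def cls_def)
  with Cons show ?case by (simp add: list_prod_def cls_mult wd_def)
qed

lemma finsum_cls:
  assumes "finite A"
  shows "finsum (Aq q) (\<lambda>u. cls q (f u)) A = cls q (\<Sum>u\<in>A. f u)"
proof -
  interpret A: ring "Aq q" by (rule ring_Aq)
  have cl: "cls q X \<in> carrier (Aq q)" for X by (simp add: carrier_Aq)
  show ?thesis using assms
    by (induction A) (simp_all add: A.finsum_insert Pi_def cl cls_add cls_zero A.finsum_empty)
qed

text \<open>
  Passage from independence and spanning, as statements about the free algebra modulo the ideal, to the
  notion of a basis of the quotient.
\<close>

lemma basis_family:
  fixes q :: "'f::field"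
  assumes inj: "inj_on (\<lambda>u. cls q (wd u)) L"
    and indep: "\<And>U c. finite U \<Longrightarrow> U \<subseteq> L \<Longrightarrow> (\<Sum>u\<in>U. const (c u) * wd u) \<in> aq_ideal q \<Longrightarrow> \<forall>u\<in>U. c u = 0"
    and span: "\<And>P. P \<in> spanI q L"
  shows "vectorspace.basis class_ring (Aq q) ((\<lambda>u. cls q (wd u)) ` L)"
proof -
  interpret V: vectorspace class_ring "Aq q" by (rule vectorspace_Aq)
  define b where "b u = cls q (wd u)" for u
  have lincomb: "V.lincomb a (b ` U) = cls q (\<Sum>u\<in>U. const (a (b u)) * wd u)"
    if U: "finite U" "U \<subseteq> L" for U a
  proof -
    have ib: "inj_on b U" using inj U(2) unfolding b_def by (rule inj_on_subset)
    have "V.lincomb a (b ` U) = finsum (Aq q) (\<lambda>u. cls q (const (a (b u)) * wd u)) U"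
      unfolding V.lincomb_def
      by (subst V.finsum_reindex[OF _ ib]) (auto simp: b_def cls_smult carrier_Aq)
    then show ?thesis by (simp add: finsum_cls[OF U(1)])
  qed
  have sub: "b ` L \<subseteq> carrier (Aq q)" by (auto simp: b_def carrier_Aq)
  have "\<not> V.lin_dep (b ` L)"
  proof
    assume "V.lin_dep (b ` L)"
    then obtain A a v where A: "finite A" "A \<subseteq> b ` L" "V.lincomb a A = \<zero>\<^bsub>Aq q\<^esub>" "v \<in> A" "a v \<noteq> 0"
      unfolding V.lin_dep_def by auto
    obtain U where U: "U \<subseteq> L" "finite U" "A = b ` U" using finite_subset_image[OF A(1,2)] by blast
    have "(\<Sum>u\<in>U. const (a (b u)) * wd u) \<in> aq_ideal q"
      using A(3) unfolding U(3) lincomb[OF U(2,1)] cls_zero cls_eq_iff by simp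
    then show False using indep[OF U(2,1), of "\<lambda>u. a (b u)"] A(4,5) U(3) by blast
  qed
  moreover have "V.gen_set (b ` L)"
  proof (intro subset_antisym V.span_is_subset2[OF sub] subsetI)
    fix x assume "x \<in> carrier (Aq q)"
    then obtain P where P: "x = cls q P" by (auto simp: carrier_Aq)
    obtain U c where U: "finite U" "U \<subseteq> L" "P - (\<Sum>u\<in>U. const (c u) * wd u) \<in> aq_ideal q"
      using spanI_explicit[OF span] by blast
    define a where "a y = c (inv_into L b y)" for y
    have "inj_on b L" using inj by (simp add: b_def[abs_def])
    then have "a (b u) = c u" if "u \<in> U" for u
      using that U(2) by (auto simp: a_def inv_into_f_f)
    then have "x = V.lincomb a (b ` U)"
      unfolding lincomb[OF U(1,2)] P cls_eq_iff using U(3) by simp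
    then show "x \<in> V.span (b ` L)" unfolding V.span_def using U(1,2) by (auto intro!: exI[of _ "b ` U"] exI[of _ a])
  qed
  ultimately show ?thesis using sub unfolding V.basis_def by (simp add: b_def[abs_def])
qed

theorem theorem6p1:
  fixes q :: "'f::field"
  assumes "q \<noteq> 0" and "\<And>n::nat. n > 0 \<Longrightarrow> q ^ n \<noteq> 1"
  shows "inj (alt q) \<and>
    (\<forall>r. linear_order_on (range (alt q)) r \<and>
         (\<forall>i j. (alt q (G i), alt q (Wneg j)) \<in> r - Id) \<and>
         (\<forall>j k. (alt q (Wneg j), alt q (Wpos k)) \<in> r - Id) \<and>
         (\<forall>k l. (alt q (Wpos k), alt q (Gt l)) \<in> r - Id) \<longrightarrow>
         pbw_basis (Aq q) (range (alt q)) r)"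
proof -
  have "q * q \<noteq> 1" using assms(2)[of 2] by (simp add: power2_eq_square)
  then have h0: "q - inverse q \<noteq> 0" using assms(1) by (auto simp: field_simps)
  have p0: "q + inverse q \<noteq> 0"
  proof
    assume "q + inverse q = 0"
    then have "q * q = - 1" using assms(1) by (simp add: field_simps eq_neg_iff_add_eq_0)
    then have "q ^ 4 = 1" by (simp add: numeral_eq_Suc flip: mult.assoc)
    then show False using assms(2)[of 4] by simp
  qed
  have indep: "\<forall>u\<in>U. c u = 0"
    if "finite U" "inj_on mset U" "(\<Sum>u\<in>U. const (c u) * wd u) \<in> aq_ideal q" for U :: "alt_gen list set" and c
    using words_independent[OF assms(1) h0 p0 that[unfolded wd_def]] .
  have eq: "u = v" if "cls q (wd u) = cls q (wd v)" "mset u = mset v \<longrightarrow> u = v" for u v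
  proof (rule ccontr)
    assume ne: "u \<noteq> v"
    define c :: "alt_gen list \<Rightarrow> 'f" where "c w = (if w = u then 1 else - 1)" for w
    have "const (- 1) = (- 1 :: ('f, alt_gen) free_algebra)"
      using const_diff[of 0 "1 :: 'f"] by (simp add: const_one const_0)
    then have "(\<Sum>w\<in>{u, v}. const (c w) * wd w) = wd u - wd v"
      using ne by (simp add: c_def const_one)
    then have "(\<Sum>w\<in>{u, v}. const (c w) * wd w) \<in> aq_ideal q"
      using that(1) by (simp add: cls_eq_iff)
    then have "\<forall>w\<in>{u, v}. c w = 0" using that(2) ne by (intro indep) (auto simp: inj_on_def)
    then show False by (simp add: c_def)
  qed
  have inj_alt: "inj (alt q)"
  proof
    fix x y assume "alt q x = alt q y"
    then have "[x] = [y]" by (intro eq) (simp_all add: wd_def alt_def cls_def)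
    then show "x = y" by simp
  qed
  show ?thesis
  proof (intro conjI allI impI inj_alt, elim conjE)
    fix r
    assume lin: "linear_order_on (range (alt q)) r"
      and GW: "\<forall>i j. (alt q (G i), alt q (Wneg j)) \<in> r - Id"
      and WW: "\<forall>j k. (alt q (Wneg j), alt q (Wpos k)) \<in> r - Id"
      and WGt: "\<forall>k l. (alt q (Wpos k), alt q (Gt l)) \<in> r - Id"
    define ord where "ord x y \<longleftrightarrow> (alt q x, alt q y) \<in> r" for x y
    define L where "L = {u. sorted_wrt ord u}"
    have refl: "refl_on (range (alt q)) r" and tr: "trans r" and an: "antisym r" and tot: "total_on (range (alt q)) r"
      using lin by (auto simp: order_on_defs)
    have total: "ord x y \<or> ord y x" for x y
      using refl tot inj_alt by (cases "x = y") (auto simp: ord_def refl_on_def total_on_def inj_eq)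
    have trans: "ord x z" if "ord x y" "ord y z" for x y z
      using that tr unfolding ord_def by (rule_tac transD)
    have anti: "x = y" if "ord x y" "ord y x" for x y
      by (rule injD[OF inj_alt antisymD[OF an]]) (use that in \<open>simp_all add: ord_def\<close>)
    have injL: "inj_on (\<lambda>u. cls q (wd u)) L"
      by (intro inj_onI eq) (auto simp: L_def intro: sorted_unique[of ord] anti)
    have indepL: "\<forall>u\<in>U. c u = 0" if "finite U" "U \<subseteq> L" "(\<Sum>u\<in>U. const (c u) * wd u) \<in> aq_ideal q" for U c
    proof (rule indep[OF that(1) _ that(3)])
      show "inj_on mset U" using that(2) unfolding L_def
        by (intro inj_onI sorted_unique[of ord]) (auto intro: anti)
    qed
    have spanL: "P \<in> spanI q L" for P
      unfolding L_def by (rule sorted_span[OF assms(1) h0 p0]; (rule total | erule (1) trans | use GW WW WGt in \<open>simp add: ord_def\<close>))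
    have S: "{as. set as \<subseteq> range (alt q) \<and> sorted_wrt (\<lambda>a b. (a, b) \<in> r) as} = map (alt q) ` L" (is "?S = _")
    proof (intro subset_antisym subsetI)
      fix as assume as: "as \<in> ?S"
      then have "as \<in> lists (range (alt q))" by (auto simp: in_lists_conv_set)
      then obtain u where "as = map (alt q) u" by (auto simp: lists_image)
      then show "as \<in> map (alt q) ` L" using as by (simp add: L_def ord_def[abs_def] sorted_wrt_map)
    qed (auto simp: L_def ord_def[abs_def] sorted_wrt_map)
    have img: "list_prod (Aq q) ` map (alt q) ` L = (\<lambda>u. cls q (wd u)) ` L"
      by (simp add: image_image list_prod_alt)
    have "inj_on (list_prod (Aq q)) (map (alt q) ` L)"
      using injL by (auto simp: inj_on_def list_prod_alt)
    moreover have "range (alt q) \<subseteq> carrier (Aq q)"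
      by (auto simp: carrier_Aq alt_def cls_def)
    ultimately show "pbw_basis (Aq q) (range (alt q)) r"
      using basis_family[OF injL indepL spanL] lin unfolding pbw_basis_def Let_def S img by blast
  qed
qed

end
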